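(* The following assertions (each one quantified over all $n\ge1$ and all the objects it mentions) are equivalent: 1. For all Hermitian $n\times n$ complex matrices $A_1,A_2$: $\;s(A_1-A_2)\prec_w\mathrm{Spr}^+(A_1\oplus A_2)$. 2. For every Hermitian $2n\times 2n$ complex matrix $A=\begin{pmatrix}A_1 & B \\ B^* & A_2\end{pmatrix}$ with $n\times n$ blocks: $\;2\,s(B)\prec_w\mathrm{Spr}^+(A)$. 3. For all Hermitian $n\times n$ complex matrices $A_1,A_2$ and every $n\times n$ complex matrix $X$: $\;s(A_1X-XA_2)\prec_w s(X)\,\mathrm{Spr}^+(A_1\oplus A_2)$. 4. For all Hermitian $n\times n$ complex matrices $A,X$, with $U=e^{iX}$: $\;s(A-U^*AU)\prec_w s(X)\,\mathrm{Spr}^+(A\oplus A)$. 5. For all subspaces $\mathcal{S},\mathcal{T}\subseteq\mathbb{C}^n$ and every Hermitian $n\times n$ complex matrix $X$ such that $e^{iX}\mathcal{S}=\mathcal{T}$: $\;\Theta(\mathcal{S},\mathcal{T})\prec_w\tfrac12\,\mathrm{Spr}^+(X)$.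
   Context: For a Hermitian $m\times m$ complex matrix $A$, $\lambda(A)=(\lambda_1(A),\dots,\lambda_m(A))$ denotes its eigenvalues, counted with multiplicity, in non-increasing order. The spectral spread of $A$ is $\mathrm{Spr}^+(A)=(\lambda_i(A)-\lambda_{m-i+1}(A))_{1\le i\le [m/2]}\in\mathbb{R}_{\ge 0}^{[m/2]}$, where $[\cdot]$ is the integer part. $A_1\oplus A_2$ is the block diagonal matrix with diagonal blocks $A_1,A_2$. For a complex matrix $C$, $s(C)=\lambda((C^*C)^{1/2})$ is the vector of singular values in non-increasing order. Products of vectors are taken entrywise. Principal angles: if $\mathcal{S},\mathcal{T}\subseteq\mathbb{C}^n$ are $k$-dimensional subspaces and $S,T$ are $n\times k$ isometries ($S^*S=T^*T=I_k$) with ranges $\mathcal{S}$ and $\mathcal{T}$, then $\Theta(\mathcal{S},\mathcal{T})=(\theta_j)_{1\le j\le k}\in[0,\pi/2]^k$ is the non-increasing vector defined by $\cos(\theta_j)=s_{k-j+1}(S^*T)$ for $1\le j\le k$. (The subspaces in item 5 have the same dimension, since $e^{iX}$ is unitary.) Submajorization: for $x,y\in\mathbb{R}^m$, $x\prec_w y$ means $\sum_{i=1}^j x_i^{\downarrow}\le\sum_{i=1}^j y_i^{\downarrow}$ for all $1\le j\le m$, where $x^{\downarrow}$ is the non-increasing rearrangement of $x$. If $x,y$ have non-negative entries and different lengths, $x\prec_w y$ means the relation holds after appending zeros to the shorter vector to equalize lengths. *)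

theory Defs
  imports
    "HOL-Computational_Algebra.Computational_Algebra"
    "Jordan_Normal_Form.Schur_Decomposition"
    "Jordan_Normal_Form.VS_Connect"
begin

text \<open>Real vectors are lists, indexed from 0.\<close>

definition hermitian_mat :: "nat \<Rightarrow> complex mat \<Rightarrow> bool" where
  "hermitian_mat n A \<longleftrightarrow> A \<in> carrier_mat n n \<and> mat_adjoint A = A"

text \<open>The eigenvalues with algebraic multiplicity, in non-increasing order. The definition is
  meant for Hermitian \<open>A\<close>, whose eigenvalues are real, so that taking \<open>Re\<close> loses nothing.\<close>

definition eigvals :: "complex mat \<Rightarrow> real list" where
  "eigvals A = rev (sorted_list_of_multiset (image_mset Re (proots (char_poly A))))"

definition spr_plus :: "complex mat \<Rightarrow> real list" where
  "spr_plus A = (let m = dim_row A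
     in map (\<lambda>i. eigvals A ! i - eigvals A ! (m - 1 - i)) [0..<m div 2])"

definition direct_sum_mat :: "complex mat \<Rightarrow> complex mat \<Rightarrow> complex mat" where
  "direct_sum_mat A B =
     four_block_mat A (0\<^sub>m (dim_row A) (dim_col B)) (0\<^sub>m (dim_row B) (dim_col A)) B"

text \<open>For a Hermitian \<open>A\<close> the quadratic form below is real, so that its real part is its value.\<close>

definition psd_mat :: "nat \<Rightarrow> complex mat \<Rightarrow> bool" where
  "psd_mat n A \<longleftrightarrow> hermitian_mat n A \<and> (\<forall>v \<in> carrier_vec n. 0 \<le> Re ((A *\<^sub>v v) \<bullet>c v))"

text \<open>The positive semidefinite square root; it exists and is unique for positive
  semidefinite \<open>A\<close>.\<close>

definition psd_sqrt :: "complex mat \<Rightarrow> complex mat" where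
  "psd_sqrt A = (THE P. psd_mat (dim_row A) P \<and> P * P = A)"

definition sing_vals :: "complex mat \<Rightarrow> real list" where
  "sing_vals C = eigvals (psd_sqrt (mat_adjoint C * C))"

text \<open>The exponential series, summed entrywise.\<close>

definition mat_exp :: "complex mat \<Rightarrow> complex mat" where
  "mat_exp A = mat (dim_row A) (dim_row A) (\<lambda>(i,j). \<Sum>k. (A ^\<^sub>m k) $$ (i,j) / fact k)"

definition isometry_mat :: "nat \<Rightarrow> nat \<Rightarrow> complex mat \<Rightarrow> bool" where
  "isometry_mat n k S \<longleftrightarrow> S \<in> carrier_mat n k \<and> mat_adjoint S * S = 1\<^sub>m k"

definition range_mat :: "complex mat \<Rightarrow> complex vec set" where
  "range_mat S = (\<lambda>x. S *\<^sub>v x) ` carrier_vec (dim_col S)"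

text \<open>The principal angles of two subspaces of equal dimension. They do not depend on the
  choice of the isometries, because the singular values of \<open>P\<^sup>* Q\<close> are unitarily invariant. With
  indices starting from 0, the singular value with index \<open>k - j + 1\<close> becomes \<open>k - 1 - j\<close>.\<close>

definition principal_angles :: "nat \<Rightarrow> complex vec set \<Rightarrow> complex vec set \<Rightarrow> real list" where
  "principal_angles n S T = (THE \<theta>. \<exists>k P Q.
     isometry_mat n k P \<and> range_mat P = S \<and> isometry_mat n k Q \<and> range_mat Q = T \<and>
     length \<theta> = k \<and>
     (\<forall>j<k. 0 \<le> \<theta> ! j \<and> \<theta> ! j \<le> pi / 2 \<and>
            cos (\<theta> ! j) = sing_vals (mat_adjoint P * Q) ! (k - 1 - j)))"

text \<open>Submajorization. The shorter vector is padded with zeros, which is meaningful for vectors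
  with non-negative entries and has no effect when the lengths agree.\<close>

definition pad_decr :: "nat \<Rightarrow> real list \<Rightarrow> real list" where
  "pad_decr m x = rev (sort (x @ replicate (m - length x) 0))"

definition submajorized :: "real list \<Rightarrow> real list \<Rightarrow> bool" (infix \<open>\<prec>\<^sub>w\<close> 50) where
  "x \<prec>\<^sub>w y \<longleftrightarrow> (let m = max (length x) (length y) in
     \<forall>j\<in>{1..m}. sum_list (take j (pad_decr m x)) \<le> sum_list (take j (pad_decr m y)))"

definition difference_assertion :: bool where
  "difference_assertion \<longleftrightarrow> (\<forall>n\<ge>1. \<forall>A\<^sub>1 A\<^sub>2.
     hermitian_mat n A\<^sub>1 \<longrightarrow> hermitian_mat n A\<^sub>2 \<longrightarrow>
     sing_vals (A\<^sub>1 - A\<^sub>2) \<prec>\<^sub>w spr_plus (direct_sum_mat A\<^sub>1 A\<^sub>2))"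

definition off_diagonal_assertion :: bool where
  "off_diagonal_assertion \<longleftrightarrow> (\<forall>n\<ge>1. \<forall>A A\<^sub>1 A\<^sub>2 B.
     A\<^sub>1 \<in> carrier_mat n n \<longrightarrow> A\<^sub>2 \<in> carrier_mat n n \<longrightarrow> B \<in> carrier_mat n n \<longrightarrow>
     A = four_block_mat A\<^sub>1 B (mat_adjoint B) A\<^sub>2 \<longrightarrow> hermitian_mat (2 * n) A \<longrightarrow>
     map ((*) 2) (sing_vals B) \<prec>\<^sub>w spr_plus A)"

definition generalized_commutator_assertion :: bool where
  "generalized_commutator_assertion \<longleftrightarrow> (\<forall>n\<ge>1. \<forall>A\<^sub>1 A\<^sub>2 X.
     hermitian_mat n A\<^sub>1 \<longrightarrow> hermitian_mat n A\<^sub>2 \<longrightarrow> X \<in> carrier_mat n n \<longrightarrow>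
     sing_vals (A\<^sub>1 * X - X * A\<^sub>2) \<prec>\<^sub>w
       map2 (*) (sing_vals X) (spr_plus (direct_sum_mat A\<^sub>1 A\<^sub>2)))"

definition unitary_conjugation_assertion :: bool where
  "unitary_conjugation_assertion \<longleftrightarrow> (\<forall>n\<ge>1. \<forall>A X U.
     hermitian_mat n A \<longrightarrow> hermitian_mat n X \<longrightarrow> U = mat_exp (\<i> \<cdot>\<^sub>m X) \<longrightarrow>
     sing_vals (A - mat_adjoint U * A * U) \<prec>\<^sub>w
       map2 (*) (sing_vals X) (spr_plus (direct_sum_mat A A)))"

definition principal_angles_assertion :: bool where
  "principal_angles_assertion \<longleftrightarrow> (\<forall>n\<ge>1. \<forall>S T X.
     VectorSpace.subspace class_ring S (module_vec TYPE(complex) n) \<longrightarrow>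
     VectorSpace.subspace class_ring T (module_vec TYPE(complex) n) \<longrightarrow>
     hermitian_mat n X \<longrightarrow> (\<lambda>v. mat_exp (\<i> \<cdot>\<^sub>m X) *\<^sub>v v) ` S = T \<longrightarrow>
     principal_angles n S T \<prec>\<^sub>w map ((*) (1/2)) (spr_plus X))"

end

theory Submission
  imports Defs "HOL-Analysis.L2_Norm"
begin

text \<open>Each of the five assertions is true, and each is proved outright; this settles their
  equivalence. All of them come from one inequality for a Hermitian matrix \<open>A\<close> and its
  spectral spread (lemma \<open>off_diagonal_trace_bound\<close>): if \<open>F\<close> and \<open>G\<close> are contractions with \<open>k\<close>
  columns and \<open>F\<^sup>* G = 0\<close>, then \<open>2 Re tr (F\<^sup>* A G)\<close> is at most the sum of the first \<open>k\<close> entries of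
  \<open>Spr\<^sup>+ A\<close>. Indeed \<open>Y = (F + G) / sqrt 2\<close> and \<open>Z = (F - G) / sqrt 2\<close> are again contractions, and
  \<open>tr (Y\<^sup>* A Y) - tr (Z\<^sup>* A Z) = 2 Re tr (F\<^sup>* A G)\<close>. In an eigenbasis of \<open>A\<close> the left-hand side is
  \<open>\<Sum>p. \<lambda>\<^sub>p (m\<^sub>p - m'\<^sub>p)\<close> with weights in the unit interval that have the same total mass, at most
  \<open>k\<close>; such a sum is largest when \<open>m\<close> sits on the \<open>k\<close> largest and \<open>m'\<close> on the \<open>k\<close> smallest
  eigenvalues.

  The link with singular values is Ky Fan's principle: the sum of the \<open>k\<close> largest singular
  values of \<open>C\<close> is the maximum of \<open>Re tr (F\<^sup>* C G)\<close> over contractions with \<open>k\<close> columns (lemmas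
  \<open>Ky_Fan_trace_le\<close> and \<open>Ky_Fan_trace_attained\<close>). The off-diagonal assertion is then the basic
  inequality for block columns supported on the two diagonal blocks. For a contraction \<open>V\<close>,
  the block columns \<open>(F; V\<^sup>* F)\<close> and \<open>(V G; - G)\<close> are orthogonal, and between them \<open>A\<^sub>1 \<oplus> A\<^sub>2\<close> yields
  \<open>F\<^sup>* (A\<^sub>1 V - V A\<^sub>2) G\<close>. With \<open>V = 1\<close> this is the difference assertion. For a general \<open>X\<close> in place
  of \<open>V\<close>, the singular value decomposition and a summation by parts reduce the claim to the
  partial isometries formed by the leading \<open>l\<close> singular vectors. In the trace that has to be
  bounded, \<open>V\<close> and \<open>F G\<^sup>*\<close> play symmetric roles, so that the bound for \<open>k\<close> columns is also one for
  \<open>min k l\<close> columns, which is what the summation needs.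

  For \<open>U = e\<^sup>i\<^sup>X\<close>, the matrix \<open>A - U\<^sup>* A U\<close> has the singular values of the commutator of \<open>A\<close> with
  \<open>U - 1\<close>, and \<open>U - 1 = K X\<close> for a contraction \<open>K\<close> because \<open>\<bar>e\<^sup>i\<^sup>x - 1\<bar> \<le> \<bar>x\<bar>\<close>.

  For the principal angles let \<open>P\<close> be the orthogonal projection onto \<open>S\<close> and
  \<open>B t = (1 - P) e\<^sup>i\<^sup>t\<^sup>X P\<close>. The singular values of \<open>B 1\<close> are the sines of the angles, followed by
  zeros. It therefore suffices that the sum of the \<open>m\<close> largest \<open>arcsin s\<^sub>j(B t)\<close> grows at most at
  the rate of half the sum of the first \<open>m\<close> entries of the spread (lemma \<open>angle_sum_step\<close>). The
  singular vectors of the later matrix \<open>B (t + h)\<close> serve as test frames for the earlier matrix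
  \<open>B t\<close>; convexity of the arcsine turns the Ky Fan inequality into one for sums of angles, and
  the derivative that appears is an instance of the basic inequality, because the slope
  \<open>1 / cos \<theta>\<close> of the arcsine cancels the length \<open>cos \<theta>\<close> of the component that stays in \<open>S\<close>.\<close>

(* The symbol $ is kept for vector entries. *)
no_notation fps_nth (infixl \<open>$\<close> 75)

section \<open>Adjoints, products and traces\<close>

abbreviation dagger :: "complex mat \<Rightarrow> complex mat" (\<open>_\<^sup>\<dagger>\<close> [1000] 1000)
  where "A\<^sup>\<dagger> \<equiv> mat_adjoint A"

lemma dim_adjoint [simp]: "dim_row (A\<^sup>\<dagger>) = dim_col A" "dim_col (A\<^sup>\<dagger>) = dim_row A"
  by (auto simp: mat_adjoint_def)

lemma adjoint_carrier [simp]: "A\<^sup>\<dagger> \<in> carrier_mat m n \<longleftrightarrow> A \<in> carrier_mat n m"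
  unfolding carrier_mat_def by (simp add: conj_commute)

lemma index_adjoint [simp]:
  "i < dim_col A \<Longrightarrow> j < dim_row A \<Longrightarrow> A\<^sup>\<dagger> $$ (i,j) = cnj (A $$ (j,i))"
  by (simp add: mat_adjoint_def mat_of_rows_def)

lemma index_mult_sum:
  "i < dim_row A \<Longrightarrow> j < dim_col B \<Longrightarrow> dim_col A = dim_row B \<Longrightarrow>
    (A * B) $$ (i,j) = (\<Sum>k<dim_row B. A $$ (i,k) * B $$ (k,j))"
  by (simp add: scalar_prod_def atLeast0LessThan)

lemma index_mult_vec_sum:
  "i < dim_row A \<Longrightarrow> dim_col A = dim_vec v \<Longrightarrow>
    (A *\<^sub>v v) $ i = (\<Sum>k<dim_vec v. A $$ (i,k) * v $ k)"
  by (simp add: scalar_prod_def atLeast0LessThan)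

lemma adjoint_adjoint [simp]: "A\<^sup>\<dagger>\<^sup>\<dagger> = A"
  by (rule eq_matI) auto

text \<open>The algebraic laws are restated with equations between dimensions as side conditions.
  The simplifier can decide these, whereas membership in a carrier leaves it with inner
  dimensions to guess.\<close>

lemma mult_assoc_dim:
  "dim_col A = dim_row B \<Longrightarrow> dim_col B = dim_row C \<Longrightarrow> A * B * C = A * (B * (C :: complex mat))"
  by (rule assoc_mult_mat[of _ "dim_row A" "dim_row B" _ "dim_row C" _ "dim_col C"]) auto

lemma adjoint_mult:
  "dim_col A = dim_row B \<Longrightarrow> (A * B)\<^sup>\<dagger> = B\<^sup>\<dagger> * A\<^sup>\<dagger>"
  by (rule eq_matI) (auto simp: index_mult_sum mult.commute simp del: index_mult_mat(1))

lemma adjoint_add: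
  "dim_row A = dim_row B \<Longrightarrow> dim_col A = dim_col B \<Longrightarrow> (A + B)\<^sup>\<dagger> = A\<^sup>\<dagger> + B\<^sup>\<dagger>"
  by (rule eq_matI) auto

lemma adjoint_minus:
  "dim_row A = dim_row B \<Longrightarrow> dim_col A = dim_col B \<Longrightarrow> (A - B)\<^sup>\<dagger> = A\<^sup>\<dagger> - B\<^sup>\<dagger>"
  by (rule eq_matI) auto

lemma adjoint_smult: "(c \<cdot>\<^sub>m A)\<^sup>\<dagger> = cnj c \<cdot>\<^sub>m A\<^sup>\<dagger>"
  by (rule eq_matI) auto

lemma adjoint_one [simp]: "(1\<^sub>m n)\<^sup>\<dagger> = 1\<^sub>m n"
  by (rule eq_matI) auto

lemma adjoint_zero [simp]: "(0\<^sub>m m n)\<^sup>\<dagger> = 0\<^sub>m n m"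
  by (rule eq_matI) auto

lemma dim_mat_diag [simp]: "dim_row (mat_diag n f) = n" "dim_col (mat_diag n f) = n"
  by (auto simp: mat_diag_def)

lemma adjoint_mat_diag [simp]: "(mat_diag n f)\<^sup>\<dagger> = mat_diag n (\<lambda>i. cnj (f i))"
  by (rule eq_matI) (auto simp: mat_diag_def)

lemma mult_add_dim:
  "dim_col A = dim_row B \<Longrightarrow> dim_row B = dim_row C \<Longrightarrow> dim_col B = dim_col C \<Longrightarrow>
    A * (B + C) = A * B + A * (C :: complex mat)"
  by (rule mult_add_distrib_mat[of _ "dim_row A" "dim_row B" _ "dim_col B"]) auto

lemma add_mult_dim:
  "dim_row A = dim_row B \<Longrightarrow> dim_col A = dim_col B \<Longrightarrow> dim_col A = dim_row C \<Longrightarrow>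
    (A + B) * C = A * C + B * (C :: complex mat)"
  by (rule add_mult_distrib_mat[of _ "dim_row A" "dim_col A" _ _ "dim_col C"]) auto

lemma mult_minus_dim:
  "dim_col A = dim_row B \<Longrightarrow> dim_row B = dim_row C \<Longrightarrow> dim_col B = dim_col C \<Longrightarrow>
    A * (B - C) = A * B - A * (C :: complex mat)"
  by (rule mult_minus_distrib_mat[of _ "dim_row A" "dim_row B" _ "dim_col B"]) auto

lemma minus_mult_dim:
  "dim_row A = dim_row B \<Longrightarrow> dim_col A = dim_col B \<Longrightarrow> dim_col A = dim_row C \<Longrightarrow>
    (A - B) * C = A * C - B * (C :: complex mat)"
  by (rule minus_mult_distrib_mat[of _ "dim_row A" "dim_col A" _ _ "dim_col C"]) auto

lemma mult_smult_dim:
  "dim_col A = dim_row B \<Longrightarrow> A * (c \<cdot>\<^sub>m B) = c \<cdot>\<^sub>m (A * (B :: complex mat))"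
  by (rule mult_smult_distrib[of _ "dim_row A" "dim_row B" _ "dim_col B"]) auto

lemma smult_mult_dim:
  "dim_col A = dim_row B \<Longrightarrow> (c \<cdot>\<^sub>m A) * B = c \<cdot>\<^sub>m (A * (B :: complex mat))"
  by (rule mult_smult_assoc_mat[of _ "dim_row A" "dim_row B" _ "dim_col B"]) auto

lemma mult_one_dim [simp]:
  "dim_row A = n \<Longrightarrow> 1\<^sub>m n * A = (A :: complex mat)" "dim_col A = n \<Longrightarrow> A * 1\<^sub>m n = A"
  using left_mult_one_mat[of A n "dim_col A"] right_mult_one_mat[of A "dim_row A" n] by auto

lemma mult_zero_dim [simp]:
  "dim_row A = n \<Longrightarrow> 0\<^sub>m m n * A = (0\<^sub>m m (dim_col A) :: complex mat)"
  "dim_col A = n \<Longrightarrow> A * 0\<^sub>m n m = (0\<^sub>m (dim_row A) m :: complex mat)"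
  by (auto intro!: left_mult_zero_mat right_mult_zero_mat)

(* The simplifier is to use mult_assoc_dim and mult_vec_assoc_dim instead. *)
declare assoc_mult_mat [simp del] assoc_mult_mat_vec [simp del]

lemmas mat_dist = mult_add_dim add_mult_dim mult_minus_dim minus_mult_dim mult_smult_dim
  smult_mult_dim adjoint_mult adjoint_add adjoint_minus adjoint_smult mult_assoc_dim

definition trace_mat :: "complex mat \<Rightarrow> complex" where
  "trace_mat A = (\<Sum>i<dim_row A. A $$ (i,i))"

lemma trace_mult:
  "dim_col A = dim_row B \<Longrightarrow> trace_mat (A * B) = (\<Sum>i<dim_row A. \<Sum>j<dim_row B. A $$ (i,j) * B $$ (j,i))"
  if "dim_row A = dim_col B" for A B
  using that by (auto simp: trace_mat_def index_mult_sum simp del: index_mult_mat(1))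

lemma trace_comm:
  "dim_col A = dim_row B \<Longrightarrow> dim_col B = dim_row A \<Longrightarrow> trace_mat (A * B) = trace_mat (B * A)"
  by (simp add: trace_mult) (subst sum.swap, simp add: mult.commute)

lemma trace_add: "dim_row A = dim_row B \<Longrightarrow> dim_col A = dim_row A \<Longrightarrow> dim_col B = dim_row B \<Longrightarrow>
    trace_mat (A + B) = trace_mat A + trace_mat B"
  by (simp add: trace_mat_def sum.distrib)

lemma trace_minus: "dim_row A = dim_row B \<Longrightarrow> dim_col A = dim_row A \<Longrightarrow> dim_col B = dim_row B \<Longrightarrow>
    trace_mat (A - B) = trace_mat A - trace_mat B"
  by (simp add: trace_mat_def sum_subtractf)

lemma trace_smult: "dim_col A = dim_row A \<Longrightarrow> trace_mat (c \<cdot>\<^sub>m A) = c * trace_mat A"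
  by (simp add: trace_mat_def sum_distrib_left)

lemma trace_adjoint: "dim_col A = dim_row A \<Longrightarrow> trace_mat (A\<^sup>\<dagger>) = cnj (trace_mat A)"
  by (simp add: trace_mat_def)

lemma trace_one [simp]: "trace_mat (1\<^sub>m n) = of_nat n"
  by (simp add: trace_mat_def)

lemma trace_zero [simp]: "trace_mat (0\<^sub>m n n) = 0"
  by (simp add: trace_mat_def)

section \<open>Contractions\<close>

definition sqnorm :: "complex vec \<Rightarrow> real" where
  "sqnorm v = (\<Sum>i<dim_vec v. (cmod (v $ i))\<^sup>2)"

definition contraction :: "complex mat \<Rightarrow> bool" where
  "contraction A \<longleftrightarrow> (\<forall>c \<in> carrier_vec (dim_col A). sqnorm (A *\<^sub>v c) \<le> sqnorm c)"

lemma sqnorm_nonneg [simp]: "0 \<le> sqnorm v"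
  by (simp add: sqnorm_def sum_nonneg)

lemma sqnorm_cscalar: "complex_of_real (sqnorm v) = v \<bullet>c v"
  by (simp add: sqnorm_def scalar_prod_def complex_norm_square atLeast0LessThan flip: of_real_power)

lemma sqnorm_eq_0: "sqnorm v = 0 \<longleftrightarrow> v = 0\<^sub>v (dim_vec v)"
proof
  assume "v = 0\<^sub>v (dim_vec v)"
  then have "v $ i = 0" if "i < dim_vec v" for i using that by (metis index_zero_vec(1))
  then show "sqnorm v = 0" by (simp add: sqnorm_def)
qed (auto simp: sqnorm_def sum_nonneg_eq_0_iff intro!: eq_vecI)

lemma sqnorm_smult: "sqnorm (c \<cdot>\<^sub>v v) = (cmod c)\<^sup>2 * sqnorm v"
  by (simp add: sqnorm_def norm_mult power_mult_distrib sum_distrib_left)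

lemma cscalar_adjoint:
  assumes "dim_vec v = dim_col A" "dim_vec w = dim_row A"
  shows "(A *\<^sub>v v) \<bullet>c w = v \<bullet>c (A\<^sup>\<dagger> *\<^sub>v w)"
proof -
  have "(A *\<^sub>v v) \<bullet>c w = (\<Sum>i<dim_row A. \<Sum>k<dim_col A. A $$ (i,k) * v $ k * cnj (w $ i))"
    using assms by (simp add: scalar_prod_def sum_distrib_right atLeast0LessThan)
  also have "\<dots> = (\<Sum>k<dim_col A. \<Sum>i<dim_row A. v $ k * cnj (A\<^sup>\<dagger> $$ (k,i) * w $ i))"
    by (subst sum.swap) (simp add: algebra_simps)
  also have "\<dots> = v \<bullet>c (A\<^sup>\<dagger> *\<^sub>v w)"
    using assms by (simp add: scalar_prod_def sum_distrib_left atLeast0LessThan)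
  finally show ?thesis .
qed

lemma cscalar_Cauchy_Schwarz:
  assumes "dim_vec v = dim_vec w"
  shows "(cmod (v \<bullet>c w))\<^sup>2 \<le> sqnorm v * sqnorm w"
proof -
  have "cmod (v \<bullet>c w) \<le> (\<Sum>i<dim_vec v. cmod (v $ i) * cmod (w $ i))"
    using assms by (auto simp: scalar_prod_def atLeast0LessThan norm_mult intro!: sum_norm_le)
  then have "(cmod (v \<bullet>c w))\<^sup>2 \<le> (\<Sum>i<dim_vec v. cmod (v $ i) * cmod (w $ i))\<^sup>2"
    by (rule power_mono) simp
  also have "\<dots> \<le> (L2_set (\<lambda>i. cmod (v $ i)) {..<dim_vec v} * L2_set (\<lambda>i. cmod (w $ i)) {..<dim_vec v})\<^sup>2"
    using L2_set_mult_ineq[of "\<lambda>i. cmod (v $ i)" "\<lambda>i. cmod (w $ i)" "{..<dim_vec v}"]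
    by (intro power_mono) (auto intro: sum_nonneg)
  also have "\<dots> = (\<Sum>i<dim_vec v. (cmod (v $ i))\<^sup>2) * (\<Sum>i<dim_vec v. (cmod (w $ i))\<^sup>2)"
    by (simp add: power_mult_distrib L2_set_def sum_nonneg)
  finally show ?thesis using assms by (simp add: sqnorm_def)
qed

lemma mult_vec_assoc_dim:
  "dim_col A = dim_row B \<Longrightarrow> dim_col B = dim_vec v \<Longrightarrow> (A * B) *\<^sub>v v = A *\<^sub>v (B *\<^sub>v (v :: complex vec))"
  by (rule assoc_mult_mat_vec[of _ "dim_row A" "dim_row B" _ "dim_vec v"]) auto

lemma sqnorm_mult_vec:
  "dim_vec c = dim_col A \<Longrightarrow> sqnorm (A *\<^sub>v c) = Re (c \<bullet>c ((A\<^sup>\<dagger> * A) *\<^sub>v c))"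
  using cscalar_adjoint[of c A "A *\<^sub>v c"]
  by (simp add: mult_vec_assoc_dim flip: sqnorm_cscalar) (metis Re_complex_of_real sqnorm_cscalar)

lemma sqnorm_add:
  assumes "dim_vec v = dim_vec w"
  shows "sqnorm (v + w) = sqnorm v + sqnorm w + 2 * Re (v \<bullet>c w)"
proof -
  have *: "(cmod (a + b))\<^sup>2 = (cmod a)\<^sup>2 + (cmod b)\<^sup>2 + 2 * Re (a * cnj b)" for a b
    unfolding cmod_power2 by (simp add: power2_eq_square algebra_simps)
  show ?thesis using assms
    by (simp add: sqnorm_def * sum.distrib scalar_prod_def atLeast0LessThan sum_distrib_left)
qed

lemma contractionD: "contraction A \<Longrightarrow> dim_vec c = dim_col A \<Longrightarrow> sqnorm (A *\<^sub>v c) \<le> sqnorm c"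
  unfolding contraction_def carrier_vec_def by auto

text \<open>The squared norm of \<open>A c\<close> is the quadratic form of \<open>A\<^sup>* A\<close>, here a sum of squares with
  weights at most 1.\<close>

lemma contraction_diag:
  assumes "A\<^sup>\<dagger> * A = mat_diag k (\<lambda>i. complex_of_real (d i))" "\<And>i. i < k \<Longrightarrow> d i \<le> 1"
  shows "contraction A"
  unfolding contraction_def
proof
  fix c :: "complex vec" assume c: "c \<in> carrier_vec (dim_col A)"
  have k: "dim_col A = k" using assms(1) by (metis dim_mat_diag(1) index_mult_mat(2) dim_adjoint(1))
  have e: "(mat_diag k (\<lambda>i. complex_of_real (d i)) *\<^sub>v c) $ i = of_real (d i) * c $ i" if "i < k" for i
    using that c k by (simp add: index_mult_vec_sum mat_diag_def if_distrib if_distribR cong: if_cong)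
      (simp add: scalar_prod_def if_distrib if_distribR atLeast0LessThan cong: if_cong)
  have "sqnorm (A *\<^sub>v c) = Re (c \<bullet>c (mat_diag k (\<lambda>i. complex_of_real (d i)) *\<^sub>v c))"
    using c by (simp add: sqnorm_mult_vec assms(1))
  also have "\<dots> = (\<Sum>i<k. d i * (cmod (c $ i))\<^sup>2)"
    unfolding cmod_power2 using c k e
    by (simp add: scalar_prod_def atLeast0LessThan power2_eq_square algebra_simps sum.distrib del: index_mult_mat_vec)
  also have "\<dots> \<le> sqnorm c"
    unfolding sqnorm_def using c k assms(2)
    by (auto intro!: sum_mono mult_right_mono[of "d _" 1, simplified])
  finally show "sqnorm (A *\<^sub>v c) \<le> sqnorm c" .
qed

lemma contraction_isometry: "A\<^sup>\<dagger> * A = 1\<^sub>m k \<Longrightarrow> contraction A"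
  using contraction_diag[of A k "\<lambda>_. 1"] by simp

lemma contraction_mult:
  assumes "contraction A" "contraction B" "dim_col A = dim_row B"
  shows "contraction (A * B)"
  unfolding contraction_def
proof
  fix c :: "complex vec" assume c: "c \<in> carrier_vec (dim_col (A * B))"
  have "sqnorm (A *\<^sub>v (B *\<^sub>v c)) \<le> sqnorm (B *\<^sub>v c)"
    using assms by (intro contractionD) auto
  also have "\<dots> \<le> sqnorm c"
    using assms c by (intro contractionD) auto
  finally show "sqnorm (A * B *\<^sub>v c) \<le> sqnorm c"
    using assms c by (simp add: mult_vec_assoc_dim)
qed

text \<open>If \<open>|A c|\<^sup>2 = (c, w)\<close> and \<open>|w| \<le> |A c|\<close>, then Cauchy and Schwarz give \<open>|A c|\<^sup>2 \<le> |c| |A c|\<close>.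
  This covers adjoints of contractions and orthogonal projections.\<close>

lemma contraction_by_Cauchy_Schwarz:
  assumes "\<And>c. dim_vec c = dim_col A \<Longrightarrow>
    \<exists>w. dim_vec w = dim_vec c \<and> complex_of_real (sqnorm (A *\<^sub>v c)) = c \<bullet>c w \<and> sqnorm w \<le> sqnorm (A *\<^sub>v c)"
  shows "contraction A"
  unfolding contraction_def
proof
  fix c :: "complex vec" assume "c \<in> carrier_vec (dim_col A)"
  then obtain w where w: "dim_vec w = dim_vec c" "complex_of_real (sqnorm (A *\<^sub>v c)) = c \<bullet>c w"
    "sqnorm w \<le> sqnorm (A *\<^sub>v c)"
    using assms[of c] by auto
  have "(sqnorm (A *\<^sub>v c))\<^sup>2 = (cmod (c \<bullet>c w))\<^sup>2"
    using w(2) by (metis norm_of_real power2_abs)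
  also have "\<dots> \<le> sqnorm c * sqnorm w"
    using w(1) by (intro cscalar_Cauchy_Schwarz) simp
  also have "\<dots> \<le> sqnorm c * sqnorm (A *\<^sub>v c)"
    using w(3) by (intro mult_left_mono) auto
  finally have "sqnorm (A *\<^sub>v c) * sqnorm (A *\<^sub>v c) \<le> sqnorm c * sqnorm (A *\<^sub>v c)"
    by (simp add: power2_eq_square)
  then show "sqnorm (A *\<^sub>v c) \<le> sqnorm c"
    using sqnorm_nonneg[of "A *\<^sub>v c"] sqnorm_nonneg[of c]
    by (cases "sqnorm (A *\<^sub>v c) = 0") (auto simp: mult_le_cancel_right)
qed

lemma contraction_adjoint:
  assumes "contraction A" shows "contraction (A\<^sup>\<dagger>)"
proof (rule contraction_by_Cauchy_Schwarz)
  fix c :: "complex vec" assume c: "dim_vec c = dim_col (A\<^sup>\<dagger>)"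
  have "complex_of_real (sqnorm (A\<^sup>\<dagger> *\<^sub>v c)) = c \<bullet>c (A *\<^sub>v (A\<^sup>\<dagger> *\<^sub>v c))"
    using c cscalar_adjoint[of c "A\<^sup>\<dagger>" "A\<^sup>\<dagger> *\<^sub>v c"] by (simp add: sqnorm_cscalar)
  then show "\<exists>w. dim_vec w = dim_vec c \<and> complex_of_real (sqnorm (A\<^sup>\<dagger> *\<^sub>v c)) = c \<bullet>c w
      \<and> sqnorm w \<le> sqnorm (A\<^sup>\<dagger> *\<^sub>v c)"
    using c assms by (intro exI[of _ "A *\<^sub>v (A\<^sup>\<dagger> *\<^sub>v c)"]) (auto intro: contractionD)
qed

lemma contraction_projection:
  assumes "P\<^sup>\<dagger> * P = P"
  shows "contraction P"
proof (rule contraction_by_Cauchy_Schwarz)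
  fix c :: "complex vec" assume c: "dim_vec c = dim_col P"
  have d: "dim_row P = dim_col P" using assms by (metis dim_adjoint(1) index_mult_mat(2))
  have "complex_of_real (sqnorm (P *\<^sub>v c)) = c \<bullet>c ((P\<^sup>\<dagger> * P) *\<^sub>v c)"
    using c cscalar_adjoint[of c P "P *\<^sub>v c"] by (simp add: sqnorm_cscalar mult_vec_assoc_dim)
  then show "\<exists>w. dim_vec w = dim_vec c \<and> complex_of_real (sqnorm (P *\<^sub>v c)) = c \<bullet>c w
      \<and> sqnorm w \<le> sqnorm (P *\<^sub>v c)"
    unfolding assms using c d by (intro exI[of _ "P *\<^sub>v c"]) auto
qed

lemma mult_unit_vec:
  "j < dim_col A \<Longrightarrow> A *\<^sub>v unit_vec (dim_col A) j = col (A :: complex mat) j"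
  by (intro eq_vecI) auto

lemma contraction_col_norm:
  assumes "contraction A" "j < dim_col A"
  shows "(\<Sum>i<dim_row A. (cmod (A $$ (i,j)))\<^sup>2) \<le> 1"
proof -
  have "(\<Sum>i<dim_row A. (cmod (A $$ (i,j)))\<^sup>2) = sqnorm (A *\<^sub>v unit_vec (dim_col A) j)"
    using assms by (simp add: sqnorm_def mult_unit_vec)
  also have "\<dots> \<le> sqnorm (unit_vec (dim_col A) j)"
    using assms by (intro contractionD) auto
  also have "\<dots> = (\<Sum>i<dim_col A. if i = j then 1 else 0)"
    using assms unfolding sqnorm_def by (intro sum.cong) auto
  also have "\<dots> = 1" using assms by simp
  finally show ?thesis .
qed

text \<open>For an isometry this is Bessel's inequality for its columns and a unit coordinate
  vector.\<close>

lemma contraction_row_norm: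
  assumes "contraction A" "i < dim_row A"
  shows "(\<Sum>j<dim_col A. (cmod (A $$ (i,j)))\<^sup>2) \<le> 1"
  using contraction_col_norm[OF contraction_adjoint[OF assms(1)], of i] assms by simp

lemma contraction_entry:
  assumes "contraction A" "i < dim_row A" "j < dim_col A"
  shows "cmod (A $$ (i,j)) \<le> 1"
proof -
  have "(cmod (A $$ (i,j)))\<^sup>2 \<le> (\<Sum>i<dim_row A. (cmod (A $$ (i,j)))\<^sup>2)"
    using assms by (intro member_le_sum) auto
  also have "\<dots> \<le> 1" by (rule contraction_col_norm) fact+
  finally show ?thesis by (simp add: power_le_one_iff abs_square_le_1)
qed

lemma trace_square:
  "trace_mat (A\<^sup>\<dagger> * A) = of_real (\<Sum>i<dim_row A. \<Sum>j<dim_col A. (cmod (A $$ (i,j)))\<^sup>2)"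
  by (subst sum.swap) (simp add: trace_mult complex_norm_square mult.commute flip: of_real_power)

section \<open>Leading columns\<close>

definition take_cols :: "nat \<Rightarrow> complex mat \<Rightarrow> complex mat" where
  "take_cols k A = mat (dim_row A) k (\<lambda>(i,j). A $$ (i,j))"

lemma dim_take_cols [simp]: "dim_row (take_cols k A) = dim_row A" "dim_col (take_cols k A) = k"
  by (auto simp: take_cols_def)

lemma index_take_cols [simp]: "i < dim_row A \<Longrightarrow> j < k \<Longrightarrow> take_cols k A $$ (i,j) = A $$ (i,j)"
  by (simp add: take_cols_def)

lemma take_cols_compress:
  assumes "dim_col (A\<^sup>\<dagger>) = dim_row M" "dim_col M = dim_row B" "k \<le> dim_col A" "l \<le> dim_col B"
    "i < k" "j < l"
  shows "((take_cols k A)\<^sup>\<dagger> * (M * take_cols l B)) $$ (i,j) = (A\<^sup>\<dagger> * (M * B)) $$ (i,j)"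
  using assms by (simp add: index_mult_sum  del: index_mult_mat(1))

lemma take_cols_gram:
  assumes "dim_row A = dim_row B" "k \<le> dim_col A" "l \<le> dim_col B" "i < k" "j < l"
  shows "((take_cols k A)\<^sup>\<dagger> * take_cols l B) $$ (i,j) = (A\<^sup>\<dagger> * B) $$ (i,j)"
  using assms by (simp add: index_mult_sum  del: index_mult_mat(1))

lemma take_cols_isometry:
  assumes "A\<^sup>\<dagger> * A = 1\<^sub>m n" "k \<le> n"
  shows "(take_cols k A)\<^sup>\<dagger> * take_cols k A = 1\<^sub>m k"
proof (rule eq_matI)
  have n: "dim_col A = n" using assms(1) by (metis dim_adjoint(1) index_mult_mat(2) index_one_mat(2))
  show "((take_cols k A)\<^sup>\<dagger> * take_cols k A) $$ (i,j) = (1\<^sub>m k) $$ (i,j)"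
    if "i < dim_row (1\<^sub>m k)" "j < dim_col (1\<^sub>m k)" for i j
    using that assms n by (subst take_cols_gram) auto
qed auto

lemma mult_take_cols:
  assumes "dim_col M = dim_row A" "k \<le> dim_col A"
  shows "M * take_cols k A = take_cols k (M * A)"
  using assms by (intro eq_matI) (auto simp: index_mult_sum simp del: index_mult_mat(1))

lemma take_cols_diag:
  assumes "dim_col A = n" "k \<le> n"
  shows "take_cols k (A * mat_diag n f) = take_cols k A * mat_diag k f"
proof -
  have A: "A \<in> carrier_mat (dim_row A) n" "take_cols k A \<in> carrier_mat (dim_row A) k"
    using assms(1) by auto
  show ?thesis
    unfolding mat_diag_mult_right[OF A(1)] mat_diag_mult_right[OF A(2)]
    using assms by (intro eq_matI) auto
qed

section \<open>Orthonormal families and the spectral theorem\<close>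

definition append_col :: "complex mat \<Rightarrow> complex vec \<Rightarrow> complex mat" where
  "append_col A v = mat (dim_row A) (Suc (dim_col A)) (\<lambda>(i,j). if j < dim_col A then A $$ (i,j) else v $ i)"

lemma dim_append_col [simp]:
  "dim_row (append_col A v) = dim_row A" "dim_col (append_col A v) = Suc (dim_col A)"
  by (auto simp: append_col_def)

lemma isometry_append_col:
  assumes V: "V \<in> carrier_mat n k" "V\<^sup>\<dagger> * V = 1\<^sub>m k"
    and v: "v \<in> carrier_vec n" "sqnorm v = 1" "V\<^sup>\<dagger> *\<^sub>v v = 0\<^sub>v k"
  shows "(append_col V v)\<^sup>\<dagger> * append_col V v = 1\<^sub>m (Suc k)"
proof (rule eq_matI)
  let ?W = "append_col V v"
  have VV: "(\<Sum>l<n. cnj (V $$ (l,i)) * V $$ (l,j)) = (if i = j then 1 else 0)" if "i < k" "j < k" for i j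
  proof -
    have "(V\<^sup>\<dagger> * V) $$ (i,j) = (\<Sum>l<n. cnj (V $$ (l,i)) * V $$ (l,j))"
      using V(1) that by (simp add: index_mult_sum del: index_mult_mat(1))
    then show ?thesis using V(2) that by simp
  qed
  have Vv: "(\<Sum>l<n. cnj (V $$ (l,i)) * v $ l) = 0" if "i < k" for i
  proof -
    have "(V\<^sup>\<dagger> *\<^sub>v v) $ i = (\<Sum>l<n. cnj (V $$ (l,i)) * v $ l)"
      using V(1) v(1) that by (simp add: index_mult_vec_sum del: index_mult_mat_vec)
    then show ?thesis using v(3) that by simp
  qed
  have vV: "(\<Sum>l<n. cnj (v $ l) * V $$ (l,i)) = 0" if "i < k" for i
    using arg_cong[OF Vv[OF that], of cnj] by (simp add: mult.commute)
  have vv: "(\<Sum>l<n. cnj (v $ l) * v $ l) = 1"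
    using v(1,2) sqnorm_cscalar[of v] by (simp add: scalar_prod_def atLeast0LessThan mult.commute)
  show "(?W\<^sup>\<dagger> * ?W) $$ (i,j) = (1\<^sub>m (Suc k)) $$ (i,j)"
    if "i < dim_row (1\<^sub>m (Suc k))" "j < dim_col (1\<^sub>m (Suc k))" for i j
  proof -
    have "(?W\<^sup>\<dagger> * ?W) $$ (i,j) = (\<Sum>l<n. cnj (?W $$ (l,i)) * ?W $$ (l,j))"
      using V(1) that by (simp add: index_mult_sum del: index_mult_mat(1))
    moreover have "i = k \<or> i < k" "j = k \<or> j < k" using that by auto
    ultimately show ?thesis
      using V(1) VV Vv vV vv by (auto simp: append_col_def)
  qed
qed (use V in auto)

lemma exists_unit_multiple:
  assumes "v \<in> carrier_vec n" "v \<noteq> 0\<^sub>v n"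
  obtains a where "sqnorm (a \<cdot>\<^sub>v v) = 1"
proof -
  have "sqnorm v \<noteq> 0" using assms by (simp add: sqnorm_eq_0)
  then have "0 < sqnorm v" using sqnorm_nonneg[of v] by linarith
  then show thesis
    using that[of "complex_of_real (1 / sqrt (sqnorm v))"]
    by (simp add: sqnorm_smult norm_divide power_divide)
qed

text \<open>Padded with zero rows, the \<open>k\<close> orthogonality conditions form a square system with
  determinant 0.\<close>

lemma exists_unit_orthogonal:
  assumes V: "V \<in> carrier_mat n k" and k: "k < n"
  obtains v where "v \<in> carrier_vec n" "sqnorm v = 1" "V\<^sup>\<dagger> *\<^sub>v v = 0\<^sub>v k"
proof -
  let ?M = "mat\<^sub>r n n (\<lambda>i. if i = k then 0\<^sub>v n else if i < k then row (V\<^sup>\<dagger>) i else 0\<^sub>v n)"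
  have "det ?M = 0"
    using V k by (intro det_row_0) auto
  then obtain v where v: "v \<in> carrier_vec n" "v \<noteq> 0\<^sub>v n" "?M *\<^sub>v v = 0\<^sub>v n"
    using det_0_iff_vec_prod_zero[of ?M n] by auto
  have "V\<^sup>\<dagger> *\<^sub>v v = 0\<^sub>v k"
  proof (rule eq_vecI)
    fix i assume i: "i < dim_vec (0\<^sub>v k :: complex vec)"
    have "(?M *\<^sub>v v) $ i = row (V\<^sup>\<dagger>) i \<bullet> v" using i k V by simp
    then show "(V\<^sup>\<dagger> *\<^sub>v v) $ i = 0\<^sub>v k $ i" using i k V v by simp
  qed (use V in auto)
  moreover obtain c where "sqnorm (c \<cdot>\<^sub>v v) = 1"
    using exists_unit_multiple[OF v(1,2)] .
  moreover have "V\<^sup>\<dagger> *\<^sub>v (c \<cdot>\<^sub>v v) = c \<cdot>\<^sub>v (V\<^sup>\<dagger> *\<^sub>v v)"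
    using V v(1) by (intro mult_mat_vec[of _ k n]) auto
  moreover have "c \<cdot>\<^sub>v 0\<^sub>v k = 0\<^sub>v k" by (intro eq_vecI) auto
  ultimately show thesis
    using that[of "c \<cdot>\<^sub>v v"] v(1) by simp
qed

lemma isometry_extend:
  assumes "V \<in> carrier_mat n k" "V\<^sup>\<dagger> * V = 1\<^sub>m k" "k \<le> n"
  obtains Q where "Q \<in> carrier_mat n n" "Q\<^sup>\<dagger> * Q = 1\<^sub>m n" "take_cols k Q = V"
proof -
  have "\<exists>Q \<in> carrier_mat n n. Q\<^sup>\<dagger> * Q = 1\<^sub>m n \<and> take_cols k Q = V"
    using assms
  proof (induction "n - k" arbitrary: k V)
    case 0
    then have "k = n" by simp
    with 0 show ?case by (intro bexI[of _ V]) (auto simp: take_cols_def intro!: eq_matI)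
  next
    case (Suc d)
    then have "k < n" by simp
    with Suc.prems obtain v where v: "v \<in> carrier_vec n" "sqnorm v = 1" "V\<^sup>\<dagger> *\<^sub>v v = 0\<^sub>v k"
      using exists_unit_orthogonal by blast
    have "append_col V v \<in> carrier_mat n (Suc k)" using Suc.prems by auto
    moreover have "d = n - Suc k" "Suc k \<le> n" using Suc.hyps(2) \<open>k < n\<close> by auto
    ultimately obtain Q where Q: "Q \<in> carrier_mat n n" "Q\<^sup>\<dagger> * Q = 1\<^sub>m n" "take_cols (Suc k) Q = append_col V v"
      using Suc.hyps(1)[of "Suc k" "append_col V v"] isometry_append_col[OF Suc.prems(1,2) v] by blast
    have "take_cols k Q = V"
    proof (rule eq_matI)
      fix i j assume ij: "i < dim_row V" "j < dim_col V"
      then have "take_cols k Q $$ (i,j) = take_cols (Suc k) Q $$ (i,j)"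
        using Q(1) Suc.prems by simp
      then show "take_cols k Q $$ (i,j) = V $$ (i,j)"
        unfolding Q(3) using ij by (simp add: append_col_def)
    qed (use Q(1) Suc.prems in auto)
    with Q show ?case by blast
  qed
  then show thesis using that by auto
qed

lemma unitary_commute: "Q \<in> carrier_mat n n \<Longrightarrow> Q\<^sup>\<dagger> * Q = 1\<^sub>m n \<Longrightarrow> Q * Q\<^sup>\<dagger> = 1\<^sub>m n"
  by (rule mat_mult_left_right_inverse) auto

lemma complex_matrix_has_eigenvector:
  assumes A: "(A :: complex mat) \<in> carrier_mat n n" and "0 < n"
  obtains v e where "v \<in> carrier_vec n" "sqnorm v = 1" "A *\<^sub>v v = e \<cdot>\<^sub>v v"
proof -
  have "\<not> constant (poly (char_poly A))"
    using degree_monic_char_poly[OF A] \<open>0 < n\<close> by (simp add: constant_degree)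
  then obtain e where "poly (char_poly A) e = 0"
    using fundamental_theorem_of_algebra by blast
  then obtain v where v: "v \<in> carrier_vec n" "v \<noteq> 0\<^sub>v n" "A *\<^sub>v v = e \<cdot>\<^sub>v v"
    using eigenvalue_root_char_poly[OF A] A by (auto simp: eigenvalue_def eigenvector_def)
  obtain c where "sqnorm (c \<cdot>\<^sub>v v) = 1"
    using exists_unit_multiple[OF v(1,2)] .
  moreover have "A *\<^sub>v (c \<cdot>\<^sub>v v) = e \<cdot>\<^sub>v (c \<cdot>\<^sub>v v)"
    using mult_mat_vec[OF A v(1), of c] v(3) by (simp add: smult_smult_assoc mult.commute)
  ultimately show thesis using that v(1) by (meson smult_carrier_vec)
qed

text \<open>The orthogonal complement of eigenvectors of a Hermitian \<open>A\<close> is invariant under \<open>A\<close>. An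
  eigenvector of the compression of \<open>A\<close> to this complement is therefore an eigenvector of \<open>A\<close>.\<close>

lemma hermitian_eigenvectors:
  assumes A: "hermitian_mat n A" and "k \<le> n"
  shows "\<exists>V d. V \<in> carrier_mat n k \<and> V\<^sup>\<dagger> * V = 1\<^sub>m k \<and> A * V = V * mat_diag k d"
  using \<open>k \<le> n\<close>
proof (induction k)
  case 0
  have "(0\<^sub>m n 0)\<^sup>\<dagger> * 0\<^sub>m n 0 = (1\<^sub>m 0 :: complex mat)" "A * 0\<^sub>m n 0 = 0\<^sub>m n 0 * mat_diag 0 (\<lambda>_. 0)"
    by (rule eq_matI; use A in \<open>auto simp: hermitian_mat_def\<close>)+
  then show ?case by (intro exI[of _ "0\<^sub>m n 0"]) auto
next
  case (Suc k)
  have Ac: "A \<in> carrier_mat n n" "A\<^sup>\<dagger> = A" using A by (auto simp: hermitian_mat_def)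
  from Suc obtain V d where V: "V \<in> carrier_mat n k" "V\<^sup>\<dagger> * V = 1\<^sub>m k" "A * V = V * mat_diag k d"
    by auto
  obtain Q where Q: "Q \<in> carrier_mat n n" "Q\<^sup>\<dagger> * Q = 1\<^sub>m n" "take_cols k Q = V"
    using isometry_extend[OF V(1,2)] Suc.prems by (metis Suc_leD)
  \<comment> \<open>The columns of \<open>W\<close> span the orthogonal complement of those of \<open>V\<close>.\<close>
  define W where "W = mat n (n - k) (\<lambda>(i,j). Q $$ (i,k + j))"
  have W: "W \<in> carrier_mat n (n - k)" by (simp add: W_def)
  have QQ: "(\<Sum>l<n. cnj (Q $$ (l,i)) * Q $$ (l,j)) = (if i = j then 1 else 0)" if "i < n" "j < n" for i j
  proof -
    have "(Q\<^sup>\<dagger> * Q) $$ (i,j) = (\<Sum>l<n. cnj (Q $$ (l,i)) * Q $$ (l,j))"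
      using Q(1) that by (simp add: index_mult_sum del: index_mult_mat(1))
    then show ?thesis using Q(2) that by simp
  qed
  have WW: "W\<^sup>\<dagger> * W = 1\<^sub>m (n - k)"
    by (rule eq_matI; use W QQ in \<open>auto simp: index_mult_sum W_def simp del: index_mult_mat(1)\<close>)
  have VW: "V\<^sup>\<dagger> * W = 0\<^sub>m k (n - k)"
    unfolding Q(3)[symmetric]
    by (rule eq_matI; use W QQ Q(1) in \<open>auto simp: index_mult_sum W_def simp del: index_mult_mat(1)\<close>)
  have "W\<^sup>\<dagger> * (A * W) \<in> carrier_mat (n - k) (n - k)" using W Ac by auto
  moreover have "0 < n - k" using Suc.prems by simp
  ultimately obtain y e where y: "y \<in> carrier_vec (n - k)" "sqnorm y = 1"
      "(W\<^sup>\<dagger> * (A * W)) *\<^sub>v y = e \<cdot>\<^sub>v y"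
    using complex_matrix_has_eigenvector by metis
  define w where "w = W *\<^sub>v y"
  have w: "w \<in> carrier_vec n" using W y by (simp add: w_def)
  have 1: "sqnorm w = 1"
    unfolding w_def using W y by (simp add: sqnorm_mult_vec WW flip: sqnorm_cscalar)
  have 2: "V\<^sup>\<dagger> *\<^sub>v w = 0\<^sub>v k"
    unfolding w_def using V W y
    by (subst mult_vec_assoc_dim[symmetric]) (auto simp: VW)
  have VA: "V\<^sup>\<dagger> * A = mat_diag k (\<lambda>i. cnj (d i)) * V\<^sup>\<dagger>"
    using arg_cong[OF V(3), of mat_adjoint] V(1) Ac by (simp add: adjoint_mult)
  have 3: "V\<^sup>\<dagger> *\<^sub>v (A *\<^sub>v w) = 0\<^sub>v k"
  proof -
    have "V\<^sup>\<dagger> *\<^sub>v (A *\<^sub>v w) = mat_diag k (\<lambda>i. cnj (d i)) *\<^sub>v (V\<^sup>\<dagger> *\<^sub>v w)"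
      using V(1) Ac w by (simp add: VA flip: mult_vec_assoc_dim)
    also have "\<dots> = 0\<^sub>v k" unfolding 2 by (intro eq_vecI) (auto simp: scalar_prod_def)
    finally show ?thesis .
  qed
  have 4: "W\<^sup>\<dagger> *\<^sub>v (A *\<^sub>v w) = e \<cdot>\<^sub>v y"
    using y W Ac unfolding w_def by (simp add: mult_vec_assoc_dim)
  have 5: "W\<^sup>\<dagger> *\<^sub>v w = y"
    using y W unfolding w_def by (simp add: WW flip: mult_vec_assoc_dim)
  \<comment> \<open>Both sides have no component along \<open>V\<close>, and along \<open>W\<close> they agree by the choice of \<open>y\<close>.\<close>
  have 6: "Q\<^sup>\<dagger> *\<^sub>v (A *\<^sub>v w) = Q\<^sup>\<dagger> *\<^sub>v (e \<cdot>\<^sub>v w)"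
  proof (rule eq_vecI)
    fix i assume "i < dim_vec (Q\<^sup>\<dagger> *\<^sub>v (e \<cdot>\<^sub>v w))"
    then have i: "i < n" using Q(1) by simp
    have split: "(Q\<^sup>\<dagger> *\<^sub>v u) $ i = (if i < k then (V\<^sup>\<dagger> *\<^sub>v u) $ i else (W\<^sup>\<dagger> *\<^sub>v u) $ (i - k))"
      if "u \<in> carrier_vec n" for u
      using i Q(1) W that unfolding Q(3)[symmetric]
      by (auto simp: index_mult_vec_sum W_def simp del: index_mult_mat_vec)
    have smult: "M *\<^sub>v (e \<cdot>\<^sub>v w) = e \<cdot>\<^sub>v (M *\<^sub>v w)" if "dim_col M = n" for M
      using that w by (intro mult_mat_vec[of _ "dim_row M" n]) auto
    show "(Q\<^sup>\<dagger> *\<^sub>v (A *\<^sub>v w)) $ i = (Q\<^sup>\<dagger> *\<^sub>v (e \<cdot>\<^sub>v w)) $ i"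
      using i w Ac V(1) W y by (subst (1 2) split) (auto simp: 2 3 4 5 smult simp del: index_mult_mat_vec)
  qed (use Q in auto)
  have 7: "A *\<^sub>v w = e \<cdot>\<^sub>v w"
  proof -
    have "u = Q *\<^sub>v (Q\<^sup>\<dagger> *\<^sub>v u)" if "u \<in> carrier_vec n" for u
      using Q that unitary_commute[OF Q(1,2)] by (simp flip: mult_vec_assoc_dim)
    with 6 w Ac show ?thesis
      by (metis mult_mat_vec_carrier smult_carrier_vec)
  qed
  define d' where "d' = d(k := e)"
  have "A * append_col V w = append_col V w * mat_diag (Suc k) d'"
  proof (rule eq_matI)
    fix i j assume "i < dim_row (append_col V w * mat_diag (Suc k) d')"
      "j < dim_col (append_col V w * mat_diag (Suc k) d')"
    then have ij: "i < n" "j < Suc k" using V(1) by auto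
    have app: "append_col V w \<in> carrier_mat n (Suc k)" using V(1) by auto
    have R: "(append_col V w * mat_diag (Suc k) d') $$ (i,j) = append_col V w $$ (i,j) * d' j"
      using ij by (simp add: mat_diag_mult_right[OF app])
    have L: "(A * append_col V w) $$ (i,j) = (\<Sum>l<n. A $$ (i,l) * append_col V w $$ (l,j))"
      using ij Ac V(1) by (simp add: index_mult_sum del: index_mult_mat(1))
    show "(A * append_col V w) $$ (i,j) = (append_col V w * mat_diag (Suc k) d') $$ (i,j)"
    proof (cases "j < k")
      case True
      have "(A * V) $$ (i,j) = (V * mat_diag k d) $$ (i,j)" by (simp add: V(3))
      then have "(\<Sum>l<n. A $$ (i,l) * V $$ (l,j)) = V $$ (i,j) * d j"
        using ij True Ac V(1) mat_diag_mult_right[OF V(1), of d]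
        by (simp add: index_mult_sum del: index_mult_mat(1))
      then show ?thesis unfolding R L using True V(1) ij by (simp add: append_col_def d'_def)
    next
      case False
      with ij have j: "j = k" by simp
      have "(A *\<^sub>v w) $ i = (e \<cdot>\<^sub>v w) $ i" by (simp add: 7)
      then have "(\<Sum>l<n. A $$ (i,l) * w $ l) = e * w $ i"
        using ij Ac w by (simp add: index_mult_vec_sum del: index_mult_mat_vec)
      then show ?thesis unfolding R L using j V(1) ij by (simp add: append_col_def d'_def)
    qed
  qed (use V(1) Ac in auto)
  moreover have "append_col V w \<in> carrier_mat n (Suc k)" using V(1) by auto
  ultimately show ?case using isometry_append_col[OF V(1,2) w 1 2] by blast
qed

text \<open>The matrix with eigenvalues \<open>d i\<close> and orthonormal eigenvectors given by the columns of
  \<open>Q\<close>. A rectangular \<open>Q\<close> is meaningful too: the matrix then vanishes on the complement of the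
  range.\<close>

definition diag_conj :: "nat \<Rightarrow> complex mat \<Rightarrow> (nat \<Rightarrow> complex) \<Rightarrow> complex mat" where
  "diag_conj n Q d = Q * (mat_diag n d * Q\<^sup>\<dagger>)"

abbreviation unitary_mat :: "nat \<Rightarrow> complex mat \<Rightarrow> bool" where
  "unitary_mat n Q \<equiv> isometry_mat n n Q"

lemma unitary_matD:
  assumes "unitary_mat n Q"
  shows "Q \<in> carrier_mat n n" "dim_row Q = n" "dim_col Q = n" "Q\<^sup>\<dagger> * Q = 1\<^sub>m n" "Q * Q\<^sup>\<dagger> = 1\<^sub>m n"
    "unitary_mat n (Q\<^sup>\<dagger>)" "contraction Q"
  using assms unitary_commute[of Q n] contraction_isometry[of Q n]
  by (auto simp: isometry_mat_def)

lemma unitary_cancel [simp]: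
  assumes "unitary_mat (dim_row M) Q"
  shows "Q\<^sup>\<dagger> * (Q * M) = M" "Q * (Q\<^sup>\<dagger> * M) = M"
  using unitary_matD(2-5)[OF assms] by (simp_all flip: mult_assoc_dim)

lemma unitary_mat_mult: "unitary_mat n P \<Longrightarrow> unitary_mat n Q \<Longrightarrow> unitary_mat n (P * Q)"
  using unitary_matD(1-4)[of n P] unitary_matD(1-4)[of n Q]
  by (simp add: isometry_mat_def[of n n "P * Q"] adjoint_mult mult_assoc_dim)

lemma diag_conj_carrier: "unitary_mat n Q \<Longrightarrow> diag_conj n Q d \<in> carrier_mat n n"
  by (auto simp: diag_conj_def isometry_mat_def)

lemma dim_diag_conj [simp]: "dim_row (diag_conj n Q d) = dim_row Q" "dim_col (diag_conj n Q d) = dim_row Q"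
  by (auto simp: diag_conj_def)

lemma mat_diag_mult_assoc:
  "dim_row M = n \<Longrightarrow> mat_diag n d * (mat_diag n e * M) = mat_diag n (\<lambda>i. d i * e i :: complex) * M"
  by (subst mult_assoc_dim[symmetric]) auto

lemma diag_conj_mult:
  "unitary_mat n Q \<Longrightarrow> diag_conj n Q d * diag_conj n Q e = diag_conj n Q (\<lambda>i. d i * e i)"
  using unitary_matD[of n Q]
  by (simp add: diag_conj_def mult_assoc_dim mat_diag_mult_assoc)

lemma diag_conj_adjoint:
  "unitary_mat n Q \<Longrightarrow> (diag_conj n Q d)\<^sup>\<dagger> = diag_conj n Q (\<lambda>i. cnj (d i))"
  using unitary_matD[of n Q] by (simp add: diag_conj_def adjoint_mult mult_assoc_dim)

lemma diag_conj_cong: "(\<And>i. i < n \<Longrightarrow> d i = e i) \<Longrightarrow> diag_conj n Q d = diag_conj n Q e"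
  unfolding diag_conj_def mat_diag_def by (rule arg_cong[of _ _ "\<lambda>M. Q * (M * Q\<^sup>\<dagger>)"]) auto

lemma diag_conj_one: "unitary_mat n Q \<Longrightarrow> diag_conj n Q (\<lambda>_. 1) = 1\<^sub>m n"
  using unitary_matD[of n Q] by (simp add: diag_conj_def)

lemma diag_conj_index:
  assumes "dim_col Q = n" "i < dim_row Q" "j < dim_row Q"
  shows "diag_conj n Q d $$ (i,j) = (\<Sum>p<n. Q $$ (i,p) * d p * cnj (Q $$ (j,p)))"
proof -
  have "Q\<^sup>\<dagger> \<in> carrier_mat n (dim_row Q)" using assms by auto
  note m = mat_diag_mult_left[OF this, of d]
  show ?thesis using assms unfolding diag_conj_def m
    by (subst index_mult_sum) (auto simp: mult.assoc)
qed

lemma diag_conj_inj: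
  assumes "unitary_mat n Q" "diag_conj n Q d = diag_conj n Q e" "i < n"
  shows "d i = e i"
proof -
  have *: "Q\<^sup>\<dagger> * (diag_conj n Q f * Q) = mat_diag n f" for f
    using assms(1) unitary_matD[OF assms(1)] by (simp add: diag_conj_def mult_assoc_dim)
  have "mat_diag n d = mat_diag n e" unfolding *[symmetric] assms(2) ..
  then have "mat_diag n d $$ (i,i) = mat_diag n e $$ (i,i)" by simp
  then show ?thesis using assms(3) by (simp add: mat_diag_def)
qed

lemma hermitian_diag_conj: "unitary_mat n Q \<Longrightarrow> hermitian_mat n (diag_conj n Q (\<lambda>i. complex_of_real (d i)))"
  by (simp add: hermitian_mat_def diag_conj_carrier diag_conj_adjoint)

lemma hermitian_diagonalizable:
  assumes A: "hermitian_mat n A"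
  obtains Q d where "unitary_mat n Q" "A = diag_conj n Q (\<lambda>i. complex_of_real (d i))"
proof -
  have Ac: "A \<in> carrier_mat n n" "A\<^sup>\<dagger> = A" using A by (auto simp: hermitian_mat_def)
  from hermitian_eigenvectors[OF A order_refl] obtain Q d
    where Q: "unitary_mat n Q" "A * Q = Q * mat_diag n d" by (auto simp: isometry_mat_def)
  note u = unitary_matD[OF Q(1)]
  have "(A * Q) * Q\<^sup>\<dagger> = A" using u Ac by (simp add: mult_assoc_dim)
  with Q(2) have eq: "A = diag_conj n Q d" using u by (simp add: diag_conj_def mult_assoc_dim)
  have "cnj (d i) = d i" if "i < n" for i
    by (rule diag_conj_inj[OF Q(1) _ that]) (use Ac(2) eq diag_conj_adjoint[OF Q(1), of d] in simp)
  then have "diag_conj n Q d = diag_conj n Q (\<lambda>i. complex_of_real (Re (d i)))"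
    by (intro diag_conj_cong) (simp add: complex_eq_iff)
  with eq Q(1) show thesis by (auto intro: that)
qed

definition decreasing_sort :: "real list \<Rightarrow> real list" where
  "decreasing_sort xs = rev (sort xs)"

lemma length_decreasing_sort [simp]: "length (decreasing_sort xs) = length xs"
  by (simp add: decreasing_sort_def)

lemma mset_decreasing_sort [simp]: "mset (decreasing_sort xs) = mset xs"
  by (simp add: decreasing_sort_def)

lemma decreasing_sort_mono: "i \<le> j \<Longrightarrow> j < length xs \<Longrightarrow> decreasing_sort xs ! j \<le> decreasing_sort xs ! i"
  unfolding decreasing_sort_def by (auto simp: rev_nth intro!: sorted_nth_mono)

lemma decreasing_sort_eqI:
  assumes "\<And>i j. i \<le> j \<Longrightarrow> j < length ys \<Longrightarrow> ys ! j \<le> ys ! i" "mset ys = mset xs"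
  shows "decreasing_sort xs = ys"
proof -
  have "sorted (rev ys)" using assms(1) by (auto simp: sorted_iff_nth_mono rev_nth)
  then have "sort xs = rev ys" by (intro properties_for_sort) (auto simp: assms(2))
  then show ?thesis by (simp add: decreasing_sort_def)
qed

lemma eigvals_diag_conj:
  assumes Q: "unitary_mat n Q"
  shows "eigvals (diag_conj n Q (\<lambda>i. complex_of_real (d i))) = decreasing_sort (map d [0..<n])"
proof -
  let ?D = "mat_diag n (\<lambda>i. complex_of_real (d i))"
  note u = unitary_matD[OF Q]
  have "similar_mat_wit (diag_conj n Q (\<lambda>i. complex_of_real (d i))) ?D Q (Q\<^sup>\<dagger>)"
    using u diag_conj_carrier[OF Q]
    by (intro similar_mat_witI[of _ _ n]) (auto simp: diag_conj_def mult_assoc_dim)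
  then have "char_poly (diag_conj n Q (\<lambda>i. complex_of_real (d i))) = char_poly ?D"
    by (intro char_poly_similar) (auto simp: similar_mat_def)
  also have "\<dots> = (\<Prod>a\<leftarrow>diag_mat ?D. [:- a, 1:])"
    by (rule char_poly_upper_triangular[of _ n]) (auto simp: mat_diag_def)
  also have "diag_mat ?D = map (\<lambda>i. complex_of_real (d i)) [0..<n]"
    by (auto simp: diag_mat_def mat_diag_def)
  finally have cp: "char_poly (diag_conj n Q (\<lambda>i. complex_of_real (d i)))
      = (\<Prod>a\<leftarrow>map (\<lambda>i. complex_of_real (d i)) [0..<n]. [:- a, 1:])" .
  have nz: "(\<Prod>a\<leftarrow>xs. [:- a, 1:]) \<noteq> 0" for xs :: "complex list"
    by (induction xs) (auto simp del: mult_pCons_left)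
  have "proots (\<Prod>a\<leftarrow>xs. [:- a, 1:]) = mset xs" for xs :: "complex list"
    by (induction xs) (auto simp: proots_mult[OF _ nz] simp del: mult_pCons_left)
  then have "proots (char_poly (diag_conj n Q (\<lambda>i. complex_of_real (d i))))
      = mset (map (\<lambda>i. complex_of_real (d i)) [0..<n])" unfolding cp by blast
  then have "image_mset Re (proots (char_poly (diag_conj n Q (\<lambda>i. complex_of_real (d i)))))
      = mset (map d [0..<n])"
    by (simp only: mset_map[symmetric] map_map o_def Re_complex_of_real)
  then show ?thesis
    unfolding eigvals_def decreasing_sort_def by (simp only: sorted_list_of_multiset_mset)
qed

text \<open>The columns of a diagonalizing unitary matrix are permuted into the order of
  \<open>eigvals A\<close>.\<close>

lemma spectral_theorem:
  assumes A: "hermitian_mat n A"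
  obtains Q where "unitary_mat n Q" "A = diag_conj n Q (\<lambda>i. complex_of_real (eigvals A ! i))"
proof -
  obtain Q d where Q: "unitary_mat n Q" "A = diag_conj n Q (\<lambda>i. complex_of_real (d i))"
    using hermitian_diagonalizable[OF A] .
  note u = unitary_matD[OF Q(1)]
  have "mset (eigvals A) = mset (map d [0..<n])"
    unfolding Q(2) eigvals_diag_conj[OF Q(1)] by simp
  then obtain p where p: "p permutes {..<n}" "permute_list p (map d [0..<n]) = eigvals A"
    by (rule mset_eq_permutation) simp
  have pn: "p i < n" if "i < n" for i using p(1) that permutes_in_image by fastforce
  have ev: "eigvals A ! i = d (p i)" if "i < n" for i
    unfolding p(2)[symmetric] using p(1) pn[OF that] that by (subst permute_list_nth) auto
  define R where "R = mat n n (\<lambda>(i,j). Q $$ (i, p j))"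
  have "R\<^sup>\<dagger> * R = 1\<^sub>m n"
  proof (rule eq_matI)
    fix i j assume "i < dim_row (1\<^sub>m n :: complex mat)" "j < dim_col (1\<^sub>m n :: complex mat)"
    then have ij: "i < n" "j < n" by auto
    have "(R\<^sup>\<dagger> * R) $$ (i,j) = (Q\<^sup>\<dagger> * Q) $$ (p i, p j)"
      using ij pn u(2,3) by (simp add: index_mult_sum R_def del: index_mult_mat(1))
    also have "\<dots> = 1\<^sub>m n $$ (i,j)"
      unfolding u(4) using ij pn permutes_inj[OF p(1)] by (auto simp: inj_eq)
    finally show "(R\<^sup>\<dagger> * R) $$ (i,j) = 1\<^sub>m n $$ (i,j)" .
  qed (auto simp: R_def)
  then have R: "unitary_mat n R" by (simp add: isometry_mat_def R_def)
  have "A = diag_conj n R (\<lambda>i. complex_of_real (eigvals A ! i))"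
  proof (rule eq_matI)
    fix i j assume "i < dim_row (diag_conj n R (\<lambda>i. complex_of_real (eigvals A ! i)))"
      "j < dim_col (diag_conj n R (\<lambda>i. complex_of_real (eigvals A ! i)))"
    then have ij: "i < n" "j < n" by (auto simp: R_def)
    have "diag_conj n R (\<lambda>i. complex_of_real (eigvals A ! i)) $$ (i,j)
        = (\<Sum>l<n. R $$ (i,l) * complex_of_real (eigvals A ! l) * cnj (R $$ (j,l)))"
      using ij by (subst diag_conj_index) (auto simp: R_def)
    also have "\<dots> = (\<Sum>l<n. Q $$ (i,p l) * complex_of_real (d (p l)) * cnj (Q $$ (j,p l)))"
      using ij by (intro sum.cong) (auto simp: R_def ev)
    also have "\<dots> = (\<Sum>l<n. Q $$ (i,l) * complex_of_real (d l) * cnj (Q $$ (j,l)))"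
      using sum.permute[OF p(1), of "\<lambda>l. Q $$ (i,l) * complex_of_real (d l) * cnj (Q $$ (j,l))"]
      by (simp add: o_def)
    also have "\<dots> = A $$ (i,j)"
      unfolding Q(2) using ij u(2,3) by (subst diag_conj_index) auto
    finally show "A $$ (i,j) = diag_conj n R (\<lambda>i. complex_of_real (eigvals A ! i)) $$ (i,j)" ..
  qed (use Q u in \<open>auto simp: R_def\<close>)
  with R show thesis by (rule that)
qed

lemma
  assumes A: "hermitian_mat n A"
  shows length_eigvals: "length (eigvals A) = n"
    and eigvals_decreasing: "i \<le> j \<Longrightarrow> j < n \<Longrightarrow> eigvals A ! j \<le> eigvals A ! i"
proof -
  obtain Q d where Q: "unitary_mat n Q" "A = diag_conj n Q (\<lambda>i. complex_of_real (d i))"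
    using hermitian_diagonalizable[OF A] .
  show "length (eigvals A) = n" "i \<le> j \<Longrightarrow> j < n \<Longrightarrow> eigvals A ! j \<le> eigvals A ! i"
    unfolding Q(2) eigvals_diag_conj[OF Q(1)] by (auto intro: decreasing_sort_mono)
qed

section \<open>Singular values\<close>

lemma psd_diag_conj:
  assumes Q: "unitary_mat n Q" and d: "\<And>i. i < n \<Longrightarrow> 0 \<le> d i"
  shows "psd_mat n (diag_conj n Q (\<lambda>i. complex_of_real (d i)))"
  unfolding psd_mat_def
proof (intro conjI ballI)
  show "hermitian_mat n (diag_conj n Q (\<lambda>i. complex_of_real (d i)))"
    by (rule hermitian_diag_conj[OF Q])
  fix v :: "complex vec" assume v: "v \<in> carrier_vec n"
  let ?R = "diag_conj n Q (\<lambda>i. complex_of_real (sqrt (d i)))"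
  have dims: "dim_row ?R = n" "dim_col ?R = n" using unitary_matD[OF Q] by auto
  have "diag_conj n Q (\<lambda>i. complex_of_real (d i)) = ?R\<^sup>\<dagger> * ?R"
    unfolding diag_conj_adjoint[OF Q] diag_conj_mult[OF Q]
    by (rule diag_conj_cong) (simp add: d flip: of_real_mult)
  then have "(diag_conj n Q (\<lambda>i. complex_of_real (d i)) *\<^sub>v v) \<bullet>c v = (?R *\<^sub>v v) \<bullet>c (?R *\<^sub>v v)"
    using v dims cscalar_adjoint[of "?R *\<^sub>v v" "?R\<^sup>\<dagger>" v] by (simp add: mult_vec_assoc_dim)
  then show "0 \<le> Re ((diag_conj n Q (\<lambda>i. complex_of_real (d i)) *\<^sub>v v) \<bullet>c v)"
    by (simp flip: sqnorm_cscalar)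
qed

lemma psd_diag_conj_nonneg:
  assumes Q: "unitary_mat n Q" and psd: "psd_mat n (diag_conj n Q (\<lambda>i. complex_of_real (d i)))" and "i < n"
  shows "0 \<le> d i"
proof -
  let ?D = "mat_diag n (\<lambda>i. complex_of_real (d i))"
  let ?e = "unit_vec n i :: complex vec"
  note u = unitary_matD[OF Q]
  have De: "?D *\<^sub>v ?e = complex_of_real (d i) \<cdot>\<^sub>v ?e"
    using \<open>i < n\<close> by (intro eq_vecI) (auto simp: mat_diag_def)
  have "diag_conj n Q (\<lambda>i. complex_of_real (d i)) *\<^sub>v (Q *\<^sub>v ?e) = Q *\<^sub>v (?D *\<^sub>v ?e)"
    using u by (simp add: diag_conj_def flip: mult_vec_assoc_dim) (simp add: mult_assoc_dim)
  then have "(diag_conj n Q (\<lambda>i. complex_of_real (d i)) *\<^sub>v (Q *\<^sub>v ?e)) \<bullet>c (Q *\<^sub>v ?e) = (?D *\<^sub>v ?e) \<bullet>c ?e"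
    using u cscalar_adjoint[of "?D *\<^sub>v ?e" Q "Q *\<^sub>v ?e"] by (simp flip: mult_vec_assoc_dim)
  also have "\<dots> = complex_of_real (d i)"
    unfolding De using \<open>i < n\<close> by (simp add: smult_scalar_prod_distrib[of _ n])
  finally show ?thesis
    using psd u by (simp add: psd_mat_def) (metis Re_complex_of_real mult_mat_vec_carrier unit_vec_carrier)
qed

text \<open>For the uniqueness, let \<open>P\<close> be a root that is diagonalized by \<open>S\<close> with eigenvalues \<open>e\<close>.
  Equality of the squares says \<open>e\<^sub>i\<^sup>2 W\<^sub>i\<^sub>j = W\<^sub>i\<^sub>j d\<^sub>j\<^sup>2\<close> for the entries of \<open>W = S\<^sup>* Q\<close>. As \<open>e\<close> and \<open>d\<close> are
  non-negative, also \<open>e\<^sub>i W\<^sub>i\<^sub>j = W\<^sub>i\<^sub>j d\<^sub>j\<close>, which is equality of the roots.\<close>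

lemma psd_sqrt_diag_conj:
  assumes Q: "unitary_mat n Q" and d: "\<And>i. i < n \<Longrightarrow> 0 \<le> d i"
  shows "psd_sqrt (diag_conj n Q (\<lambda>i. complex_of_real ((d i)\<^sup>2))) = diag_conj n Q (\<lambda>i. complex_of_real (d i))"
proof -
  note u = unitary_matD[OF Q]
  let ?A = "diag_conj n Q (\<lambda>i. complex_of_real ((d i)\<^sup>2))"
  let ?R = "diag_conj n Q (\<lambda>i. complex_of_real (d i))"
  have "psd_mat n ?R \<and> ?R * ?R = ?A"
    using psd_diag_conj[OF Q, of d] d by (simp add: diag_conj_mult[OF Q] power2_eq_square)
  moreover have "P = ?R" if P: "psd_mat n P \<and> P * P = ?A" for P
  proof -
    obtain S e where S: "unitary_mat n S" "P = diag_conj n S (\<lambda>i. complex_of_real (e i))"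
      using hermitian_diagonalizable[of n P] P by (auto simp: psd_mat_def)
    note s = unitary_matD[OF S(1)]
    have e: "0 \<le> e i" if "i < n" for i
      using psd_diag_conj_nonneg[OF S(1) _ that] P S(2) by blast
    let ?W = "S\<^sup>\<dagger> * Q"
    have W: "?W \<in> carrier_mat n n" using s u by auto
    have "S * (mat_diag n (\<lambda>i. complex_of_real ((e i)\<^sup>2)) * S\<^sup>\<dagger>) = Q * (mat_diag n (\<lambda>i. complex_of_real ((d i)\<^sup>2)) * Q\<^sup>\<dagger>)"
      using P unfolding S(2) diag_conj_mult[OF S(1)] by (simp add: diag_conj_def power2_eq_square)
    then have "S\<^sup>\<dagger> * (S * (mat_diag n (\<lambda>i. complex_of_real ((e i)\<^sup>2)) * S\<^sup>\<dagger>)) * Q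
      = S\<^sup>\<dagger> * (Q * (mat_diag n (\<lambda>i. complex_of_real ((d i)\<^sup>2)) * Q\<^sup>\<dagger>)) * Q" by simp
    then have DW: "mat_diag n (\<lambda>i. complex_of_real ((e i)\<^sup>2)) * ?W = ?W * mat_diag n (\<lambda>i. complex_of_real ((d i)\<^sup>2))"
      using s u S(1) Q by (simp add: mult_assoc_dim)
    have sq: "complex_of_real ((e i)\<^sup>2) * ?W $$ (i,j) = ?W $$ (i,j) * complex_of_real ((d j)\<^sup>2)" if "i < n" "j < n" for i j
      using arg_cong[of _ _ "\<lambda>M. M $$ (i,j)", OF DW[unfolded mat_diag_mult_left[OF W] mat_diag_mult_right[OF W]]]
        that by simp
    have "complex_of_real (e i) * ?W $$ (i,j) = ?W $$ (i,j) * complex_of_real (d j)" if "i < n" "j < n" for i j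
    proof (cases "?W $$ (i,j) = 0")
      case False
      then have "complex_of_real ((e i)\<^sup>2) = complex_of_real ((d j)\<^sup>2)" using sq[OF that] by simp
      then have "(e i)\<^sup>2 = (d j)\<^sup>2" using of_real_eq_iff by blast
      then show ?thesis using e[OF that(1)] d[OF that(2)] by (simp add: power2_eq_iff_nonneg)
    qed auto
    then have "mat_diag n (\<lambda>i. complex_of_real (e i)) * ?W = ?W * mat_diag n (\<lambda>i. complex_of_real (d i))"
      unfolding mat_diag_mult_left[OF W] mat_diag_mult_right[OF W] by (intro eq_matI) auto
    note comm = this
    have "P = S * (mat_diag n (\<lambda>i. complex_of_real (e i)) * S\<^sup>\<dagger>) * (Q * Q\<^sup>\<dagger>)"
      using s u by (simp add: S(2) diag_conj_def)
    also have "\<dots> = S * (mat_diag n (\<lambda>i. complex_of_real (e i)) * ?W) * Q\<^sup>\<dagger>"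
      using s(2,3) u(2,3) by (simp add: mult_assoc_dim)
    also have "\<dots> = S * (S\<^sup>\<dagger> * (Q * (mat_diag n (\<lambda>i. complex_of_real (d i)) * Q\<^sup>\<dagger>)))"
      unfolding comm using s(2,3) u(2,3) by (simp add: mult_assoc_dim)
    also have "\<dots> = ?R"
      using S(1) u(2,3) by (simp add: diag_conj_def)
    finally show ?thesis .
  qed
  ultimately have "(THE P. psd_mat n P \<and> P * P = ?A) = ?R" by (rule the_equality)
  then show ?thesis by (simp only: psd_sqrt_def dim_diag_conj u(2))
qed

lemma sing_vals_eqI:
  assumes Q: "unitary_mat n Q" and d: "\<And>i. i < n \<Longrightarrow> 0 \<le> d i"
    and C: "C\<^sup>\<dagger> * C = diag_conj n Q (\<lambda>i. complex_of_real ((d i)\<^sup>2))"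
  shows "sing_vals C = decreasing_sort (map d [0..<n])"
proof -
  have "psd_sqrt (C\<^sup>\<dagger> * C) = diag_conj n Q (\<lambda>i. complex_of_real (d i))"
    unfolding C using d by (rule psd_sqrt_diag_conj[OF Q])
  then show ?thesis by (simp add: sing_vals_def eigvals_diag_conj[OF Q])
qed

definition decr_nonneg :: "real list \<Rightarrow> bool" where
  "decr_nonneg x \<longleftrightarrow> (\<forall>i j. i \<le> j \<longrightarrow> j < length x \<longrightarrow> x ! j \<le> x ! i) \<and> (\<forall>i < length x. 0 \<le> x ! i)"

lemma decreasing_sort_id: "decr_nonneg x \<Longrightarrow> mset x = mset y \<Longrightarrow> decreasing_sort y = x"
  by (rule decreasing_sort_eqI) (auto simp: decr_nonneg_def)

lemma sing_vals_gram:
  assumes "dim_col C = n"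
  obtains Q where "unitary_mat n Q" "C\<^sup>\<dagger> * C = diag_conj n Q (\<lambda>i. complex_of_real ((sing_vals C ! i)\<^sup>2))"
    "length (sing_vals C) = n" "decr_nonneg (sing_vals C)"
proof -
  have H: "hermitian_mat n (C\<^sup>\<dagger> * C)" using assms by (auto simp: hermitian_mat_def adjoint_mult)
  let ?e = "eigvals (C\<^sup>\<dagger> * C)"
  obtain Q where Q: "unitary_mat n Q" "C\<^sup>\<dagger> * C = diag_conj n Q (\<lambda>i. complex_of_real (?e ! i))"
    using spectral_theorem[OF H] .
  have "psd_mat n (C\<^sup>\<dagger> * C)"
    unfolding psd_mat_def
  proof (intro conjI ballI H)
    fix v :: "complex vec" assume "v \<in> carrier_vec n"
    then have "((C\<^sup>\<dagger> * C) *\<^sub>v v) \<bullet>c v = complex_of_real (sqnorm (C *\<^sub>v v))"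
      using assms cscalar_adjoint[of "C *\<^sub>v v" "C\<^sup>\<dagger>" v] by (simp add: mult_vec_assoc_dim sqnorm_cscalar)
    then show "0 \<le> Re (((C\<^sup>\<dagger> * C) *\<^sub>v v) \<bullet>c v)" by simp
  qed
  then have e: "0 \<le> ?e ! i" if "i < n" for i
    using psd_diag_conj_nonneg[OF Q(1) _ that, of "\<lambda>i. ?e ! i"] Q(2) by metis
  define d where "d = map (\<lambda>i. sqrt (?e ! i)) [0..<n]"
  have gram: "C\<^sup>\<dagger> * C = diag_conj n Q (\<lambda>i. complex_of_real ((d ! i)\<^sup>2))"
    by (subst Q(2), rule diag_conj_cong) (auto simp: d_def e)
  have dn: "decr_nonneg d" "length d = n"
    using eigvals_decreasing[OF H] e by (auto simp: decr_nonneg_def d_def)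
  have "sing_vals C = decreasing_sort (map (\<lambda>i. d ! i) [0..<n])"
    by (rule sing_vals_eqI[OF Q(1) _ gram]) (auto simp: d_def e)
  also have "map (\<lambda>i. d ! i) [0..<n] = d" using dn(2) map_nth by auto
  also have "decreasing_sort d = d" using dn(1) by (rule decreasing_sort_id) simp
  finally show thesis using that[OF Q(1)] gram dn by simp
qed

lemma
  assumes "dim_col C = n"
  shows length_sing_vals: "length (sing_vals C) = n"
    and decr_nonneg_sing_vals: "decr_nonneg (sing_vals C)"
  using sing_vals_gram[OF assms] by auto

lemma sing_vals_gram_cong: "C\<^sup>\<dagger> * C = D\<^sup>\<dagger> * D \<Longrightarrow> sing_vals C = sing_vals D"
  by (simp add: sing_vals_def)

lemma sing_vals_unitary_left:
  assumes "unitary_mat (dim_row C) W" shows "sing_vals (W * C) = sing_vals C"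
  using assms unitary_matD[OF assms]
  by (intro sing_vals_gram_cong) (simp add: adjoint_mult mult_assoc_dim)

lemma sing_vals_unitary_right:
  assumes W: "unitary_mat (dim_col C) W" shows "sing_vals (C * W) = sing_vals C"
proof -
  define n where "n = dim_col C"
  obtain Q where Q: "unitary_mat n Q" "C\<^sup>\<dagger> * C = diag_conj n Q (\<lambda>i. complex_of_real ((sing_vals C ! i)\<^sup>2))"
    "length (sing_vals C) = n" "decr_nonneg (sing_vals C)" using sing_vals_gram n_def by metis
  note u = unitary_matD[OF Q(1)] and w = unitary_matD[OF W[folded n_def]]
  have R: "unitary_mat n (W\<^sup>\<dagger> * Q)" using unitary_mat_mult[OF w(6) Q(1)] .
  have "(C * W)\<^sup>\<dagger> * (C * W) = W\<^sup>\<dagger> * ((C\<^sup>\<dagger> * C) * W)"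
    using w n_def by (simp add: adjoint_mult mult_assoc_dim)
  also have "\<dots> = diag_conj n (W\<^sup>\<dagger> * Q) (\<lambda>i. complex_of_real ((sing_vals C ! i)\<^sup>2))"
    unfolding Q(2) using u w by (simp add: diag_conj_def adjoint_mult mult_assoc_dim)
  finally have "sing_vals (C * W) = decreasing_sort (map (\<lambda>i. sing_vals C ! i) [0..<n])"
    using Q(3,4) by (intro sing_vals_eqI[OF R]) (auto simp: decr_nonneg_def)
  also have "map (\<lambda>i. sing_vals C ! i) [0..<n] = sing_vals C" using Q(3) map_nth by blast
  also have "decreasing_sort (sing_vals C) = sing_vals C" using Q(4) by (rule decreasing_sort_id) simp
  finally show ?thesis .
qed

lemma decreasing_threshold:
  fixes n :: nat and s :: "nat \<Rightarrow> real"
  assumes "\<And>i j. i \<le> j \<Longrightarrow> j < n \<Longrightarrow> s j \<le> s i"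
  obtains r where "r \<le> n" "\<And>i. i < n \<Longrightarrow> 0 < s i \<longleftrightarrow> i < r"
proof -
  have "(\<forall>i j. i \<le> j \<longrightarrow> j < n \<longrightarrow> s j \<le> s i) \<Longrightarrow> \<exists>r \<le> n. \<forall>i < n. 0 < s i \<longleftrightarrow> i < r"
  proof (induction n)
    case (Suc n)
    then obtain r where r: "r \<le> n" "\<forall>i < n. 0 < s i \<longleftrightarrow> i < r" by auto
    show ?case
    proof (cases "0 < s n")
      case True
      have "0 < s i" if "i < Suc n" for i
        using True Suc.prems[rule_format, of i n] that by simp
      then show ?thesis by (intro exI[of _ "Suc n"]) auto
    next
      case False
      then show ?thesis using r by (intro exI[of _ r]) (auto simp: less_Suc_eq)
    qed
  qed auto
  with assms have "\<exists>r \<le> n. \<forall>i < n. 0 < s i \<longleftrightarrow> i < r" by blast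
  then show thesis using that by blast
qed

text \<open>If \<open>G\<close> diagonalizes \<open>C\<^sup>* C\<close>, then the columns of \<open>C G\<close> are orthogonal, and their norms are
  the singular values. The nonzero columns come first; normalized, they are completed to the
  unitary matrix \<open>F\<close>.\<close>

lemma singular_value_decomposition:
  assumes C: "C \<in> carrier_mat n n"
  obtains F G where "unitary_mat n F" "unitary_mat n G"
    "C * G = F * mat_diag n (\<lambda>i. complex_of_real (sing_vals C ! i))"
proof -
  let ?s = "\<lambda>i. sing_vals C ! i"
  obtain G where G: "unitary_mat n G" "C\<^sup>\<dagger> * C = diag_conj n G (\<lambda>i. complex_of_real ((?s i)\<^sup>2))"
    and s: "length (sing_vals C) = n" "decr_nonneg (sing_vals C)"
    using sing_vals_gram C by blast
  note u = unitary_matD[OF G(1)]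
  define M where "M = C * G"
  have M: "M \<in> carrier_mat n n" using C u by (auto simp: M_def)
  have "M\<^sup>\<dagger> * M = G\<^sup>\<dagger> * ((C\<^sup>\<dagger> * C) * G)" using C u by (simp add: M_def adjoint_mult mult_assoc_dim)
  also have "\<dots> = mat_diag n (\<lambda>i. complex_of_real ((?s i)\<^sup>2))"
    unfolding G(2) using u G(1) by (simp add: diag_conj_def mult_assoc_dim)
  finally have MM: "M\<^sup>\<dagger> * M = mat_diag n (\<lambda>i. complex_of_real ((?s i)\<^sup>2))" .
  obtain r where r: "r \<le> n" "\<And>i. i < n \<Longrightarrow> 0 < ?s i \<longleftrightarrow> i < r"
    using decreasing_threshold[of n ?s] s by (auto simp: decr_nonneg_def)
  define V where "V = take_cols r M * mat_diag r (\<lambda>i. complex_of_real (1 / ?s i))"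
  have tM: "take_cols r M \<in> carrier_mat n r" using M by auto
  have Vi: "V $$ (i,j) = M $$ (i,j) * complex_of_real (1 / ?s j)" if "i < n" "j < r" for i j
    using that M unfolding V_def mat_diag_mult_right[OF tM] by simp
  have V: "V \<in> carrier_mat n r" using M by (auto simp: V_def)
  have "V\<^sup>\<dagger> * V = 1\<^sub>m r"
  proof (rule eq_matI)
    fix i j assume "i < dim_row (1\<^sub>m r :: complex mat)" "j < dim_col (1\<^sub>m r :: complex mat)"
    then have ij: "i < r" "j < r" by auto
    then have pos: "?s i > 0" "?s j > 0" using r by auto
    have "(V\<^sup>\<dagger> * V) $$ (i,j) = (\<Sum>l<n. cnj (V $$ (l,i)) * V $$ (l,j))"
      using V ij by (simp add: index_mult_sum del: index_mult_mat(1))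
    also have "\<dots> = (\<Sum>l<n. cnj (M $$ (l,i)) * M $$ (l,j)) * complex_of_real (1 / ?s i * (1 / ?s j))"
      unfolding sum_distrib_right using ij by (intro sum.cong) (auto simp: Vi)
    also have "(\<Sum>l<n. cnj (M $$ (l,i)) * M $$ (l,j)) = (M\<^sup>\<dagger> * M) $$ (i,j)"
      using M ij r(1) by (simp add: index_mult_sum del: index_mult_mat(1))
    also have "\<dots> * complex_of_real (1 / ?s i * (1 / ?s j)) = 1\<^sub>m r $$ (i,j)"
      unfolding MM using ij r(1) pos by (auto simp: mat_diag_def power2_eq_square simp flip: of_real_mult)
    finally show "(V\<^sup>\<dagger> * V) $$ (i,j) = 1\<^sub>m r $$ (i,j)" .
  qed (use V in auto)
  then obtain F where F: "F \<in> carrier_mat n n" "F\<^sup>\<dagger> * F = 1\<^sub>m n" "take_cols r F = V"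
    using isometry_extend[OF V _ r(1)] by blast
  have "M = F * mat_diag n (\<lambda>i. complex_of_real (?s i))"
    unfolding mat_diag_mult_right[OF F(1)]
  proof (rule eq_matI)
    fix i j assume "i < dim_row (mat n n (\<lambda>(i, j). F $$ (i, j) * complex_of_real (?s j)))"
      "j < dim_col (mat n n (\<lambda>(i, j). F $$ (i, j) * complex_of_real (?s j)))"
    then have ij: "i < n" "j < n" by auto
    have "M $$ (i,j) = F $$ (i,j) * complex_of_real (?s j)"
    proof (cases "j < r")
      case True
      then have "F $$ (i,j) = V $$ (i,j)" using F(1,3) ij by (metis carrier_matD(1) index_take_cols)
      then show ?thesis using Vi[OF ij(1) True] r(2)[OF ij(2)] True by simp
    next
      case False
      then have s0: "?s j = 0" using r(2)[OF ij(2)] s ij by (auto simp: decr_nonneg_def not_less intro: antisym)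
      have "complex_of_real (\<Sum>l<n. (cmod (M $$ (l,j)))\<^sup>2) = (M\<^sup>\<dagger> * M) $$ (j,j)"
        using M ij by (simp add: index_mult_sum complex_norm_square mult.commute del: index_mult_mat(1) of_real_power)
      also have "\<dots> = 0" unfolding MM using ij s0 by (simp add: mat_diag_def)
      finally have "(\<Sum>l<n. (cmod (M $$ (l,j)))\<^sup>2) = 0" using of_real_eq_0_iff by blast
      then have "M $$ (i,j) = 0" using ij by (simp add: sum_nonneg_eq_0_iff)
      then show ?thesis using s0 by simp
    qed
    then show "M $$ (i,j) = mat n n (\<lambda>(i, j). F $$ (i, j) * complex_of_real (?s j)) $$ (i,j)" using ij by simp
  qed (use M in auto)
  with F G(1) show thesis using that[of F G] by (simp add: isometry_mat_def M_def)
qed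

section \<open>Submajorization and the spectral spread\<close>

text \<open>Padding and sorting only append zeros to a non-negative decreasing list.\<close>

lemma submajorizedI:
  assumes x: "decr_nonneg x" and y: "decr_nonneg y"
    and le: "\<And>j. j \<le> max (length x) (length y) \<Longrightarrow>
      (\<Sum>i<min j (length x). x ! i) \<le> (\<Sum>i<min j (length y). y ! i)"
  shows "x \<prec>\<^sub>w y"
proof -
  have pad: "pad_decr m z = z @ replicate (m - length z) 0" if "decr_nonneg z" for m z
  proof -
    have "decr_nonneg (z @ replicate (m - length z) 0)"
      using that by (auto simp: decr_nonneg_def nth_append)
    then show ?thesis
      using decreasing_sort_id[of "z @ replicate (m - length z) 0"] by (simp add: pad_decr_def decreasing_sort_def)
  qed
  have tk: "sum_list (take j (pad_decr m z)) = (\<Sum>i<min j (length z). z ! i)" if "decr_nonneg z" for j m z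
    using sum_list_sum_nth[of "take j z"]
    by (simp add: pad[OF that] sum_list_replicate take_replicate atLeast0LessThan min.commute)
  show ?thesis
    unfolding submajorized_def Let_def using le by (auto simp: tk[OF x] tk[OF y])
qed

lemma
  assumes A: "hermitian_mat N A"
  shows length_spr_plus: "length (spr_plus A) = N div 2"
    and nth_spr_plus: "i < N div 2 \<Longrightarrow> spr_plus A ! i = eigvals A ! i - eigvals A ! (N - 1 - i)"
    and decr_nonneg_spr_plus: "decr_nonneg (spr_plus A)"
proof -
  have d: "dim_row A = N" using A by (auto simp: hermitian_mat_def)
  show l: "length (spr_plus A) = N div 2" by (simp add: spr_plus_def d)
  show n: "spr_plus A ! i = eigvals A ! i - eigvals A ! (N - 1 - i)" if "i < N div 2" for i
    using that by (simp add: spr_plus_def d)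
  show "decr_nonneg (spr_plus A)"
    unfolding decr_nonneg_def l
  proof (intro conjI allI impI)
    fix i j assume "i \<le> j" "j < N div 2"
    then have "eigvals A ! j \<le> eigvals A ! i" "eigvals A ! (N - 1 - i) \<le> eigvals A ! (N - 1 - j)"
      by (auto intro: eigvals_decreasing[OF A])
    with \<open>i \<le> j\<close> \<open>j < N div 2\<close> show "spr_plus A ! j \<le> spr_plus A ! i"
      using n[of i] n[of j] by simp
  next
    fix i assume "i < N div 2"
    then show "0 \<le> spr_plus A ! i" using n[of i] eigvals_decreasing[OF A, of i "N - 1 - i"] by simp
  qed
qed

section \<open>Weighted sums of decreasing sequences\<close>

text \<open>Let \<open>a\<close> be the \<open>k\<close>-th value of \<open>lam\<close>. Relative to \<open>a\<close>, the first \<open>k\<close> terms are non-negative and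
  the others non-positive, so that weights 1 on the former are best. Passing from \<open>a\<close> to the
  smaller reference value \<open>c\<close> adds \<open>a - c\<close> times the total weight, which is at most \<open>k\<close>.\<close>

lemma weighted_sum_le_top:
  fixes lam m :: "nat \<Rightarrow> real"
  assumes dec: "\<And>i j. i \<le> j \<Longrightarrow> j < N \<Longrightarrow> lam j \<le> lam i" and "k \<le> N"
    and m: "\<And>i. i < N \<Longrightarrow> 0 \<le> m i" "\<And>i. i < N \<Longrightarrow> m i \<le> 1" "(\<Sum>i<N. m i) \<le> real k"
    and c: "\<And>i. i < k \<Longrightarrow> c \<le> lam i"
  shows "(\<Sum>i<N. (lam i - c) * m i) \<le> (\<Sum>i<k. lam i - c)"
proof (cases "k = 0")
  case True
  then have "(\<Sum>i<N. m i) = 0" using m by (intro antisym sum_nonneg) auto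
  then have "m i = 0" if "i < N" for i using m that sum_nonneg_eq_0_iff[of "{..<N}" m] by simp
  then show ?thesis using True by simp
next
  case False
  define a where "a = lam (k - 1)"
  have "c \<le> a" using c False by (simp add: a_def)
  have "(lam i - a) * m i \<le> (if i < k then lam i - a else 0)" if "i < N" for i
  proof (cases "i < k")
    case True
    then have "a \<le> lam i" unfolding a_def using dec[of i "k - 1"] \<open>k \<le> N\<close> by simp
    then have "(lam i - a) * m i \<le> (lam i - a) * 1" using m(2)[OF that] by (intro mult_left_mono) auto
    then show ?thesis using True by simp
  next
    case f: False
    then have "lam i \<le> a" unfolding a_def using dec[of "k - 1" i] that by simp
    then show ?thesis using f m(1)[OF that] by (simp add: mult_nonpos_nonneg)
  qed
  then have "(\<Sum>i<N. (lam i - a) * m i) \<le> (\<Sum>i<N. if i < k then lam i - a else 0)" by (intro sum_mono) simp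
  also have "\<dots> = (\<Sum>i<k. lam i - a)"
    using \<open>k \<le> N\<close> by (intro sum.mono_neutral_cong_right) auto
  finally have 1: "(\<Sum>i<N. (lam i - a) * m i) \<le> (\<Sum>i<k. lam i - a)" .
  have "(\<Sum>i<N. (lam i - c) * m i) = (\<Sum>i<N. (lam i - a) * m i) + (a - c) * (\<Sum>i<N. m i)"
    unfolding sum_distrib_left sum.distrib[symmetric] by (simp add: algebra_simps)
  also have "\<dots> \<le> (\<Sum>i<k. lam i - a) + (a - c) * real k"
    using 1 m(3) \<open>c \<le> a\<close> by (intro add_mono mult_left_mono) auto
  also have "\<dots> = (\<Sum>i<k. lam i - c)" by (simp add: sum_subtractf algebra_simps)
  finally show ?thesis .
qed

text \<open>Since both weights have the same total, \<open>lam\<close> may be measured from any reference value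
  \<open>c\<close>. For the \<open>k\<close>-th largest value as \<open>c\<close>, the preceding bound applies to \<open>m\<close> at the upper end and,
  after reversing the order and the sign of \<open>lam\<close>, to \<open>m'\<close> at the lower end. The latter needs
  that the \<open>k\<close> smallest values are at most \<open>c\<close>, which holds because \<open>2 k \<le> N\<close>.\<close>

lemma weighted_sum_le_spread:
  fixes lam m m' :: "nat \<Rightarrow> real"
  assumes dec: "\<And>i j. i \<le> j \<Longrightarrow> j < N \<Longrightarrow> lam j \<le> lam i" and k: "k \<le> N div 2"
    and m: "\<And>i. i < N \<Longrightarrow> 0 \<le> m i" "\<And>i. i < N \<Longrightarrow> m i \<le> 1" "(\<Sum>i<N. m i) \<le> real k"
    and m': "\<And>i. i < N \<Longrightarrow> 0 \<le> m' i" "\<And>i. i < N \<Longrightarrow> m' i \<le> 1" "(\<Sum>i<N. m' i) = (\<Sum>i<N. m i)"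
  shows "(\<Sum>i<N. lam i * m i) - (\<Sum>i<N. lam i * m' i) \<le> (\<Sum>i<k. lam i - lam (N - 1 - i))"
proof -
  define c where "c = lam (k - 1)"
  have 1: "(\<Sum>i<N. (lam i - c) * m i) \<le> (\<Sum>i<k. lam i - c)"
    using dec k m by (intro weighted_sum_le_top) (auto simp: c_def)
  have reflect: "(\<Sum>i<N. f (N - 1 - i)) = (\<Sum>i<N. f i)" for f :: "nat \<Rightarrow> real"
    using sum.nat_diff_reindex[of f N] by simp
  have "(\<Sum>i<N. (- lam (N - 1 - i) - - c) * m' (N - 1 - i)) \<le> (\<Sum>i<k. - lam (N - 1 - i) - - c)"
  proof (rule weighted_sum_le_top)
    show "- lam (N - 1 - j) \<le> - lam (N - 1 - i)" if "i \<le> j" "j < N" for i j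
      using dec[of "N - 1 - j" "N - 1 - i"] that by simp
    show "(\<Sum>i<N. m' (N - 1 - i)) \<le> real k" using reflect[of m'] m'(3) m(3) by simp
    show "- c \<le> - lam (N - 1 - i)" if "i < k" for i
      unfolding c_def using dec[of "k - 1" "N - 1 - i"] that k by simp
  qed (use m' k in auto)
  then have 2: "(\<Sum>i<N. (c - lam i) * m' i) \<le> (\<Sum>i<k. c - lam (N - 1 - i))"
    using reflect[of "\<lambda>i. (c - lam i) * m' i"] by simp
  have "(\<Sum>i<N. lam i * m i) - (\<Sum>i<N. lam i * m' i) = (\<Sum>i<N. (lam i - c) * m i) + (\<Sum>i<N. (c - lam i) * m' i)"
    by (simp add: left_diff_distrib sum_subtractf m'(3) flip: sum_distrib_left)
  also have "\<dots> \<le> (\<Sum>i<k. lam i - c) + (\<Sum>i<k. c - lam (N - 1 - i))" using 1 2 by (rule add_mono)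
  also have "\<dots> = (\<Sum>i<k. lam i - lam (N - 1 - i))" by (simp add: sum_subtractf)
  finally show ?thesis .
qed

text \<open>Summation by parts: the claim is a combination of the inequalities between partial
  sums, whose coefficients are the decrements of \<open>e\<close>.\<close>

lemma Abel_sum_mono:
  fixes e b c :: "nat \<Rightarrow> real"
  assumes e: "\<And>i j. i \<le> j \<Longrightarrow> j < m \<Longrightarrow> e j \<le> e i" "\<And>i. i < m \<Longrightarrow> 0 \<le> e i"
    and le: "\<And>l. l \<le> m \<Longrightarrow> (\<Sum>i<l. b i) \<le> (\<Sum>i<l. c i)"
  shows "(\<Sum>i<m. e i * b i) \<le> (\<Sum>i<m. e i * c i)"
proof -
  define d where "d i = c i - b i" for i
  have d: "0 \<le> (\<Sum>i<l. d i)" if "l \<le> m" for l using le[OF that] by (simp add: d_def sum_subtractf)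
  have *: "e l * (\<Sum>i<Suc l. d i) \<le> (\<Sum>i<Suc l. e i * d i)" if "Suc l \<le> m" for l
    using that
  proof (induction l)
    case (Suc l)
    then have "e (Suc l) * (\<Sum>i<Suc l. d i) \<le> e l * (\<Sum>i<Suc l. d i)"
      using e(1)[of l "Suc l"] d[of "Suc l"] by (intro mult_right_mono) auto
    also have "\<dots> \<le> (\<Sum>i<Suc l. e i * d i)" using Suc by simp
    finally show ?case by (simp add: distrib_left)
  qed simp
  have "0 \<le> (\<Sum>i<m. e i * d i)"
  proof (cases m)
    case (Suc l)
    have "0 \<le> e l * (\<Sum>i<Suc l. d i)" using Suc e(2)[of l] d[of "Suc l"] by simp
    with Suc show ?thesis using *[of l] by simp
  qed simp
  then show ?thesis by (simp add: d_def right_diff_distrib sum_subtractf)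
qed

section \<open>Trace inequalities\<close>

lemma trace_diag_form:
  assumes "P \<in> carrier_mat n k" "R \<in> carrier_mat n k"
  shows "trace_mat (P\<^sup>\<dagger> * (mat_diag n d * R)) = (\<Sum>p<n. d p * (\<Sum>j<k. cnj (P $$ (p,j)) * R $$ (p,j)))"
proof -
  have "trace_mat (P\<^sup>\<dagger> * (mat_diag n d * R)) = (\<Sum>j<k. \<Sum>p<n. cnj (P $$ (p,j)) * (d p * R $$ (p,j)))"
    using assms by (simp add: trace_mult mat_diag_mult_left[OF assms(2)])
  also have "\<dots> = (\<Sum>p<n. d p * (\<Sum>j<k. cnj (P $$ (p,j)) * R $$ (p,j)))"
    by (subst sum.swap) (simp add: sum_distrib_left mult.left_commute)
  finally show ?thesis .
qed

lemma contraction_sum_le: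
  assumes "contraction P" "P \<in> carrier_mat n k"
  shows "(\<Sum>p<n. \<Sum>j<k. (cmod (P $$ (p,j)))\<^sup>2) \<le> real k"
proof -
  have "(\<Sum>p<n. \<Sum>j<k. (cmod (P $$ (p,j)))\<^sup>2) = (\<Sum>j<k. \<Sum>p<n. (cmod (P $$ (p,j)))\<^sup>2)" by (rule sum.swap)
  also have "\<dots> \<le> (\<Sum>j<k. 1)"
    using assms contraction_col_norm[OF assms(1)] by (intro sum_mono) auto
  finally show ?thesis by simp
qed

text \<open>In bases of singular vectors the trace is \<open>\<Sum>p. s\<^sub>p (\<Sum>j. cnj P\<^sub>p\<^sub>j R\<^sub>p\<^sub>j)\<close> with contractions \<open>P\<close>
  and \<open>R\<close>. By the inequality between geometric and arithmetic means, the inner sum is at most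
  the mean of the squared norms of two rows. These weights are at most 1, and summing over
  columns instead of rows shows that their total is at most \<open>k\<close>.\<close>

lemma Ky_Fan_trace_le:
  assumes C: "C \<in> carrier_mat n n" and "k \<le> n"
    and F: "F \<in> carrier_mat n k" "contraction F" and G: "G \<in> carrier_mat n k" "contraction G"
  shows "Re (trace_mat (F\<^sup>\<dagger> * (C * G))) \<le> (\<Sum>j<k. sing_vals C ! j)"
proof -
  let ?s = "\<lambda>i. sing_vals C ! i"
  have len: "length (sing_vals C) = n" and dn: "decr_nonneg (sing_vals C)"
    using C by (auto intro: length_sing_vals decr_nonneg_sing_vals)
  obtain S T where S: "unitary_mat n S" and T: "unitary_mat n T" and svd: "C * T = S * mat_diag n (\<lambda>i. complex_of_real (?s i))"
    using singular_value_decomposition[OF C] .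
  note s = unitary_matD[OF S] and t = unitary_matD[OF T]
  define P R where "P = S\<^sup>\<dagger> * F" and "R = T\<^sup>\<dagger> * G"
  have P: "P \<in> carrier_mat n k" "contraction P"
    using s F contraction_mult[OF contraction_adjoint[OF s(7)] F(2)] by (auto simp: P_def)
  have R: "R \<in> carrier_mat n k" "contraction R"
    using t G contraction_mult[OF contraction_adjoint[OF t(7)] G(2)] by (auto simp: R_def)
  have "C * G = (C * T) * R" using C t G T by (simp add: R_def mult_assoc_dim)
  then have "F\<^sup>\<dagger> * (C * G) = P\<^sup>\<dagger> * (mat_diag n (\<lambda>i. complex_of_real (?s i)) * R)"
    unfolding svd P_def using s F R by (simp add: adjoint_mult mult_assoc_dim)
  then have "Re (trace_mat (F\<^sup>\<dagger> * (C * G))) = (\<Sum>p<n. ?s p * (\<Sum>j<k. Re (cnj (P $$ (p,j)) * R $$ (p,j))))"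
    using P R by (simp add: trace_diag_form)
  also have "\<dots> \<le> (\<Sum>p<n. ?s p * (\<Sum>j<k. ((cmod (P $$ (p,j)))\<^sup>2 + (cmod (R $$ (p,j)))\<^sup>2) / 2))"
  proof (intro sum_mono mult_left_mono)
    fix p j
    have "Re (cnj (P $$ (p,j)) * R $$ (p,j)) \<le> cmod (P $$ (p,j)) * cmod (R $$ (p,j))"
      using complex_Re_le_cmod[of "cnj (P $$ (p,j)) * R $$ (p,j)"] by (simp add: norm_mult)
    also have "\<dots> \<le> ((cmod (P $$ (p,j)))\<^sup>2 + (cmod (R $$ (p,j)))\<^sup>2) / 2"
      using sum_squares_bound[of "cmod (P $$ (p,j))" "cmod (R $$ (p,j))"] by simp
    finally show "Re (cnj (P $$ (p,j)) * R $$ (p,j)) \<le> ((cmod (P $$ (p,j)))\<^sup>2 + (cmod (R $$ (p,j)))\<^sup>2) / 2" .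
  qed (use dn len in \<open>auto simp: decr_nonneg_def\<close>)
  also have "\<dots> = (\<Sum>p<n. (?s p - 0) * (\<Sum>j<k. ((cmod (P $$ (p,j)))\<^sup>2 + (cmod (R $$ (p,j)))\<^sup>2) / 2))"
    by simp
  also have "\<dots> \<le> (\<Sum>p<k. ?s p - 0)"
  proof (rule weighted_sum_le_top[OF _ \<open>k \<le> n\<close>])
    show "(\<Sum>j<k. ((cmod (P $$ (p,j)))\<^sup>2 + (cmod (R $$ (p,j)))\<^sup>2) / 2) \<le> 1" if "p < n" for p
      using contraction_row_norm[OF P(2), of p] contraction_row_norm[OF R(2), of p] P(1) R(1) that
      by (simp add: sum.distrib add_divide_distrib flip: sum_divide_distrib)
    show "(\<Sum>p<n. \<Sum>j<k. ((cmod (P $$ (p,j)))\<^sup>2 + (cmod (R $$ (p,j)))\<^sup>2) / 2) \<le> real k"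
      using contraction_sum_le[OF P(2,1)] contraction_sum_le[OF R(2,1)]
      by (simp add: sum.distrib add_divide_distrib flip: sum_divide_distrib)
  qed (use dn len \<open>k \<le> n\<close> in \<open>auto simp: decr_nonneg_def intro: sum_nonneg\<close>)
  finally show ?thesis by simp
qed

text \<open>The leading \<open>k\<close> left and right singular vectors turn the Ky Fan inequality into an
  equality.\<close>

lemma Ky_Fan_trace_attained:
  assumes C: "C \<in> carrier_mat n n" and "k \<le> n"
  obtains F G where "F \<in> carrier_mat n k" "contraction F" "G \<in> carrier_mat n k" "contraction G"
    "Re (trace_mat (F\<^sup>\<dagger> * (C * G))) = (\<Sum>j<k. sing_vals C ! j)"
proof -
  let ?s = "\<lambda>i. sing_vals C ! i"
  obtain S T where S: "unitary_mat n S" and T: "unitary_mat n T" and svd: "C * T = S * mat_diag n (\<lambda>i. complex_of_real (?s i))"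
    using singular_value_decomposition[OF C] .
  note s = unitary_matD[OF S] and t = unitary_matD[OF T]
  have "C * take_cols k T = take_cols k S * mat_diag k (\<lambda>i. complex_of_real (?s i))"
    using C t \<open>k \<le> n\<close> s(3) by (simp add: mult_take_cols svd take_cols_diag)
  moreover have iso: "(take_cols k S)\<^sup>\<dagger> * take_cols k S = 1\<^sub>m k" "(take_cols k T)\<^sup>\<dagger> * take_cols k T = 1\<^sub>m k"
    using take_cols_isometry s(4) t(4) \<open>k \<le> n\<close> by auto
  ultimately have "(take_cols k S)\<^sup>\<dagger> * (C * take_cols k T) = mat_diag k (\<lambda>i. complex_of_real (?s i))"
    by (simp flip: mult_assoc_dim)
  then have "Re (trace_mat ((take_cols k S)\<^sup>\<dagger> * (C * take_cols k T))) = (\<Sum>j<k. ?s j)"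
    by (simp add: trace_mat_def mat_diag_def)
  then show thesis
    using that[of "take_cols k S" "take_cols k T"] iso[THEN contraction_isometry] s(2) t(2)
    by (metis carrier_matI dim_take_cols)
qed

text \<open>In an eigenbasis of \<open>A\<close>, the trace of \<open>Y\<^sup>* A Y\<close> is a sum of the eigenvalues, weighted with
  the squared norms of the rows of a contraction.\<close>

lemma spread_trace_bound:
  assumes A: "hermitian_mat N A" and k: "k \<le> N div 2"
    and Y: "Y \<in> carrier_mat N k" "contraction Y" and Z: "Z \<in> carrier_mat N k" "contraction Z"
    and tr: "trace_mat (Y\<^sup>\<dagger> * Y) = trace_mat (Z\<^sup>\<dagger> * Z)"
  shows "Re (trace_mat (Y\<^sup>\<dagger> * (A * Y))) - Re (trace_mat (Z\<^sup>\<dagger> * (A * Z))) \<le> (\<Sum>j<k. spr_plus A ! j)"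
proof -
  obtain Q where Q: "unitary_mat N Q" "A = diag_conj N Q (\<lambda>i. complex_of_real (eigvals A ! i))"
    using spectral_theorem[OF A] .
  note u = unitary_matD[OF Q(1)]
  define m where "m W p = (\<Sum>j<k. (cmod ((Q\<^sup>\<dagger> * W) $$ (p,j)))\<^sup>2)" for W p
  have form: "Re (trace_mat (W\<^sup>\<dagger> * (A * W))) = (\<Sum>p<N. eigvals A ! p * m W p)"
    and sum: "trace_mat (W\<^sup>\<dagger> * W) = complex_of_real (\<Sum>p<N. m W p)"
    and m: "p < N \<Longrightarrow> 0 \<le> m W p" "p < N \<Longrightarrow> m W p \<le> 1" "(\<Sum>p<N. m W p) \<le> real k"
    if W: "W \<in> carrier_mat N k" "contraction W" for W p
  proof -
    let ?P = "Q\<^sup>\<dagger> * W"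
    have P: "?P \<in> carrier_mat N k" "contraction ?P"
      using u W contraction_mult[OF contraction_adjoint[OF u(7)] W(2)] by auto
    have m_alt: "(\<Sum>j<k. cnj (?P $$ (p,j)) * ?P $$ (p,j)) = complex_of_real (m W p)" for p
      unfolding m_def of_real_sum by (intro sum.cong) (simp_all only: complex_norm_square mult.commute)
    have "W\<^sup>\<dagger> * (A * W) = ?P\<^sup>\<dagger> * (mat_diag N (\<lambda>i. complex_of_real (eigvals A ! i)) * ?P)"
      using u W by (subst Q(2)) (simp add: diag_conj_def adjoint_mult mult_assoc_dim)
    then show "Re (trace_mat (W\<^sup>\<dagger> * (A * W))) = (\<Sum>p<N. eigvals A ! p * m W p)"
      by (simp add: trace_diag_form[OF P(1) P(1)] m_alt flip: of_real_mult of_real_sum)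
    have "W\<^sup>\<dagger> * W = ?P\<^sup>\<dagger> * ?P" using u W Q(1) by (simp add: adjoint_mult mult_assoc_dim)
    then show "trace_mat (W\<^sup>\<dagger> * W) = complex_of_real (\<Sum>p<N. m W p)"
      using u(2,3) W(1) by (simp add: trace_square m_def del: index_mult_mat(1))
    show "p < N \<Longrightarrow> 0 \<le> m W p" by (simp add: m_def sum_nonneg)
    show "p < N \<Longrightarrow> m W p \<le> 1" using contraction_row_norm[OF P(2), of p] u(2,3) W(1)
      by (simp add: m_def del: index_mult_mat(1))
    show "(\<Sum>p<N. m W p) \<le> real k" using contraction_sum_le[OF P(2,1)] by (simp add: m_def)
  qed
  have "(\<Sum>p<N. m Z p) = (\<Sum>p<N. m Y p)"
    using tr unfolding sum[OF Y] sum[OF Z] using of_real_eq_iff by metis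
  then have "(\<Sum>p<N. eigvals A ! p * m Y p) - (\<Sum>p<N. eigvals A ! p * m Z p)
      \<le> (\<Sum>i<k. eigvals A ! i - eigvals A ! (N - 1 - i))"
    using m[OF Y] m[OF Z] eigvals_decreasing[OF A] k by (intro weighted_sum_le_spread) auto
  also have "\<dots> = (\<Sum>j<k. spr_plus A ! j)"
    using k by (intro sum.cong) (auto simp: nth_spr_plus[OF A])
  finally show ?thesis unfolding form[OF Y] form[OF Z] .
qed

lemma add_mult_vec_dim:
  "dim_row A = dim_row B \<Longrightarrow> dim_col A = dim_col B \<Longrightarrow> dim_vec v = dim_col A \<Longrightarrow>
    (A + B) *\<^sub>v v = A *\<^sub>v v + B *\<^sub>v (v :: complex vec)"
  by (rule add_mult_distrib_mat_vec[of _ "dim_row A" "dim_col A"]) (auto intro: carrier_vecI)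

text \<open>\<open>F c\<close> and \<open>G c\<close> are orthogonal, so that Pythagoras applies.\<close>

lemma contraction_orthogonal_sum:
  assumes F: "F \<in> carrier_mat N k" "contraction F" and G: "G \<in> carrier_mat N k" "contraction G"
    and orth: "F\<^sup>\<dagger> * G = 0\<^sub>m k k"
  shows "contraction (complex_of_real (1 / sqrt 2) \<cdot>\<^sub>m (F + G))"
  unfolding contraction_def
proof
  let ?r = "complex_of_real (1 / sqrt 2)"
  fix c :: "complex vec" assume "c \<in> carrier_vec (dim_col (?r \<cdot>\<^sub>m (F + G)))"
  then have c: "c \<in> carrier_vec k" using G by simp
  have "(F *\<^sub>v c) \<bullet>c (G *\<^sub>v c) = c \<bullet>c ((F\<^sup>\<dagger> * G) *\<^sub>v c)"
    using F G c by (simp add: cscalar_adjoint mult_vec_assoc_dim)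
  also have "\<dots> = 0" unfolding orth using c by (simp add: scalar_prod_def)
  finally have "sqnorm ((F + G) *\<^sub>v c) = sqnorm (F *\<^sub>v c) + sqnorm (G *\<^sub>v c)"
    using F G c by (simp add: add_mult_vec_dim sqnorm_add)
  also have "\<dots> \<le> 2 * sqnorm c"
    using contractionD[OF F(2), of c] contractionD[OF G(2), of c] F G c by simp
  finally have "sqnorm (?r \<cdot>\<^sub>v ((F + G) *\<^sub>v c)) \<le> sqnorm c"
    unfolding sqnorm_smult norm_of_real power2_abs by (simp add: power_divide)
  moreover have "(?r \<cdot>\<^sub>m (F + G)) *\<^sub>v c = ?r \<cdot>\<^sub>v ((F + G) *\<^sub>v c)"
    using F G c by (intro eq_vecI) (auto simp: index_mult_vec_sum sum_distrib_left mult.assoc simp del: index_mult_mat_vec)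
  ultimately show "sqnorm ((?r \<cdot>\<^sub>m (F + G)) *\<^sub>v c) \<le> sqnorm c" by simp
qed

lemma contraction_uminus: "contraction G \<Longrightarrow> contraction (- G)"
  unfolding contraction_def
proof
  fix c :: "complex vec" assume G: "\<forall>c\<in>carrier_vec (dim_col G). sqnorm (G *\<^sub>v c) \<le> sqnorm c"
    and c: "c \<in> carrier_vec (dim_col (- G))"
  have "sqnorm (- G *\<^sub>v c) = sqnorm (G *\<^sub>v c)"
    unfolding sqnorm_def using c by (auto simp: index_mult_vec_sum sum_negf simp del: index_mult_mat_vec intro!: sum.cong)
  then show "sqnorm (- G *\<^sub>v c) \<le> sqnorm c" using G c by simp
qed

text \<open>The inequality behind all five assertions. For \<open>Y\<close> and \<open>Z\<close> the normalized sum and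
  difference of \<open>F\<close> and \<open>G\<close>, the difference of \<open>tr (Y\<^sup>* M Y)\<close> and \<open>tr (Z\<^sup>* M Z)\<close> consists of the mixed
  terms only. For \<open>M = 1\<close> these vanish, which gives \<open>Y\<close> and \<open>Z\<close> the same total weight; for \<open>M = A\<close>
  they are the left-hand side.\<close>

lemma off_diagonal_trace_bound:
  assumes A: "hermitian_mat N A" and k: "k \<le> N div 2"
    and F: "F \<in> carrier_mat N k" "contraction F" and G: "G \<in> carrier_mat N k" "contraction G"
    and orth: "F\<^sup>\<dagger> * G = 0\<^sub>m k k"
  shows "2 * Re (trace_mat (F\<^sup>\<dagger> * (A * G))) \<le> (\<Sum>j<k. spr_plus A ! j)"
proof -
  let ?r = "complex_of_real (1 / sqrt 2)"
  have Ac: "A \<in> carrier_mat N N" "A\<^sup>\<dagger> = A" using A by (auto simp: hermitian_mat_def)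
  define Y Z where "Y = ?r \<cdot>\<^sub>m (F + G)" and "Z = ?r \<cdot>\<^sub>m (F + - G)"
  have Y: "Y \<in> carrier_mat N k" and Z: "Z \<in> carrier_mat N k" using F G by (auto simp: Y_def Z_def)
  have cY: "contraction Y" unfolding Y_def by (rule contraction_orthogonal_sum) fact+
  have F_minus: "F\<^sup>\<dagger> * (- G) = 0\<^sub>m k k"
    using F G orth uminus_mult_right_mat[of "F\<^sup>\<dagger>" G] by auto
  have cZ: "contraction Z"
    unfolding Z_def using F G F_minus
    by (intro contraction_orthogonal_sum[of F N k "- G"] contraction_uminus) auto
  have rr: "cnj ?r * ?r = 1 / 2" by (simp flip: of_real_mult)
  have Zm: "Z = ?r \<cdot>\<^sub>m (F - G)"
    using F G by (simp add: Z_def minus_add_uminus_mat[of F N k G])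
  have GF: "G\<^sup>\<dagger> * F = 0\<^sub>m k k" using arg_cong[OF orth, of mat_adjoint] F G by (simp add: adjoint_mult)
  have expand: "trace_mat (Y\<^sup>\<dagger> * (M * Y)) - trace_mat (Z\<^sup>\<dagger> * (M * Z))
      = trace_mat (F\<^sup>\<dagger> * (M * G)) + trace_mat (G\<^sup>\<dagger> * (M * F))" if M: "M \<in> carrier_mat N N" for M
  proof -
    have y: "trace_mat (Y\<^sup>\<dagger> * (M * Y)) = 1/2 * (trace_mat (F\<^sup>\<dagger> * (M * F)) + trace_mat (F\<^sup>\<dagger> * (M * G))
       + (trace_mat (G\<^sup>\<dagger> * (M * F)) + trace_mat (G\<^sup>\<dagger> * (M * G))))"
      unfolding Y_def rr[symmetric] using F G M by (simp add: mat_dist trace_add trace_smult) (simp add: add_divide_distrib)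
    have z: "trace_mat (Z\<^sup>\<dagger> * (M * Z)) = 1/2 * (trace_mat (F\<^sup>\<dagger> * (M * F)) - trace_mat (F\<^sup>\<dagger> * (M * G))
       - (trace_mat (G\<^sup>\<dagger> * (M * F)) - trace_mat (G\<^sup>\<dagger> * (M * G))))"
      unfolding Zm rr[symmetric] using F G M by (simp add: mat_dist trace_minus trace_smult) (simp add: diff_divide_distrib)
    show ?thesis unfolding y z by (simp add: algebra_simps)
  qed
  have "trace_mat (Y\<^sup>\<dagger> * Y) = trace_mat (Z\<^sup>\<dagger> * Z)"
    using expand[of "1\<^sub>m N"] F G Y Z by (simp add: orth GF)
  from spread_trace_bound[OF A k Y cY Z cZ this]
  have "Re (trace_mat (Y\<^sup>\<dagger> * (A * Y)) - trace_mat (Z\<^sup>\<dagger> * (A * Z))) \<le> (\<Sum>j<k. spr_plus A ! j)" by simp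
  also have "trace_mat (G\<^sup>\<dagger> * (A * F)) = cnj (trace_mat (F\<^sup>\<dagger> * (A * G)))"
    using F G Ac by (subst trace_adjoint[symmetric]) (auto simp: adjoint_mult mult_assoc_dim)
  then have "Re (trace_mat (Y\<^sup>\<dagger> * (A * Y)) - trace_mat (Z\<^sup>\<dagger> * (A * Z))) = 2 * Re (trace_mat (F\<^sup>\<dagger> * (A * G)))"
    unfolding expand[OF Ac(1)] by simp
  finally show ?thesis .
qed

section \<open>The off-diagonal assertion\<close>

definition stack :: "complex mat \<Rightarrow> complex mat \<Rightarrow> complex mat" where
  "stack F H = mat (dim_row F + dim_row H) (dim_col F)
     (\<lambda>(i,j). if i < dim_row F then F $$ (i,j) else H $$ (i - dim_row F, j))"

lemma dim_stack [simp]: "dim_row (stack F H) = dim_row F + dim_row H" "dim_col (stack F H) = dim_col F"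
  by (auto simp: stack_def)

lemma sum_lessThan_add: "(\<Sum>i<m + n. f i) = (\<Sum>i<m. f i) + (\<Sum>i<n. f (m + i))" for f :: "nat \<Rightarrow> 'a::comm_monoid_add"
  by (induction n) (auto simp: add.assoc)

lemma stack_adjoint_mult:
  assumes "dim_row F = dim_row F'" "dim_row H = dim_row H'" "dim_col F = dim_col H" "dim_col F' = dim_col H'"
  shows "(stack F H)\<^sup>\<dagger> * stack F' H' = F\<^sup>\<dagger> * F' + H\<^sup>\<dagger> * H'"
  using assms
  by (intro eq_matI) (auto simp: index_mult_sum sum_lessThan_add stack_def simp del: index_mult_mat(1))

lemma four_block_mult_stack:
  assumes "A \<in> carrier_mat m m" "B \<in> carrier_mat m n" "C \<in> carrier_mat n m" "D \<in> carrier_mat n n"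
    "F \<in> carrier_mat m k" "H \<in> carrier_mat n k"
  shows "four_block_mat A B C D * stack F H = stack (A * F + B * H) (C * F + D * H)"
  using assms
  by (intro eq_matI) (auto simp: index_mult_sum sum_lessThan_add stack_def simp del: index_mult_mat(1))

lemma sqnorm_stack:
  assumes "dim_vec c = dim_col F" "dim_col H = dim_col F"
  shows "sqnorm (stack F H *\<^sub>v c) = sqnorm (F *\<^sub>v c) + sqnorm (H *\<^sub>v c)"
  using assms
  by (auto simp: sqnorm_def sum_lessThan_add index_mult_vec_sum stack_def simp del: index_mult_mat_vec)

lemma contraction_smult_stack:
  assumes F: "contraction F" and H: "contraction H" and "dim_col F = dim_col H"
  shows "contraction (complex_of_real (1 / sqrt 2) \<cdot>\<^sub>m stack F H)"
  unfolding contraction_def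
proof
  let ?r = "complex_of_real (1 / sqrt 2)"
  fix c :: "complex vec" assume "c \<in> carrier_vec (dim_col (?r \<cdot>\<^sub>m stack F H))"
  then have c: "dim_vec c = dim_col F" by auto
  have "sqnorm (stack F H *\<^sub>v c) = sqnorm (F *\<^sub>v c) + sqnorm (H *\<^sub>v c)"
    using c assms(3) by (simp add: sqnorm_stack)
  also have "\<dots> \<le> 2 * sqnorm c"
    using contractionD[OF F c] contractionD[OF H, of c] c assms(3) by simp
  finally have "sqnorm (?r \<cdot>\<^sub>v (stack F H *\<^sub>v c)) \<le> sqnorm c"
    unfolding sqnorm_smult norm_of_real power2_abs by (simp add: power_divide)
  moreover have "(?r \<cdot>\<^sub>m stack F H) *\<^sub>v c = ?r \<cdot>\<^sub>v (stack F H *\<^sub>v c)"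
    using c by (intro eq_vecI) (auto simp: index_mult_vec_sum sum_distrib_left mult.assoc simp del: index_mult_mat_vec)
  ultimately show "sqnorm ((?r \<cdot>\<^sub>m stack F H) *\<^sub>v c) \<le> sqnorm c" by simp
qed

lemma contraction_stack_zero:
  assumes F: "contraction F"
  shows "contraction (stack F (0\<^sub>m n (dim_col F)))" "contraction (stack (0\<^sub>m n (dim_col F)) F)"
proof -
  have zero: "sqnorm (0\<^sub>m n m *\<^sub>v c) = 0" if "dim_vec c = m" for m and c :: "complex vec"
    using that by (simp add: sqnorm_def index_mult_vec_sum del: index_mult_mat_vec)
  show "contraction (stack F (0\<^sub>m n (dim_col F)))" "contraction (stack (0\<^sub>m n (dim_col F)) F)"
    unfolding contraction_def
    by (auto simp: sqnorm_stack zero carrier_vecD intro!: contractionD[OF F])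
qed

text \<open>The block columns \<open>(F; 0)\<close> and \<open>(0; G)\<close> are orthogonal, and \<open>A\<close> pairs them to \<open>F\<^sup>* B G\<close>.\<close>

lemma off_diagonal_assertion_holds: "off_diagonal_assertion"
  unfolding off_diagonal_assertion_def
proof (intro allI impI)
  fix n :: nat and A A\<^sub>1 A\<^sub>2 B
  assume A1: "A\<^sub>1 \<in> carrier_mat n n" and A2: "A\<^sub>2 \<in> carrier_mat n n" and B: "B \<in> carrier_mat n n"
    and A: "A = four_block_mat A\<^sub>1 B (B\<^sup>\<dagger>) A\<^sub>2" and herm: "hermitian_mat (2 * n) A"
  have len: "length (sing_vals B) = n" "decr_nonneg (sing_vals B)"
    using B by (auto intro: length_sing_vals decr_nonneg_sing_vals)
  have "2 * (\<Sum>i<k. sing_vals B ! i) \<le> (\<Sum>i<k. spr_plus A ! i)" if k: "k \<le> n" for k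
  proof -
    obtain F G where FG: "F \<in> carrier_mat n k" "contraction F" "G \<in> carrier_mat n k" "contraction G"
      "Re (trace_mat (F\<^sup>\<dagger> * (B * G))) = (\<Sum>j<k. sing_vals B ! j)"
      using Ky_Fan_trace_attained[OF B k] .
    let ?F = "stack F (0\<^sub>m n k)" and ?G = "stack (0\<^sub>m n k) G"
    have "?F\<^sup>\<dagger> * (A * ?G) = F\<^sup>\<dagger> * (B * G)"
      using FG A1 A2 B unfolding A by (subst four_block_mult_stack) (auto simp: stack_adjoint_mult)
    moreover have "2 * Re (trace_mat (?F\<^sup>\<dagger> * (A * ?G))) \<le> (\<Sum>j<k. spr_plus A ! j)"
      using FG k contraction_stack_zero[OF FG(2), of n] contraction_stack_zero[OF FG(4), of n]
      by (intro off_diagonal_trace_bound[OF herm]) (auto simp: stack_adjoint_mult mult_2)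
    ultimately show ?thesis using FG(5) by simp
  qed
  then show "map ((*) 2) (sing_vals B) \<prec>\<^sub>w spr_plus A"
    using len by (intro submajorizedI decr_nonneg_spr_plus[OF herm])
      (auto simp: decr_nonneg_def length_spr_plus[OF herm] sum_distrib_left)
qed

section \<open>Differences and generalized commutators\<close>

lemma adjoint_direct_sum:
  "A \<in> carrier_mat n n \<Longrightarrow> B \<in> carrier_mat n n \<Longrightarrow> (direct_sum_mat A B)\<^sup>\<dagger> = direct_sum_mat (A\<^sup>\<dagger>) (B\<^sup>\<dagger>)"
  by (intro eq_matI) (auto simp: direct_sum_mat_def)

lemma hermitian_direct_sum:
  "hermitian_mat n A \<Longrightarrow> hermitian_mat n B \<Longrightarrow> hermitian_mat (2 * n) (direct_sum_mat A B)"
  by (auto simp: hermitian_mat_def adjoint_direct_sum mult_2) (simp add: direct_sum_mat_def)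

lemma uminus_eq_smult: "- A = (- 1 :: complex) \<cdot>\<^sub>m A"
  by (rule eq_matI) auto

text \<open>The block columns \<open>S = (F; V\<^sup>* F)\<close> and \<open>T = (V G; - G)\<close> are orthogonal, and \<open>A\<^sub>1 \<oplus> A\<^sub>2\<close> pairs
  them to the commutator term. Their norm is at most \<open>sqrt 2\<close>; scaling both to contractions
  contributes the factor \<open>1/2\<close> that cancels the factor 2 of the off-diagonal bound.\<close>

lemma commutator_trace_bound:
  assumes A1: "hermitian_mat n A\<^sub>1" and A2: "hermitian_mat n A\<^sub>2" and k: "k \<le> n"
    and F: "F \<in> carrier_mat n k" "contraction F" and G: "G \<in> carrier_mat n k" "contraction G"
    and V: "V \<in> carrier_mat n n" "contraction V"
  shows "Re (trace_mat (F\<^sup>\<dagger> * ((A\<^sub>1 * V - V * A\<^sub>2) * G))) \<le> (\<Sum>j<k. spr_plus (direct_sum_mat A\<^sub>1 A\<^sub>2) ! j)"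
proof -
  let ?r = "complex_of_real (1 / sqrt 2)"
  let ?A = "direct_sum_mat A\<^sub>1 A\<^sub>2"
  have c: "A\<^sub>1 \<in> carrier_mat n n" "A\<^sub>2 \<in> carrier_mat n n" using A1 A2 by (auto simp: hermitian_mat_def)
  define S T where "S = stack F (V\<^sup>\<dagger> * F)" and "T = stack (V * G) ((- 1) \<cdot>\<^sub>m G)"
  have dims: "dim_row S = 2 * n" "dim_col S = k" "dim_row T = 2 * n" "dim_col T = k"
    using F G V by (auto simp: S_def T_def)
  have rr: "cnj ?r * ?r = 1 / 2" by (simp flip: of_real_mult)
  have "S\<^sup>\<dagger> * T = 0\<^sub>m k k"
    using F G V unfolding S_def T_def by (simp add: stack_adjoint_mult mat_dist) (intro eq_matI, auto)
  then have orth: "(?r \<cdot>\<^sub>m S)\<^sup>\<dagger> * (?r \<cdot>\<^sub>m T) = 0\<^sub>m k k"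
    using dims by (simp add: mat_dist)
  have AT: "?A * T = stack (A\<^sub>1 * (V * G)) ((- 1) \<cdot>\<^sub>m (A\<^sub>2 * G))"
    using F G V c unfolding T_def direct_sum_mat_def
    by (subst four_block_mult_stack[of _ n _ n _ _ _ k]) (auto simp: mat_dist)
  have "(?r \<cdot>\<^sub>m S)\<^sup>\<dagger> * (?A * (?r \<cdot>\<^sub>m T)) = (1/2) \<cdot>\<^sub>m (S\<^sup>\<dagger> * (?A * T))"
    unfolding rr[symmetric] using dims c by (intro eq_matI) (auto simp: mat_dist direct_sum_mat_def)
  also have "S\<^sup>\<dagger> * (?A * T) = F\<^sup>\<dagger> * ((A\<^sub>1 * V - V * A\<^sub>2) * G)"
    unfolding AT S_def using F G V c by (simp add: stack_adjoint_mult mat_dist) (intro eq_matI, auto)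
  finally have eq: "(?r \<cdot>\<^sub>m S)\<^sup>\<dagger> * (?A * (?r \<cdot>\<^sub>m T)) = (1/2) \<cdot>\<^sub>m (F\<^sup>\<dagger> * ((A\<^sub>1 * V - V * A\<^sub>2) * G))" .
  have cS: "contraction (?r \<cdot>\<^sub>m S)" unfolding S_def
    using F V contraction_mult[OF contraction_adjoint[OF V(2)] F(2)] by (intro contraction_smult_stack) auto
  have cT: "contraction (?r \<cdot>\<^sub>m T)" unfolding T_def
    using G V contraction_mult[OF V(2) G(2)] contraction_uminus[OF G(2)]
    by (intro contraction_smult_stack) (auto simp: uminus_eq_smult)
  have "2 * Re (trace_mat ((?r \<cdot>\<^sub>m S)\<^sup>\<dagger> * (?A * (?r \<cdot>\<^sub>m T)))) \<le> (\<Sum>j<k. spr_plus ?A ! j)"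
    using dims k by (intro off_diagonal_trace_bound[OF hermitian_direct_sum[OF A1 A2] _ _ cS _ cT orth]) auto
  then show ?thesis unfolding eq using F G by (simp add: trace_smult)
qed

text \<open>The difference is the commutator term for \<open>V = 1\<close>.\<close>

lemma difference_assertion_holds: "difference_assertion"
  unfolding difference_assertion_def
proof (intro allI impI)
  fix n :: nat and A\<^sub>1 A\<^sub>2
  assume A1: "hermitian_mat n A\<^sub>1" and A2: "hermitian_mat n A\<^sub>2"
  let ?C = "A\<^sub>1 - A\<^sub>2" and ?A = "direct_sum_mat A\<^sub>1 A\<^sub>2"
  have c: "A\<^sub>1 \<in> carrier_mat n n" "A\<^sub>2 \<in> carrier_mat n n" using A1 A2 by (auto simp: hermitian_mat_def)
  then have C: "?C \<in> carrier_mat n n" by auto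
  have len: "length (sing_vals ?C) = n" "decr_nonneg (sing_vals ?C)"
    using C by (auto intro: length_sing_vals decr_nonneg_sing_vals)
  note herm = hermitian_direct_sum[OF A1 A2]
  have "(\<Sum>i<k. sing_vals ?C ! i) \<le> (\<Sum>i<k. spr_plus ?A ! i)" if k: "k \<le> n" for k
  proof -
    obtain F G where FG: "F \<in> carrier_mat n k" "contraction F" "G \<in> carrier_mat n k" "contraction G"
      "Re (trace_mat (F\<^sup>\<dagger> * (?C * G))) = (\<Sum>j<k. sing_vals ?C ! j)"
      using Ky_Fan_trace_attained[OF C k] .
    show ?thesis
      using commutator_trace_bound[OF A1 A2 k FG(1-4), of "1\<^sub>m n"] FG(5) c contraction_isometry[of "1\<^sub>m n" n]
      by simp
  qed
  then show "sing_vals ?C \<prec>\<^sub>w spr_plus ?A"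
    using len by (intro submajorizedI decr_nonneg_spr_plus[OF herm]) (auto simp: length_spr_plus[OF herm])
qed

lemma take_cols_compress_trace:
  assumes "H \<in> carrier_mat n n" "N \<in> carrier_mat n n" "E \<in> carrier_mat n n" "l \<le> n"
  shows "trace_mat ((take_cols l H)\<^sup>\<dagger> * (N * take_cols l E)) = (\<Sum>i<l. (H\<^sup>\<dagger> * (N * E)) $$ (i,i))"
  using assms by (auto simp: trace_mat_def take_cols_compress simp del: index_mult_mat(1))

text \<open>Let \<open>X = E D H\<^sup>*\<close> be a singular value decomposition and \<open>F, G\<close> frames that are optimal for
  the commutator. The sum on the left is \<open>\<Sum>i. s\<^sub>i b\<^sub>i\<close>, where \<open>b\<^sub>i\<close> is the real part of the trace
  with \<open>X\<close> replaced by the product of the \<open>i\<close>-th singular vectors. By summation by parts it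
  suffices to bound the partial sums of \<open>b\<close> up to \<open>l\<close> by the spread up to \<open>min k l\<close>.\<close>

lemma commutator_Ky_Fan:
  assumes A1: "hermitian_mat n A\<^sub>1" and A2: "hermitian_mat n A\<^sub>2" and X: "X \<in> carrier_mat n n" and k: "k \<le> n"
  shows "(\<Sum>i<k. sing_vals (A\<^sub>1 * X - X * A\<^sub>2) ! i)
    \<le> (\<Sum>i<k. sing_vals X ! i * spr_plus (direct_sum_mat A\<^sub>1 A\<^sub>2) ! i)"
proof -
  let ?C = "A\<^sub>1 * X - X * A\<^sub>2" and ?A = "direct_sum_mat A\<^sub>1 A\<^sub>2"
  let ?s = "\<lambda>i. sing_vals X ! i"
  have c: "A\<^sub>1 \<in> carrier_mat n n" "A\<^sub>2 \<in> carrier_mat n n" "A\<^sub>1\<^sup>\<dagger> = A\<^sub>1" "A\<^sub>2\<^sup>\<dagger> = A\<^sub>2"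
    using A1 A2 by (auto simp: hermitian_mat_def)
  then have C: "?C \<in> carrier_mat n n" using X by auto
  have len: "length (sing_vals X) = n" "decr_nonneg (sing_vals X)"
    using X by (auto intro: length_sing_vals decr_nonneg_sing_vals)
  obtain F G where F: "F \<in> carrier_mat n k" "contraction F" and G: "G \<in> carrier_mat n k" "contraction G"
    and FG: "Re (trace_mat (F\<^sup>\<dagger> * (?C * G))) = (\<Sum>j<k. sing_vals ?C ! j)"
    using Ky_Fan_trace_attained[OF C k] .
  obtain E H where E: "unitary_mat n E" and H: "unitary_mat n H"
    and svd: "X * H = E * mat_diag n (\<lambda>i. complex_of_real (?s i))"
    using singular_value_decomposition[OF X] .
  note e = unitary_matD[OF E] and h = unitary_matD[OF H]
  let ?D = "mat_diag n (\<lambda>i. complex_of_real (?s i))"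
  define N where "N = G * (F\<^sup>\<dagger> * A\<^sub>1) - A\<^sub>2 * (G * F\<^sup>\<dagger>)"
  have N: "N \<in> carrier_mat n n" using F G c by (auto simp: N_def)
  define b where "b i = Re ((H\<^sup>\<dagger> * (N * E)) $$ (i,i))" for i
  have partial: "(\<Sum>i<l. b i) \<le> (\<Sum>i<l. if i < k then spr_plus ?A ! i else 0)" if l: "l \<le> n" for l
  proof -
    let ?H = "take_cols l H" and ?E = "take_cols l E"
    have HE: "?H \<in> carrier_mat n l" "contraction ?H" "?E \<in> carrier_mat n l" "contraction ?E"
      using e(2) h(2) take_cols_isometry[OF e(4) l] take_cols_isometry[OF h(4) l]
      by (auto intro: contraction_isometry carrier_matI)
    have b: "(\<Sum>i<l. b i) = Re (trace_mat (?H\<^sup>\<dagger> * (N * ?E)))"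
      using take_cols_compress_trace[OF h(1) N e(1) l] by (simp add: b_def)
    show ?thesis
    proof (cases "l \<le> k")
      case True
      \<comment> \<open>With at most \<open>k\<close> leading singular vectors, these are the frames and \<open>F G\<^sup>*\<close> is the contraction.\<close>
      let ?V = "F * G\<^sup>\<dagger>"
      have "contraction ?V" using F G by (intro contraction_mult contraction_adjoint) auto
      then have "Re (trace_mat (?E\<^sup>\<dagger> * ((A\<^sub>1 * ?V - ?V * A\<^sub>2) * ?H))) \<le> (\<Sum>j<l. spr_plus ?A ! j)"
        using HE F G l by (intro commutator_trace_bound[OF A1 A2]) auto
      moreover have "(?E\<^sup>\<dagger> * ((A\<^sub>1 * ?V - ?V * A\<^sub>2) * ?H))\<^sup>\<dagger> = ?H\<^sup>\<dagger> * (N * ?E)"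
        using HE F G c e(2,3) h(2,3) by (simp add: mat_dist N_def)
      then have "Re (trace_mat (?H\<^sup>\<dagger> * (N * ?E))) = Re (trace_mat (?E\<^sup>\<dagger> * ((A\<^sub>1 * ?V - ?V * A\<^sub>2) * ?H)))"
        using HE e(2,3) h(2,3) trace_adjoint[of "?E\<^sup>\<dagger> * ((A\<^sub>1 * ?V - ?V * A\<^sub>2) * ?H)"] by simp
      ultimately show ?thesis unfolding b using True by simp
    next
      case False
      \<comment> \<open>Otherwise \<open>F\<close> and \<open>G\<close> are the frames, and the leading singular vectors form the contraction.\<close>
      let ?V = "?E * ?H\<^sup>\<dagger>"
      have V: "contraction ?V" "?V \<in> carrier_mat n n" using HE by (auto intro: contraction_mult contraction_adjoint)
      have "trace_mat (?H\<^sup>\<dagger> * (N * ?E)) = trace_mat (?H\<^sup>\<dagger> * (G * (F\<^sup>\<dagger> * (A\<^sub>1 * ?E)))) - trace_mat (?H\<^sup>\<dagger> * (A\<^sub>2 * (G * (F\<^sup>\<dagger> * ?E))))"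
        using HE F G c e(2,3) h(2,3) by (simp add: N_def mat_dist trace_minus)
      also have "trace_mat (?H\<^sup>\<dagger> * (G * (F\<^sup>\<dagger> * (A\<^sub>1 * ?E)))) = trace_mat (F\<^sup>\<dagger> * (A\<^sub>1 * ?V * G))"
        using HE F G c e(2,3) h(2,3) trace_comm[of "?H\<^sup>\<dagger> * G" "F\<^sup>\<dagger> * (A\<^sub>1 * ?E)"] by (simp add: mult_assoc_dim)
      also have "trace_mat (?H\<^sup>\<dagger> * (A\<^sub>2 * (G * (F\<^sup>\<dagger> * ?E)))) = trace_mat (F\<^sup>\<dagger> * (?V * A\<^sub>2 * G))"
        using HE F G c e(2,3) h(2,3) trace_comm[of "?H\<^sup>\<dagger> * (A\<^sub>2 * G)" "F\<^sup>\<dagger> * ?E"] by (simp add: mult_assoc_dim)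
      also have "trace_mat (F\<^sup>\<dagger> * (A\<^sub>1 * ?V * G)) - trace_mat (F\<^sup>\<dagger> * (?V * A\<^sub>2 * G)) = trace_mat (F\<^sup>\<dagger> * ((A\<^sub>1 * ?V - ?V * A\<^sub>2) * G))"
        using HE F G c e(2,3) h(2,3) by (simp add: mat_dist trace_minus)
      finally have "Re (trace_mat (?H\<^sup>\<dagger> * (N * ?E))) \<le> (\<Sum>j<k. spr_plus ?A ! j)"
        using commutator_trace_bound[OF A1 A2 k F G V(2,1)] by simp
      also have "\<dots> = (\<Sum>i<l. if i < k then spr_plus ?A ! i else 0)"
        using False by (intro sum.mono_neutral_cong_left) auto
      finally show ?thesis unfolding b .
    qed
  qed
  have XM: "X * M = E * (?D * (H\<^sup>\<dagger> * M))" if "dim_row M = n" for M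
  proof -
    have "X * M = (X * H) * (H\<^sup>\<dagger> * M)" using X h(2,3) H that by (simp add: mult_assoc_dim)
    then show ?thesis unfolding svd using e(2,3) h(2,3) that by (simp add: mult_assoc_dim)
  qed
  have "trace_mat (F\<^sup>\<dagger> * (?C * G)) = trace_mat (F\<^sup>\<dagger> * (A\<^sub>1 * (E * (?D * (H\<^sup>\<dagger> * G))))) - trace_mat (F\<^sup>\<dagger> * (E * (?D * (H\<^sup>\<dagger> * (A\<^sub>2 * G)))))"
    using F G c X e(2,3) h(2,3) by (simp add: XM mat_dist trace_minus)
  also have "trace_mat (F\<^sup>\<dagger> * (A\<^sub>1 * (E * (?D * (H\<^sup>\<dagger> * G))))) = trace_mat (?D * (H\<^sup>\<dagger> * (G * (F\<^sup>\<dagger> * (A\<^sub>1 * E)))))"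
    using F G c e(2,3) h(2,3) trace_comm[of "F\<^sup>\<dagger> * (A\<^sub>1 * E)" "?D * (H\<^sup>\<dagger> * G)"] by (simp add: mult_assoc_dim)
  also have "trace_mat (F\<^sup>\<dagger> * (E * (?D * (H\<^sup>\<dagger> * (A\<^sub>2 * G))))) = trace_mat (?D * (H\<^sup>\<dagger> * (A\<^sub>2 * (G * (F\<^sup>\<dagger> * E)))))"
    using F G c e(2,3) h(2,3) trace_comm[of "F\<^sup>\<dagger> * E" "?D * (H\<^sup>\<dagger> * (A\<^sub>2 * G))"] by (simp add: mult_assoc_dim)
  also have "trace_mat (?D * (H\<^sup>\<dagger> * (G * (F\<^sup>\<dagger> * (A\<^sub>1 * E))))) - trace_mat (?D * (H\<^sup>\<dagger> * (A\<^sub>2 * (G * (F\<^sup>\<dagger> * E)))))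
      = trace_mat (?D * (H\<^sup>\<dagger> * (N * E)))"
    using F G c e(2,3) h(2,3) by (simp add: N_def mat_dist trace_minus)
  also have "\<dots> = (\<Sum>i<n. complex_of_real (?s i) * (H\<^sup>\<dagger> * (N * E)) $$ (i,i))"
  proof -
    have K: "H\<^sup>\<dagger> * (N * E) \<in> carrier_mat n n" using e(2,3) h(2,3) by auto
    show ?thesis unfolding mat_diag_mult_left[OF K] by (simp add: trace_mat_def del: index_mult_mat(1))
  qed
  finally have "(\<Sum>j<k. sing_vals ?C ! j) = (\<Sum>i<n. ?s i * b i)"
    using FG by (simp add: b_def del: index_mult_mat(1))
  also have "\<dots> \<le> (\<Sum>i<n. ?s i * (if i < k then spr_plus ?A ! i else 0))"
    using len partial by (intro Abel_sum_mono) (auto simp: decr_nonneg_def)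
  also have "\<dots> = (\<Sum>i<k. ?s i * spr_plus ?A ! i)"
    using k by (intro sum.mono_neutral_cong_right) auto
  finally show ?thesis .
qed

lemma decr_nonneg_map2_mult:
  assumes "decr_nonneg x" "decr_nonneg y"
  shows "decr_nonneg (map2 (*) x y)"
  using assms by (auto simp: decr_nonneg_def intro!: mult_mono)

lemma generalized_commutator_assertion_holds: "generalized_commutator_assertion"
  unfolding generalized_commutator_assertion_def
proof (intro allI impI)
  fix n :: nat and A\<^sub>1 A\<^sub>2 X :: "complex mat"
  assume A1: "hermitian_mat n A\<^sub>1" and A2: "hermitian_mat n A\<^sub>2" and X: "X \<in> carrier_mat n n"
  let ?C = "A\<^sub>1 * X - X * A\<^sub>2" and ?A = "direct_sum_mat A\<^sub>1 A\<^sub>2"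
  have "dim_col ?C = n" "dim_col X = n" using A1 A2 X by (auto simp: hermitian_mat_def)
  note len = this[THEN length_sing_vals] this[THEN decr_nonneg_sing_vals]
  note herm = hermitian_direct_sum[OF A1 A2]
  show "sing_vals ?C \<prec>\<^sub>w map2 (*) (sing_vals X) (spr_plus ?A)"
    using len commutator_Ky_Fan[OF A1 A2 X]
    by (intro submajorizedI decr_nonneg_map2_mult decr_nonneg_spr_plus[OF herm]) (auto simp: length_spr_plus[OF herm])
qed

section \<open>Unitary conjugation\<close>

lemma pow_diag_conj:
  assumes Q: "unitary_mat n Q"
  shows "diag_conj n Q z ^\<^sub>m k = diag_conj n Q (\<lambda>i. z i ^ k)"
proof (induction k)
  case 0
  then show ?case using unitary_matD[OF Q] by (simp add: diag_conj_one[OF Q])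
next
  case (Suc k)
  then show ?case by (simp add: diag_conj_mult[OF Q] mult.commute)
qed

lemma mat_exp_diag_conj:
  assumes Q: "unitary_mat n Q"
  shows "mat_exp (diag_conj n Q z) = diag_conj n Q (\<lambda>i. exp (z i))"
proof (rule eq_matI)
  note u = unitary_matD[OF Q]
  fix i j assume "i < dim_row (diag_conj n Q (\<lambda>i. exp (z i)))" "j < dim_col (diag_conj n Q (\<lambda>i. exp (z i)))"
  then have ij: "i < n" "j < n" using u by auto
  have "(\<lambda>k. z p ^ k / fact k) sums exp (z p)" for p
    using exp_converges[of "z p"] by (simp add: scaleR_conv_of_real divide_inverse mult.commute)
  then have "(\<lambda>k. \<Sum>p<n. Q $$ (i,p) * cnj (Q $$ (j,p)) * (z p ^ k / fact k)) sums
      (\<Sum>p<n. Q $$ (i,p) * cnj (Q $$ (j,p)) * exp (z p))"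
    by (intro sums_sum sums_mult)
  moreover have "(diag_conj n Q z ^\<^sub>m k) $$ (i,j) / fact k = (\<Sum>p<n. Q $$ (i,p) * cnj (Q $$ (j,p)) * (z p ^ k / fact k))" for k
    using ij u by (simp add: pow_diag_conj[OF Q] diag_conj_index sum_divide_distrib mult_ac)
  ultimately have "(\<Sum>k. (diag_conj n Q z ^\<^sub>m k) $$ (i,j) / fact k) = (\<Sum>p<n. Q $$ (i,p) * cnj (Q $$ (j,p)) * exp (z p))"
    by (simp add: sums_iff)
  then show "mat_exp (diag_conj n Q z) $$ (i,j) = diag_conj n Q (\<lambda>i. exp (z i)) $$ (i,j)"
    using ij u by (simp add: mat_exp_def diag_conj_index mult_ac)
qed (simp_all add: mat_exp_def)

lemma diag_conj_smult:
  "c \<cdot>\<^sub>m diag_conj n Q z = diag_conj n Q (\<lambda>i. c * z i)" if "dim_col Q = n"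
  using that by (intro eq_matI) (auto simp: diag_conj_index sum_distrib_left mult_ac)

lemma diag_conj_add:
  "diag_conj n Q z + diag_conj n Q w = diag_conj n Q (\<lambda>i. z i + w i)" if "dim_col Q = n"
  using that by (intro eq_matI) (auto simp: diag_conj_index sum.distrib algebra_simps)

lemma diag_conj_minus:
  "diag_conj n Q z - diag_conj n Q w = diag_conj n Q (\<lambda>i. z i - w i)" if "dim_col Q = n"
  using that by (intro eq_matI) (auto simp: diag_conj_index sum_subtractf algebra_simps)

lemma contraction_diag_conj:
  assumes Q: "unitary_mat n Q" and z: "\<And>i. i < n \<Longrightarrow> cmod (z i) \<le> 1"
  shows "contraction (diag_conj n Q z)"
proof -
  note u = unitary_matD[OF Q]
  have "mat_diag n (\<lambda>i. cnj (z i)) * mat_diag n z = mat_diag n (\<lambda>i. complex_of_real ((cmod (z i))\<^sup>2))"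
    by (simp only: mat_diag_diag complex_norm_square mult.commute)
  then have "contraction (mat_diag n z)"
    using contraction_diag[of "mat_diag n z" n "\<lambda>i. (cmod (z i))\<^sup>2"] z
    by (simp add: power_le_one_iff abs_square_le_1)
  then show ?thesis
    unfolding diag_conj_def using u
    by (intro contraction_mult contraction_adjoint) auto
qed

lemma one_minus_cos_le: "1 - cos y \<le> y\<^sup>2 / 2" for y :: real
proof -
  have "1 - cos y = 2 * (sin (y / 2))\<^sup>2"
    using cos_double_sin[of "y / 2"] by simp
  also have "(sin (y / 2))\<^sup>2 \<le> (y / 2)\<^sup>2"
    using abs_sin_x_le_abs_x[of "y / 2"] by (simp only: abs_le_square_iff)
  finally show ?thesis by (simp add: power_divide)
qed

lemma cmod_exp_minus_one_le: "cmod (exp (\<i> * complex_of_real y) - 1) \<le> \<bar>y\<bar>"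
proof -
  have "(cmod (exp (\<i> * complex_of_real y) - 1))\<^sup>2 = (cos y - 1)\<^sup>2 + (sin y)\<^sup>2"
    by (simp add: cmod_power2 flip: cis_conv_exp)
  also have "\<dots> = 2 * (1 - cos y)"
    using sin_cos_squared_add[of y] by (simp add: power2_eq_square algebra_simps)
  also have "\<dots> \<le> \<bar>y\<bar>\<^sup>2" using one_minus_cos_le[of y] by simp
  finally show ?thesis by (rule power2_le_imp_le) simp
qed

lemma cmod_exp_second_order_le: "cmod (exp (\<i> * complex_of_real y) - 1 - \<i> * complex_of_real y) \<le> y\<^sup>2"
proof -
  have "\<bar>sin y - (\<Sum>m<2. sin_coeff m * y ^ m)\<bar> \<le> inverse (fact 2) * \<bar>y\<bar> ^ 2"
    by (rule Maclaurin_sin_bound)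
  then have "\<bar>sin y - y\<bar> \<le> y\<^sup>2 / 2" by (simp add: numeral_2_eq_2 sin_coeff_def)
  moreover have "\<bar>cos y - 1\<bar> \<le> y\<^sup>2 / 2" using one_minus_cos_le[of y] cos_le_one[of y] by linarith
  moreover have "cmod (exp (\<i> * complex_of_real y) - 1 - \<i> * complex_of_real y) \<le> \<bar>cos y - 1\<bar> + \<bar>sin y - y\<bar>"
    using cmod_le[of "exp (\<i> * complex_of_real y) - 1 - \<i> * complex_of_real y"]
    by (simp flip: cis_conv_exp)
  ultimately show ?thesis by linarith
qed

lemma hermitian_exp:
  assumes "hermitian_mat n X"
  obtains Q x where "unitary_mat n Q" "X = diag_conj n Q (\<lambda>p. complex_of_real (x p))"
    "mat_exp (\<i> \<cdot>\<^sub>m X) = diag_conj n Q (\<lambda>p. exp (\<i> * complex_of_real (x p)))"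
proof -
  obtain Q x where Q: "unitary_mat n Q" "X = diag_conj n Q (\<lambda>p. complex_of_real (x p))"
    using hermitian_diagonalizable[OF assms] .
  show thesis
    using that[OF Q] Q unitary_matD(3)[OF Q(1)] by (simp add: diag_conj_smult mat_exp_diag_conj)
qed

lemma unitary_diag_conj:
  assumes Q: "unitary_mat n Q" and "\<And>p. p < n \<Longrightarrow> cmod (z p) = 1"
  shows "unitary_mat n (diag_conj n Q z)"
proof -
  have "diag_conj n Q (\<lambda>p. cnj (z p) * z p) = diag_conj n Q (\<lambda>_. 1)"
    using assms(2) by (intro diag_conj_cong) (simp add: mult.commute complex_norm_square[symmetric])
  then show ?thesis
    unfolding isometry_mat_def diag_conj_adjoint[OF Q] diag_conj_mult[OF Q]
    by (simp add: diag_conj_one[OF Q] diag_conj_carrier[OF Q])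
qed

text \<open>In the Ky Fan principle, the left factor \<open>K\<close> can be moved to the left frame.\<close>

lemma sing_vals_contraction_mult:
  assumes K: "K \<in> carrier_mat n n" "contraction K" and X: "X \<in> carrier_mat n n" and k: "k \<le> n"
  shows "(\<Sum>i<k. sing_vals (K * X) ! i) \<le> (\<Sum>i<k. sing_vals X ! i)"
proof -
  have KX: "K * X \<in> carrier_mat n n" using K X by auto
  obtain F G where FG: "F \<in> carrier_mat n k" "contraction F" "G \<in> carrier_mat n k" "contraction G"
    "Re (trace_mat (F\<^sup>\<dagger> * (K * X * G))) = (\<Sum>j<k. sing_vals (K * X) ! j)"
    using Ky_Fan_trace_attained[OF KX k] .
  have "contraction (K\<^sup>\<dagger> * F)" using FG K by (intro contraction_mult contraction_adjoint) auto
  then have "Re (trace_mat ((K\<^sup>\<dagger> * F)\<^sup>\<dagger> * (X * G))) \<le> (\<Sum>j<k. sing_vals X ! j)"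
    using FG K X k by (intro Ky_Fan_trace_le) auto
  also have "(K\<^sup>\<dagger> * F)\<^sup>\<dagger> * (X * G) = F\<^sup>\<dagger> * (K * X * G)"
    using FG K X by (simp add: adjoint_mult mult_assoc_dim)
  finally show ?thesis using FG(5) by simp
qed

text \<open>Multiplication by \<open>- U\<close> turns \<open>A - U\<^sup>* A U\<close> into the commutator of \<open>A\<close> with \<open>W = U - 1\<close>,
  because the identity commutes with \<open>A\<close>. Moreover \<open>W = K X\<close>, where the eigenvalues
  \<open>(e\<^sup>i\<^sup>x - 1) / x\<close> of \<open>K\<close> have modulus at most 1. An eigenvalue \<open>x = 0\<close> causes no trouble: division
  by zero gives the value 0 to the quotient, and the corresponding eigenvalue of \<open>W\<close> vanishes
  as well.\<close>

lemma unitary_conjugation_assertion_holds: "unitary_conjugation_assertion"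
  unfolding unitary_conjugation_assertion_def
proof (intro allI impI)
  fix n :: nat and A X U
  assume A: "hermitian_mat n A" and X: "hermitian_mat n X" and U_def: "U = mat_exp (\<i> \<cdot>\<^sub>m X)"
  obtain Q x where Q: "unitary_mat n Q" and Xd: "X = diag_conj n Q (\<lambda>p. complex_of_real (x p))"
    and Ud: "U = diag_conj n Q (\<lambda>p. exp (\<i> * complex_of_real (x p)))"
    using hermitian_exp[OF X] unfolding U_def by metis
  note u = unitary_matD[OF Q]
  have U: "unitary_mat n U"
    unfolding Ud by (rule unitary_diag_conj[OF Q]) simp
  note uU = unitary_matD[OF U]
  have c: "A \<in> carrier_mat n n" "X \<in> carrier_mat n n" using A X by (auto simp: hermitian_mat_def)
  let ?A = "direct_sum_mat A A" and ?C = "A - U\<^sup>\<dagger> * A * U"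
  note herm = hermitian_direct_sum[OF A A]
  have colC: "dim_col ?C = n" "dim_col X = n" using c uU by auto
  note len = colC[THEN length_sing_vals] colC[THEN decr_nonneg_sing_vals]
  define W where "W = U - 1\<^sub>m n"
  have W: "W \<in> carrier_mat n n" using uU by (simp add: W_def minus_carrier_mat)
  define K where "K = diag_conj n Q (\<lambda>p. (exp (\<i> * complex_of_real (x p)) - 1) / complex_of_real (x p))"
  have K: "K \<in> carrier_mat n n" unfolding K_def by (rule diag_conj_carrier[OF Q])
  have cK: "contraction K" unfolding K_def
  proof (rule contraction_diag_conj[OF Q])
    show "cmod ((exp (\<i> * complex_of_real (x p)) - 1) / complex_of_real (x p)) \<le> 1" for p
      using cmod_exp_minus_one_le[of "x p"] by (cases "x p = 0") (simp_all add: norm_divide divide_le_eq_1)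
  qed
  have "W = K * X"
  proof -
    have "W = diag_conj n Q (\<lambda>p. exp (\<i> * complex_of_real (x p)) - 1)"
      unfolding W_def Ud diag_conj_one[OF Q, symmetric] using u by (simp add: diag_conj_minus)
    also have "\<dots> = K * X"
      unfolding K_def Xd diag_conj_mult[OF Q] by (rule diag_conj_cong) simp
    finally show ?thesis .
  qed
  have "- U * ?C = A * W - W * A"
    using c uU U unfolding W_def uminus_eq_smult by (simp add: mat_dist) (intro eq_matI, auto)
  moreover have "unitary_mat n (- U)"
    using uU unfolding isometry_mat_def uminus_eq_smult by (simp add: mat_dist) (intro eq_matI, auto)
  ultimately have sv: "sing_vals ?C = sing_vals (A * W - W * A)"
    using sing_vals_unitary_left[of ?C "- U"] c uU by simp
  have "(\<Sum>i<k. sing_vals ?C ! i) \<le> (\<Sum>i<k. sing_vals X ! i * spr_plus ?A ! i)" if k: "k \<le> n" for k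
  proof -
    have "(\<Sum>i<k. sing_vals ?C ! i) \<le> (\<Sum>i<k. sing_vals W ! i * spr_plus ?A ! i)"
      unfolding sv by (rule commutator_Ky_Fan[OF A A W k])
    also have "\<dots> = (\<Sum>i<k. spr_plus ?A ! i * sing_vals W ! i)" by (simp add: mult.commute)
    also have "\<dots> \<le> (\<Sum>i<k. spr_plus ?A ! i * sing_vals X ! i)"
      using decr_nonneg_spr_plus[OF herm] length_spr_plus[OF herm] k
        sing_vals_contraction_mult[OF K cK c(2)]
      unfolding \<open>W = K * X\<close> by (intro Abel_sum_mono) (auto simp: decr_nonneg_def)
    finally show ?thesis by (simp add: mult.commute)
  qed
  then show "sing_vals ?C \<prec>\<^sub>w map2 (*) (sing_vals X) (spr_plus ?A)"
    using len by (intro submajorizedI decr_nonneg_map2_mult decr_nonneg_spr_plus[OF herm]) (auto simp: length_spr_plus[OF herm])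
qed

section \<open>Growth of the angles along a one-parameter group\<close>

lemma sing_vals_contraction_le_one:
  assumes C: "C \<in> carrier_mat n n" "contraction C" and "j < n"
  shows "sing_vals C ! j \<le> 1"
proof -
  obtain S T where S: "unitary_mat n S" and T: "unitary_mat n T"
    and svd: "C * T = S * mat_diag n (\<lambda>i. complex_of_real (sing_vals C ! i))"
    using singular_value_decomposition[OF C(1)] .
  note s = unitary_matD[OF S] and t = unitary_matD[OF T]
  have "S\<^sup>\<dagger> * (C * T) = mat_diag n (\<lambda>i. complex_of_real (sing_vals C ! i))" unfolding svd using S by simp
  moreover have "contraction (S\<^sup>\<dagger> * (C * T))"
    using C s t by (intro contraction_mult contraction_adjoint) auto
  ultimately have "cmod (mat_diag n (\<lambda>i. complex_of_real (sing_vals C ! i)) $$ (j,j)) \<le> 1"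
    using \<open>j < n\<close> by (intro contraction_entry) auto
  then show ?thesis using \<open>j < n\<close> by (simp add: mat_diag_def)
qed

text \<open>Let \<open>P\<close> project onto a subspace. The matrix \<open>B\<close> maps a vector of the subspace to the part
  of its image under \<open>U\<close> that is orthogonal to the subspace. Singular vectors of \<open>B\<close> for
  positive singular values lie in the subspace on the right and in its complement on the
  left; together they are \<open>2 m\<close> orthonormal vectors, so that \<open>2 m\<close> is at most the dimension.
  Applied to the right ones, \<open>U\<close> has the part \<open>W D\<close> in the complement, and by Pythagoras the
  parts in the subspace are orthogonal with squared norms \<open>1 - s\<^sub>i\<^sup>2\<close>.\<close>

lemma singular_frames:
  assumes P: "P \<in> carrier_mat n n" "P\<^sup>\<dagger> = P" "P * P = P" and U: "unitary_mat n U"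
    and B_def: "B = (1\<^sub>m n - P) * (U * P)" and m: "m \<le> n" "\<And>j. j < m \<Longrightarrow> 0 < sing_vals B ! j"
    and S: "unitary_mat n S" and T: "unitary_mat n T"
    and svd: "B * T = S * mat_diag n (\<lambda>i. complex_of_real (sing_vals B ! i))"
  defines "W \<equiv> take_cols m S" and "V \<equiv> take_cols m T"
    and "D \<equiv> mat_diag m (\<lambda>i. complex_of_real (sing_vals B ! i))"
  shows "P * W = 0\<^sub>m n m" "P * V = V" "2 * m \<le> n" "U * V = P * (U * V) + W * D"
    "(P * (U * V))\<^sup>\<dagger> * (P * (U * V)) = mat_diag m (\<lambda>i. complex_of_real (1 - (sing_vals B ! i)\<^sup>2))"
proof -
  note s = unitary_matD[OF S] and t = unitary_matD[OF T] and u = unitary_matD[OF U]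
  let ?s = "\<lambda>i. complex_of_real (sing_vals B ! i)"
  let ?Di = "mat_diag m (\<lambda>i. complex_of_real (1 / sing_vals B ! i))"
  have B: "B \<in> carrier_mat n n" using P u by (auto simp: B_def)
  have W: "W \<in> carrier_mat n m" and V: "V \<in> carrier_mat n m" using s t by (auto simp: W_def V_def intro: carrier_matI)
  have WW: "W\<^sup>\<dagger> * W = 1\<^sub>m m" and VV: "V\<^sup>\<dagger> * V = 1\<^sub>m m"
    unfolding W_def V_def using s(4) t(4) m(1) take_cols_isometry by auto
  have BV: "B * V = W * D"
    unfolding W_def V_def D_def using B t s m(1) by (simp add: mult_take_cols svd take_cols_diag)
  have "B = S * (mat_diag n ?s * T\<^sup>\<dagger>)"
  proof -
    have "B = (B * T) * T\<^sup>\<dagger>" using B t by (simp add: mult_assoc_dim)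
    then show ?thesis unfolding svd using s t by (simp add: mult_assoc_dim)
  qed
  then have "B\<^sup>\<dagger> * S = (S * (mat_diag n ?s * T\<^sup>\<dagger>))\<^sup>\<dagger> * S" by simp
  also have "\<dots> = T * mat_diag n ?s" using s t S by (simp add: adjoint_mult mult_assoc_dim)
  finally have BS: "B\<^sup>\<dagger> * S = T * mat_diag n ?s" .
  then have BW: "B\<^sup>\<dagger> * W = V * D"
    unfolding W_def V_def D_def using B t s m(1) by (simp add: mult_take_cols take_cols_diag)
  have nz: "sing_vals B ! j \<noteq> 0" if "j < m" for j using m(2)[OF that] by simp
  have "D * ?Di = 1\<^sub>m m"
    unfolding D_def mat_diag_diag using nz by (intro eq_matI) (auto simp: mat_diag_def)
  then have DDi: "M * D * ?Di = M" if "dim_col M = m" for M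
    using that by (simp add: mult_assoc_dim D_def)
  have W_eq: "W = B * (V * ?Di)" and V_eq: "V = B\<^sup>\<dagger> * (W * ?Di)"
    using DDi[of W] DDi[of V] W V B unfolding BV[symmetric] BW[symmetric] by (simp_all add: mult_assoc_dim)
  have PPc: "P * (P * M) = P * M" if "dim_row M = n" for M
    using P that by (simp flip: mult_assoc_dim)
  have PB: "P * B = 0\<^sub>m n n"
    using P u by (simp add: B_def mat_dist PPc)
  show PW: "P * W = 0\<^sub>m n m"
  proof -
    have "P * W = (P * B) * (V * ?Di)" using P B V by (subst W_eq) (simp add: mult_assoc_dim)
    then show ?thesis unfolding PB using V by simp
  qed
  have "P * B\<^sup>\<dagger> = B\<^sup>\<dagger>" using P u by (simp add: B_def mat_dist PPc)
  then have "P * (B\<^sup>\<dagger> * (W * ?Di)) = B\<^sup>\<dagger> * (W * ?Di)"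
    using P B W by (simp flip: mult_assoc_dim)
  then show PV: "P * V = V" using V_eq by metis
  have WP: "W\<^sup>\<dagger> * P = 0\<^sub>m m n" using arg_cong[OF PW, of mat_adjoint] P W by (simp add: adjoint_mult)
  have WV: "W\<^sup>\<dagger> * V = 0\<^sub>m m m"
  proof -
    have "W\<^sup>\<dagger> * V = W\<^sup>\<dagger> * (P * V)" by (simp add: PV)
    also have "\<dots> = (W\<^sup>\<dagger> * P) * V" using P W V by (simp add: mult_assoc_dim)
    finally show ?thesis unfolding WP using V by simp
  qed
  have VW: "V\<^sup>\<dagger> * W = 0\<^sub>m m m" using arg_cong[OF WV, of mat_adjoint] W V by (simp add: adjoint_mult)
  show "2 * m \<le> n"
  proof -
    \<comment> \<open>The projection onto the span of all these vectors has trace \<open>2 m\<close>, and its diagonal entries are at most 1.\<close>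
    let ?R = "W * W\<^sup>\<dagger> + V * V\<^sup>\<dagger>"
    have R: "?R \<in> carrier_mat n n" using W V by auto
    have c: "W\<^sup>\<dagger> * (W * M) = M" "V\<^sup>\<dagger> * (V * M) = M" "W\<^sup>\<dagger> * (V * M) = 0\<^sub>m m (dim_col M)" "V\<^sup>\<dagger> * (W * M) = 0\<^sub>m m (dim_col M)"
      if "dim_row M = m" for M
      using W V that WW VV WV VW by (simp_all flip: mult_assoc_dim)
    have "?R\<^sup>\<dagger> * ?R = ?R" using W V by (simp add: mat_dist c)
    then have "contraction ?R" by (rule contraction_projection)
    then have "cmod (?R $$ (i,i)) \<le> 1" if "i < n" for i using that R by (intro contraction_entry) auto
    then have "Re (?R $$ (i,i)) \<le> 1" if "i < n" for i using that complex_Re_le_cmod order_trans by blast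
    then have "Re (trace_mat ?R) \<le> (\<Sum>i<n. 1)"
      unfolding trace_mat_def Re_sum carrier_matD(1)[OF R] by (intro sum_mono) simp
    moreover have "trace_mat ?R = of_nat (2 * m)"
      using W V trace_comm[of W "W\<^sup>\<dagger>"] trace_comm[of V "V\<^sup>\<dagger>"] by (simp add: trace_add WW VV)
    ultimately show ?thesis by (simp del: of_nat_mult)
  qed
  show UV: "U * V = P * (U * V) + W * D"
  proof -
    have "W * D = (1\<^sub>m n - P) * (U * (P * V))"
      unfolding BV[symmetric] B_def using P u V by (simp add: mult_assoc_dim)
    also have "\<dots> = U * V - P * (U * V)" unfolding PV using P u V by (simp add: mat_dist)
    finally show ?thesis using P u V by (intro eq_matI) auto
  qed
  let ?Y = "P * (U * V)"
  have Y: "?Y \<in> carrier_mat n m" using P u V by auto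
  have D: "D \<in> carrier_mat m m" "D\<^sup>\<dagger> = D" by (auto simp: D_def)
  have YW: "?Y\<^sup>\<dagger> * W = 0\<^sub>m m m" using P u V W PW by (simp add: adjoint_mult mult_assoc_dim)
  have WY: "W\<^sup>\<dagger> * ?Y = 0\<^sub>m m m" using arg_cong[OF YW, of mat_adjoint] W P by (simp add: adjoint_mult)
  have "1\<^sub>m m = (U * V)\<^sup>\<dagger> * (U * V)" using u U V VV by (simp add: adjoint_mult mult_assoc_dim)
  also have "\<dots> = (?Y + W * D)\<^sup>\<dagger> * (?Y + W * D)" unfolding UV[symmetric] ..
  also have "\<dots> = ?Y\<^sup>\<dagger> * ?Y + D * D"
  proof -
    define Y where "Y = ?Y"
    note Y' = \<open>?Y \<in> carrier_mat n m\<close>[folded Y_def] YW[folded Y_def] WY[folded Y_def]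
    have c: "W\<^sup>\<dagger> * (W * M) = M" "Y\<^sup>\<dagger> * (W * M) = 0\<^sub>m m (dim_col M)"
      if "dim_row M = m" for M
      using W Y' that WW by (simp_all flip: mult_assoc_dim)
    show ?thesis
      unfolding Y_def[symmetric] using W D Y' by (simp add: mat_dist c)
  qed
  finally have gram: "1\<^sub>m m = ?Y\<^sup>\<dagger> * ?Y + D * D" .
  have "?Y\<^sup>\<dagger> * ?Y = (?Y\<^sup>\<dagger> * ?Y + D * D) - D * D" using Y D by (intro eq_matI) auto
  also have "\<dots> = 1\<^sub>m m - D * D" unfolding gram[symmetric] ..
  also have "\<dots> = mat_diag m (\<lambda>i. complex_of_real (1 - (sing_vals B ! i)\<^sup>2))"
    unfolding D_def mat_diag_diag by (intro eq_matI) (auto simp: mat_diag_def power2_eq_square)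
  finally show "?Y\<^sup>\<dagger> * ?Y = mat_diag m (\<lambda>i. complex_of_real (1 - (sing_vals B ! i)\<^sup>2))" .
qed

text \<open>The convex function \<open>arcsin (r x)\<close> lies above its tangent at \<open>s\<close>. The factor \<open>r < 1\<close> keeps
  the slope finite at \<open>s = 1\<close>.\<close>

lemma arcsin_tangent:
  assumes r: "0 < r" "r < 1" and s: "0 \<le> s" "s \<le> 1" and w: "0 \<le> w" "w \<le> (1::real)"
  shows "r / sqrt (1 - (r * s)\<^sup>2) * (w - s) \<le> arcsin (r * w) - arcsin (r * s)"
proof -
  let ?g' = "\<lambda>x. r / sqrt (1 - (r * x)\<^sup>2)"
  have pos: "0 < 1 - (r * x)\<^sup>2" if "0 \<le> x" "x \<le> 1" for x
  proof -
    have "r * x \<le> r * 1" using r that by (intro mult_left_mono) auto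
    moreover have "0 \<le> r * x" using r that by simp
    ultimately have "\<bar>r * x\<bar> < 1" using r by linarith
    then show ?thesis by (simp add: abs_square_less_1)
  qed
  have der: "((\<lambda>x. arcsin (r * x)) has_real_derivative ?g' x) (at x)" if "0 \<le> x" "x \<le> 1" for x
  proof -
    have "r * x \<le> r * 1" using r that by (intro mult_left_mono) auto
    moreover have "0 \<le> r * x" using r that by simp
    ultimately have "- 1 < r * x" "r * x < 1" using r by linarith+
    then show ?thesis by (auto intro!: derivative_eq_intros simp: divide_inverse)
  qed
  have mono: "?g' x \<le> ?g' y" if "0 \<le> x" "x \<le> y" "y \<le> 1" for x y
    using r that pos[of x] pos[of y] by (intro divide_left_mono real_sqrt_le_mono mult_pos_pos) (auto intro!: power_mono mult_left_mono)
  consider "w = s" | "s < w" | "w < s" by linarith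
  then show ?thesis
  proof cases
    case 2
    then obtain z where z: "s < z" "z < w" "arcsin (r * w) - arcsin (r * s) = (w - s) * ?g' z"
      using MVT2[of s w "\<lambda>x. arcsin (r * x)" ?g'] der s w by force
    have "(w - s) * ?g' s \<le> (w - s) * ?g' z" using mono[of s z] z s w by (intro mult_left_mono) auto
    then show ?thesis using z(3) by (simp only: mult.commute)
  next
    case 3
    then obtain z where z: "w < z" "z < s" "arcsin (r * s) - arcsin (r * w) = (s - w) * ?g' z"
      using MVT2[of w s "\<lambda>x. arcsin (r * x)" ?g'] der s w by force
    have "(s - w) * ?g' z \<le> (s - w) * ?g' s" using mono[of z s] z s w by (intro mult_left_mono) auto
    moreover have "?g' s * (w - s) = - ((s - w) * ?g' s)"
      by (simp only: mult.commute[of _ "w - s"] mult_minus_left[symmetric] minus_diff_eq)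
    ultimately show ?thesis using z(3) by linarith
  qed simp
qed

lemma trace_mult_mat_diag:
  assumes "M \<in> carrier_mat m m"
  shows "trace_mat (M * mat_diag m e) = (\<Sum>j<m. M $$ (j,j) * e j)"
  using assms by (simp add: trace_mat_def mat_diag_mult_right[OF assms])

lemma add_assoc_dim:
  "dim_row A = dim_row B \<Longrightarrow> dim_col A = dim_col B \<Longrightarrow> dim_row B = dim_row C \<Longrightarrow> dim_col B = dim_col C \<Longrightarrow>
    A + B + C = A + (B + (C :: complex mat))"
  by (rule assoc_add_mat[of _ "dim_row A" "dim_col A"]) auto

text \<open>The sum of the \<open>m\<close> largest angles (up to the factor \<open>r\<close> under the arcsine) grows in time \<open>h\<close>
  by at most \<open>h / 2\<close> times the spread, up to an error of order \<open>h\<^sup>2\<close> that does not depend on \<open>t\<close>.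
  The singular vectors \<open>W, V\<close> of the later matrix \<open>B (t + h)\<close> are used as test frames for \<open>B t\<close>.
  At the later time the weights \<open>e j\<close> are the slopes of the arcsine; by convexity the sum of
  angles at time \<open>t\<close> is at least the later sum plus \<open>\<Sum>j. e j (\<sigma> j - s j)\<close>, and by Ky Fan and
  summation by parts \<open>\<Sum>j. e j \<sigma> j\<close> is at least \<open>Re tr (W\<^sup>* B(t) V E)\<close>. Expanding
  \<open>U t = e\<^sup>-\<^sup>i\<^sup>h\<^sup>X U (t + h)\<close> to first order in \<open>h\<close>, this trace is \<open>\<Sum>j. e j s j\<close> minus
  \<open>h Re tr (W\<^sup>* X G)\<close>, up to the error. Here \<open>G\<close> consists of the components of \<open>U (t + h) V\<close> in the
  subspace, multiplied by \<open>e\<close> and the imaginary unit. It is orthogonal to \<open>W\<close>, so the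
  off-diagonal bound applies.\<close>

lemma angle_sum_step:
  fixes h t r :: real
  assumes Q: "unitary_mat n Q" and X_def: "X = diag_conj n Q (\<lambda>p. complex_of_real (x p))"
    and P: "P \<in> carrier_mat n n" "P\<^sup>\<dagger> = P" "P * P = P"
    and r: "0 < r" "r < 1" and m: "m \<le> n" and h: "0 \<le> h"
    and U_def: "\<And>t. U t = diag_conj n Q (\<lambda>p. exp (\<i> * complex_of_real (t * x p)))"
    and B_def: "\<And>t. B t = (1\<^sub>m n - P) * (U t * P)"
  shows "(\<Sum>j<m. arcsin (r * sing_vals (B (t + h)) ! j))
    \<le> (\<Sum>j<m. arcsin (r * sing_vals (B t) ! j)) + h / 2 * (\<Sum>j<min m (n div 2). spr_plus X ! j)
      + real m * (r / sqrt (1 - r\<^sup>2)) * (\<Sum>p<n. (x p)\<^sup>2) * h\<^sup>2"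
proof -
  note u = unitary_matD[OF Q]
  have X: "hermitian_mat n X" unfolding X_def by (rule hermitian_diag_conj[OF Q])
  then have Xc: "X \<in> carrier_mat n n" "X\<^sup>\<dagger> = X" by (auto simp: hermitian_mat_def)
  have U: "unitary_mat n (U t)" for t
    unfolding U_def by (rule unitary_diag_conj[OF Q]) (simp flip: of_real_mult)
  note uU = unitary_matD[OF U]
  have cP: "contraction P" "contraction (1\<^sub>m n - P)"
    using P by (auto intro!: contraction_projection simp: mat_dist)
  have B: "B t \<in> carrier_mat n n" "contraction (B t)" for t
    using P uU[of t] cP unfolding B_def by (auto intro!: contraction_mult)
  have sv: "length (sing_vals (B t)) = n" "decr_nonneg (sing_vals (B t))" for t
    using B(1)[of t] by (auto intro: length_sing_vals decr_nonneg_sing_vals)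
  define \<sigma> s where "\<sigma> j = sing_vals (B t) ! j" and "s j = sing_vals (B (t + h)) ! j" for j
  have bounds: "0 \<le> \<sigma> j" "\<sigma> j \<le> 1" "0 \<le> s j" "s j \<le> 1" if "j < n" for j
    using sv[of t] sv[of "t + h"] that sing_vals_contraction_le_one[OF B that]
    by (auto simp: \<sigma>_def s_def decr_nonneg_def)
  have s_decr: "s j \<le> s i" if "i \<le> j" "j < n" for i j
    using sv[of "t + h"] that
    by (auto simp: s_def decr_nonneg_def)
  obtain q where q: "q \<le> n" "\<And>i. i < n \<Longrightarrow> 0 < s i \<longleftrightarrow> i < q"
    using decreasing_threshold[of n s] s_decr by blast
  \<comment> \<open>Vanishing singular values contribute nothing to the later sum, and only the positive ones
    determine left singular vectors in the complement of the subspace.\<close>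
  define m' where "m' = min m q"
  have m': "m' \<le> m" "m' \<le> n" "\<And>j. j < m' \<Longrightarrow> 0 < s j" using m q by (auto simp: m'_def)
  obtain S T where S: "unitary_mat n S" and T: "unitary_mat n T"
    and svd: "B (t + h) * T = S * mat_diag n (\<lambda>i. complex_of_real (s i))"
    using singular_value_decomposition[OF B(1)] unfolding s_def .
  note uS = unitary_matD[OF S] and uT = unitary_matD[OF T]
  define W V where "W = take_cols m' S" and "V = take_cols m' T"
  define D where "D = mat_diag m' (\<lambda>i. complex_of_real (s i))"
  define Y where "Y = P * (U (t + h) * V)"
  have W: "W \<in> carrier_mat n m'" and V: "V \<in> carrier_mat n m'"
    using uS uT by (auto simp: W_def V_def intro: carrier_matI)
  have WW: "W\<^sup>\<dagger> * W = 1\<^sub>m m'" and VV: "V\<^sup>\<dagger> * V = 1\<^sub>m m'"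
    unfolding W_def V_def using uS(4) uT(4) m'(2) take_cols_isometry by auto
  have PW: "P * W = 0\<^sub>m n m'" and PV: "P * V = V" and m'2: "2 * m' \<le> n"
    and UV: "U (t + h) * V = Y + W * D"
    and YY: "Y\<^sup>\<dagger> * Y = mat_diag m' (\<lambda>i. complex_of_real (1 - (s i)\<^sup>2))"
    using singular_frames[OF P U B_def m'(2) _ S T] svd m'(3)
    unfolding W_def V_def Y_def D_def s_def by blast+
  have Y: "Y \<in> carrier_mat n m'" using P V uU by (auto simp: Y_def)
  have D: "D \<in> carrier_mat m' m'" "D\<^sup>\<dagger> = D" by (auto simp: D_def)
  have WP: "W\<^sup>\<dagger> * P = 0\<^sub>m m' n" using arg_cong[OF PW, of mat_adjoint] P W by (simp add: adjoint_mult)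
  have WPM: "W\<^sup>\<dagger> * (P * M) = 0\<^sub>m m' (dim_col M)" if "dim_row M = n" for M
    using W P that WP by (simp flip: mult_assoc_dim)
  have WY: "W\<^sup>\<dagger> * Y = 0\<^sub>m m' m'"
    unfolding Y_def using V uU by (simp add: WPM)
  \<comment> \<open>the slope of \<open>arcsin (r x)\<close> at \<open>s j\<close>, and the maximal slope on the unit interval\<close>
  define e where "e j = r / sqrt (1 - (r * s j)\<^sup>2)" for j
  define L where "L = r / sqrt (1 - r\<^sup>2)"
  define E where "E = mat_diag m' (\<lambda>j. complex_of_real (e j))"
  have E: "E \<in> carrier_mat m' m'" "E\<^sup>\<dagger> = E" by (auto simp: E_def)
  have rs: "(r * s j)\<^sup>2 \<le> r\<^sup>2" "r\<^sup>2 < 1" if "j < n" for j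
  proof -
    have "r * s j \<le> r * 1" using r bounds[OF that] by (intro mult_left_mono) auto
    then show "(r * s j)\<^sup>2 \<le> r\<^sup>2" using r bounds[OF that] by (intro power_mono) auto
    show "r\<^sup>2 < 1" using r by (simp add: abs_square_less_1)
  qed
  have e0: "0 \<le> e j" and eL: "e j \<le> L" if "j < n" for j
  proof -
    show "0 \<le> e j" using rs[OF that] r by (simp add: e_def)
    show "e j \<le> L" unfolding e_def L_def
      using rs[OF that] r by (intro divide_left_mono real_sqrt_le_mono mult_pos_pos) auto
  qed
  have e_decr: "e j \<le> e i" if "i \<le> j" "j < n" for i j
  proof -
    have "(r * s j)\<^sup>2 \<le> (r * s i)\<^sup>2"
      using s_decr[OF that] bounds[OF that(2)] r by (intro power_mono mult_left_mono) auto
    then show ?thesis unfolding e_def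
      using rs[OF that(2)] rs[of i] that r by (intro divide_left_mono real_sqrt_le_mono mult_pos_pos) auto
  qed
  have e_contr: "(e j)\<^sup>2 * (1 - (s j)\<^sup>2) \<le> 1" if "j < n" for j
  proof -
    have "(e j)\<^sup>2 = r\<^sup>2 / (1 - (r * s j)\<^sup>2)"
      using rs[OF that] by (simp add: e_def power_divide)
    moreover have "r\<^sup>2 * (1 - (s j)\<^sup>2) \<le> 1 - (r * s j)\<^sup>2"
      using rs[OF that] by (simp add: power_mult_distrib algebra_simps)
    ultimately show ?thesis using rs[OF that] by (simp add: divide_le_eq_1)
  qed
  \<comment> \<open>The columns of \<open>Y\<close> have norm \<open>sqrt (1 - (s j)\<^sup>2)\<close>, which compensates the growth of the slope
    \<open>e j\<close>: the weighted columns form a contraction.\<close>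
  define G where "G = \<i> \<cdot>\<^sub>m (Y * E)"
  have G: "G \<in> carrier_mat n m'" using Y E by (auto simp: G_def)
  have "G\<^sup>\<dagger> * G = E * ((Y\<^sup>\<dagger> * Y) * E)"
    using Y E by (simp add: G_def mat_dist) (intro eq_matI, auto)
  also have "\<dots> = mat_diag m' (\<lambda>j. complex_of_real ((e j)\<^sup>2 * (1 - (s j)\<^sup>2)))"
    unfolding YY E_def mat_diag_diag by (simp add: power2_eq_square mult_ac)
  finally have cG: "contraction G"
    by (rule contraction_diag) (use e_contr m'(2) in auto)
  have WG: "W\<^sup>\<dagger> * G = 0\<^sub>m m' m'"
  proof -
    have "W\<^sup>\<dagger> * G = \<i> \<cdot>\<^sub>m ((W\<^sup>\<dagger> * Y) * E)" using W Y E by (simp add: G_def mat_dist)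
    then show ?thesis unfolding WY using E by (intro eq_matI) auto
  qed
  have core: "2 * Re (trace_mat (W\<^sup>\<dagger> * (X * G))) \<le> (\<Sum>j<min m (n div 2). spr_plus X ! j)"
  proof -
    have "2 * Re (trace_mat (W\<^sup>\<dagger> * (X * G))) \<le> (\<Sum>j<m'. spr_plus X ! j)"
      using m'2 by (intro off_diagonal_trace_bound[OF X _ W contraction_isometry[OF WW] G cG WG]) auto
    also have "\<dots> \<le> (\<Sum>j<min m (n div 2). spr_plus X ! j)"
      using m'(1) m'2 decr_nonneg_spr_plus[OF X] length_spr_plus[OF X]
      by (intro sum_mono2) (auto simp: decr_nonneg_def)
    finally show ?thesis .
  qed
  \<comment> \<open>\<open>R\<close> is the remainder in the first order expansion of the exponential of \<open>- i h X\<close>.\<close>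
  define \<rho> where "\<rho> p = exp (\<i> * complex_of_real (- h * x p)) - 1 - \<i> * complex_of_real (- h * x p)" for p
  define R where "R = diag_conj n Q \<rho>"
  have R: "R \<in> carrier_mat n n" unfolding R_def by (rule diag_conj_carrier[OF Q])
  define U' where "U' = U (t + h)"
  have U'c: "U' \<in> carrier_mat n n" using uU by (simp add: U'_def)
  have Ut: "U t = U' + (- \<i> * complex_of_real h) \<cdot>\<^sub>m (X * U') + R * U'"
  proof -
    have "diag_conj n Q (\<lambda>p. 1 + (- \<i> * complex_of_real h) * complex_of_real (x p) + \<rho> p) * U' = U t"
      unfolding U'_def U_def diag_conj_mult[OF Q]
      by (rule diag_conj_cong) (simp add: \<rho>_def algebra_simps flip: exp_add)
    moreover have "diag_conj n Q (\<lambda>p. 1 + (- \<i> * complex_of_real h) * complex_of_real (x p) + \<rho> p)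
        = 1\<^sub>m n + (- \<i> * complex_of_real h) \<cdot>\<^sub>m X + R"
      unfolding X_def R_def diag_conj_one[OF Q, symmetric] using u
      by (simp add: diag_conj_smult diag_conj_add)
    ultimately show ?thesis using U'c Xc R by (simp add: mat_dist)
  qed
  have "W\<^sup>\<dagger> * (B t * (V * E)) = W\<^sup>\<dagger> * (U t * (V * E))"
  proof -
    have "B t * (V * E) = (1\<^sub>m n - P) * (U t * ((P * V) * E))"
      unfolding B_def using P uU[of t] V E by (simp add: mult_assoc_dim)
    then show ?thesis unfolding PV using P uU[of t] V E W by (simp add: mat_dist WPM)  (intro eq_matI, auto)
  qed
  also have "\<dots> = W\<^sup>\<dagger> * ((U' * V) * E) + (- \<i> * complex_of_real h) \<cdot>\<^sub>m (W\<^sup>\<dagger> * (X * ((U' * V) * E))) + W\<^sup>\<dagger> * (R * (U' * V)) * E"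
    unfolding Ut using U'c Xc R V W E by (simp add: mat_dist add_assoc_dim)
  finally have split: "trace_mat (W\<^sup>\<dagger> * (B t * (V * E))) = trace_mat (W\<^sup>\<dagger> * ((U' * V) * E))
      + (- \<i> * complex_of_real h) * trace_mat (W\<^sup>\<dagger> * (X * ((U' * V) * E))) + trace_mat (W\<^sup>\<dagger> * (R * (U' * V)) * E)"
    using U'c Xc R V W E by (simp add: trace_add trace_smult)
  have t1: "trace_mat (W\<^sup>\<dagger> * ((U' * V) * E)) = complex_of_real (\<Sum>j<m'. s j * e j)"
  proof -
    have "W\<^sup>\<dagger> * ((U' * V) * E) = (W\<^sup>\<dagger> * Y) * E + (W\<^sup>\<dagger> * W) * (D * E)"
      unfolding U'_def UV using W Y D E by (simp add: mat_dist)
    also have "\<dots> = mat_diag m' (\<lambda>j. complex_of_real (s j * e j))"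
      unfolding WY WW D_def E_def mat_diag_diag by (intro eq_matI) (auto simp: mat_diag_def)
    finally show ?thesis by (simp add: trace_mat_def mat_diag_def)
  qed
  \<comment> \<open>The part \<open>W D\<close> of \<open>U' V\<close> drops out: \<open>W\<^sup>* X W\<close> is Hermitian, and the factor \<open>i\<close> makes its
    contribution purely imaginary.\<close>
  have t2: "Re ((- \<i> * complex_of_real h) * trace_mat (W\<^sup>\<dagger> * (X * ((U' * V) * E)))) = - h * Re (trace_mat (W\<^sup>\<dagger> * (X * G)))"
  proof -
    have a: "trace_mat (W\<^sup>\<dagger> * (X * G)) = \<i> * trace_mat (W\<^sup>\<dagger> * (X * (Y * E)))"
      unfolding G_def using W Xc Y E by (simp add: mat_dist trace_smult)
    let ?K = "W\<^sup>\<dagger> * (X * W)"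
    have K: "?K \<in> carrier_mat m' m'" "?K\<^sup>\<dagger> = ?K" using W Xc by (auto simp: adjoint_mult mult_assoc_dim)
    have DE: "D * E = mat_diag m' (\<lambda>j. complex_of_real (s j * e j))"
      unfolding D_def E_def by simp
    have "cnj (?K $$ (j,j)) = ?K $$ (j,j)" if "j < m'" for j
      using arg_cong[OF K(2), of "\<lambda>M. M $$ (j,j)"] K(1) that by (metis carrier_matD index_adjoint)
    then have Im: "Im (?K $$ (j,j)) = 0" if "j < m'" for j using that by (simp add: complex_eq_iff)
    have "W\<^sup>\<dagger> * (X * ((W * D) * E)) = ?K * (D * E)" using W Xc D E by (simp add: mult_assoc_dim)
    then have b: "Im (trace_mat (W\<^sup>\<dagger> * (X * ((W * D) * E)))) = 0"
      unfolding DE using trace_mult_mat_diag[OF K(1)] Im by (simp del: index_mult_mat(1))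
    have "trace_mat (W\<^sup>\<dagger> * (X * ((U' * V) * E))) = trace_mat (W\<^sup>\<dagger> * (X * (Y * E))) + trace_mat (W\<^sup>\<dagger> * (X * ((W * D) * E)))"
      unfolding U'_def UV using W Xc D Y E by (simp add: mat_dist trace_add)
    then show ?thesis using a b by simp
  qed
  have t3: "- (real m * L * (\<Sum>p<n. (x p)\<^sup>2) * h\<^sup>2) \<le> Re (trace_mat (W\<^sup>\<dagger> * (R * (U' * V)) * E))"
  proof -
    let ?M = "W\<^sup>\<dagger> * (R * (U' * V))"
    define a b where "a = Q\<^sup>\<dagger> * W" and "b = Q\<^sup>\<dagger> * (U' * V)"
    have a: "a \<in> carrier_mat n m'" "contraction a"
      using W u contraction_isometry[OF WW] unfolding a_def by (auto intro!: contraction_mult contraction_adjoint)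
    have b: "b \<in> carrier_mat n m'" "contraction b"
      using V u uU[of "t + h"] contraction_isometry[OF VV]
      unfolding b_def U'_def by (auto intro!: contraction_mult contraction_adjoint)
    have M: "?M \<in> carrier_mat m' m'" using W R U'c V by auto
    have Mab: "?M = a\<^sup>\<dagger> * (mat_diag n \<rho> * b)"
      unfolding a_def b_def R_def diag_conj_def using W u U'c V by (simp add: adjoint_mult mult_assoc_dim)
    have entry: "cmod (?M $$ (j,j)) \<le> (\<Sum>p<n. (x p)\<^sup>2) * h\<^sup>2" if "j < m'" for j
    proof -
      have "?M $$ (j,j) = (\<Sum>p<n. cnj (a $$ (p,j)) * (\<rho> p * b $$ (p,j)))"
        unfolding Mab using a(1) b(1) that by (subst index_mult_sum) (auto simp: mat_diag_mult_left[OF b(1)])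
      also have "cmod \<dots> \<le> (\<Sum>p<n. (x p)\<^sup>2 * h\<^sup>2)"
      proof (rule sum_norm_le)
        fix p assume "p \<in> {..<n}"
        then have le: "cmod (a $$ (p,j)) \<le> 1" "cmod (b $$ (p,j)) \<le> 1"
          using a b that by (auto intro!: contraction_entry)
        have "cmod (\<rho> p) \<le> (- h * x p)\<^sup>2" unfolding \<rho>_def by (rule cmod_exp_second_order_le)
        also have "\<dots> = (x p)\<^sup>2 * h\<^sup>2" by (simp add: power_mult_distrib mult.commute)
        finally have "cmod (\<rho> p) \<le> (x p)\<^sup>2 * h\<^sup>2" .
        then have "cmod (a $$ (p,j)) * (cmod (\<rho> p) * cmod (b $$ (p,j))) \<le> 1 * ((x p)\<^sup>2 * h\<^sup>2 * 1)"
          using le by (intro mult_mono) auto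
        then show "cmod (cnj (a $$ (p,j)) * (\<rho> p * b $$ (p,j))) \<le> (x p)\<^sup>2 * h\<^sup>2"
          by (simp add: norm_mult)
      qed
      finally show ?thesis by (simp add: sum_distrib_right)
    qed
    have "\<bar>Re (trace_mat (?M * E))\<bar> \<le> cmod (trace_mat (?M * E))" by (rule abs_Re_le_cmod)
    also have "\<dots> \<le> (\<Sum>j<m'. (\<Sum>p<n. (x p)\<^sup>2) * h\<^sup>2 * L)"
      unfolding E_def trace_mult_mat_diag[OF M]
    proof (rule sum_norm_le)
      fix j assume "j \<in> {..<m'}"
      then have j: "j < m'" "j < n" using m'(2) by auto
      show "cmod (?M $$ (j,j) * complex_of_real (e j)) \<le> (\<Sum>p<n. (x p)\<^sup>2) * h\<^sup>2 * L"
        unfolding norm_mult using entry[OF j(1)] e0[OF j(2)] eL[OF j(2)]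
        by (intro mult_mono) (auto intro: order_trans[OF norm_ge_zero])
    qed
    also have "\<dots> = real m' * (L * (\<Sum>p<n. (x p)\<^sup>2) * h\<^sup>2)" by simp
    also have "\<dots> \<le> real m * (L * (\<Sum>p<n. (x p)\<^sup>2) * h\<^sup>2)"
    proof (rule mult_right_mono)
      have "0 \<le> L" unfolding L_def using r by (simp add: abs_square_le_1)
      then show "0 \<le> L * (\<Sum>p<n. (x p)\<^sup>2) * h\<^sup>2" by (simp add: sum_nonneg)
    qed (use m'(1) in simp)
    finally show ?thesis by (simp add: mult.assoc)
  qed
  have lower: "(\<Sum>j<m'. e j * s j) - h / 2 * (\<Sum>j<min m (n div 2). spr_plus X ! j) - real m * L * (\<Sum>p<n. (x p)\<^sup>2) * h\<^sup>2
      \<le> Re (trace_mat (W\<^sup>\<dagger> * (B t * (V * E))))"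
  proof -
    have "h * Re (trace_mat (W\<^sup>\<dagger> * (X * G))) \<le> h / 2 * (\<Sum>j<min m (n div 2). spr_plus X ! j)"
      using mult_left_mono[OF core h] by simp
    then show ?thesis
      unfolding split plus_complex.sel t1 Re_complex_of_real t2 using t3 by (simp add: mult.commute)
  qed
  \<comment> \<open>At time \<open>t\<close> the partial sums of \<open>b\<close> are dominated by those of the singular values.\<close>
  define b where "b j = Re ((S\<^sup>\<dagger> * (B t * T)) $$ (j,j))" for j
  have "Re (trace_mat (W\<^sup>\<dagger> * (B t * (V * E)))) = (\<Sum>j<m'. e j * b j)"
  proof -
    have K: "W\<^sup>\<dagger> * (B t * V) \<in> carrier_mat m' m'" using W V B by auto
    have "W\<^sup>\<dagger> * (B t * (V * E)) = (W\<^sup>\<dagger> * (B t * V)) * E"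
      using W V B[of t] E by (simp add: mult_assoc_dim)
    then have "trace_mat (W\<^sup>\<dagger> * (B t * (V * E))) = (\<Sum>j<m'. (W\<^sup>\<dagger> * (B t * V)) $$ (j,j) * complex_of_real (e j))"
      unfolding E_def using trace_mult_mat_diag[OF K] by simp
    also have "\<dots> = (\<Sum>j<m'. (S\<^sup>\<dagger> * (B t * T)) $$ (j,j) * complex_of_real (e j))"
      unfolding W_def V_def using uS uT B(1)[of t] m'(2)
      by (intro sum.cong refl arg_cong2[of _ _ _ _ "(*)"] take_cols_compress) auto
    finally show ?thesis by (simp add: b_def mult.commute del: index_mult_mat(1))
  qed
  also have "(\<Sum>j<m'. e j * b j) \<le> (\<Sum>j<m'. e j * \<sigma> j)"
  proof (rule Abel_sum_mono)
    fix l assume "l \<le> m'"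
    then have l: "l \<le> n" using m'(2) by simp
    have "(\<Sum>i<l. b i) = Re (trace_mat ((take_cols l S)\<^sup>\<dagger> * (B t * take_cols l T)))"
      using take_cols_compress_trace[OF uS(1) B(1) uT(1) l] by (simp add: b_def)
    also have "\<dots> \<le> (\<Sum>j<l. \<sigma> j)"
      unfolding \<sigma>_def
      using take_cols_isometry[OF uS(4) l] take_cols_isometry[OF uT(4) l] uS(2) uT(2)
      by (intro Ky_Fan_trace_le[OF B(1) l]) (auto intro: contraction_isometry carrier_matI)
    finally show "(\<Sum>i<l. b i) \<le> (\<Sum>j<l. \<sigma> j)" .
  qed (use e_decr e0 m'(2) in auto)
  finally have "(\<Sum>j<m'. e j * s j) - h / 2 * (\<Sum>j<min m (n div 2). spr_plus X ! j) - real m * L * (\<Sum>p<n. (x p)\<^sup>2) * h\<^sup>2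
      \<le> (\<Sum>j<m'. e j * \<sigma> j)" using lower by linarith
  moreover have "(\<Sum>j<m'. e j * \<sigma> j) - (\<Sum>j<m'. e j * s j) \<le> (\<Sum>j<m'. arcsin (r * \<sigma> j)) - (\<Sum>j<m'. arcsin (r * s j))"
    unfolding sum_subtractf[symmetric] right_diff_distrib[symmetric] e_def
    using r bounds m'(2) by (intro sum_mono arcsin_tangent) auto
  moreover have "(\<Sum>j<m'. arcsin (r * \<sigma> j)) \<le> (\<Sum>j<m. arcsin (r * \<sigma> j))"
  proof (rule sum_mono2)
    fix j assume "j \<in> {..<m} - {..<m'}"
    then have "0 \<le> \<sigma> j" "\<sigma> j \<le> 1" using bounds m by auto
    then show "0 \<le> arcsin (r * \<sigma> j)" using r by (intro arcsin_nonneg) (auto intro: mult_le_one)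
  qed (use m'(1) in auto)
  moreover have "(\<Sum>j<m. arcsin (r * s j)) = (\<Sum>j<m'. arcsin (r * s j))"
  proof (rule sum.mono_neutral_right)
    show "\<forall>j\<in>{..<m} - {..<m'}. arcsin (r * s j) = 0"
    proof
      fix j assume "j \<in> {..<m} - {..<m'}"
      then have j: "j < n" "\<not> j < q" using m by (auto simp: m'_def)
      then have "s j = 0" using q(2)[OF j(1)] bounds(3)[OF j(1)] by simp
      then show "arcsin (r * s j) = 0" by simp
    qed
  qed (use m'(1) in auto)
  ultimately show ?thesis unfolding \<sigma>_def s_def L_def by linarith
qed

lemma sing_vals_zero:
  assumes "j < n"
  shows "sing_vals (0\<^sub>m n n) ! j = 0"
proof -
  have C: "0\<^sub>m n n \<in> carrier_mat n n" by simp
  obtain F G where FG: "F \<in> carrier_mat n n" "G \<in> carrier_mat n n"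
    "Re (trace_mat (F\<^sup>\<dagger> * (0\<^sub>m n n * G))) = (\<Sum>j<n. sing_vals (0\<^sub>m n n) ! j)"
    using Ky_Fan_trace_attained[OF C order_refl] by metis
  have nn: "0 \<le> sing_vals (0\<^sub>m n n) ! j" if "j < n" for j
    using that length_sing_vals[of "0\<^sub>m n n" n] decr_nonneg_sing_vals[of "0\<^sub>m n n" n] by (simp add: decr_nonneg_def)
  have "(\<Sum>j<n. sing_vals (0\<^sub>m n n) ! j) = 0" using FG by simp
  then show ?thesis using assms nn sum_nonneg_eq_0_iff[of "{..<n}" "\<lambda>j. sing_vals (0\<^sub>m n n) ! j"] by simp
qed

text \<open>The unit interval is divided into \<open>N + 1\<close> steps. Their errors add up to order
  \<open>1 / (N + 1)\<close> and disappear as \<open>N\<close> grows; the sum starts from zero because \<open>B 0 = 0\<close>. Then \<open>r\<close>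
  tends to 1.\<close>

lemma angle_sum_bound:
  assumes X: "hermitian_mat n X" and P: "P \<in> carrier_mat n n" "P\<^sup>\<dagger> = P" "P * P = P" and m: "m \<le> n"
  shows "(\<Sum>j<m. arcsin (sing_vals ((1\<^sub>m n - P) * (mat_exp (\<i> \<cdot>\<^sub>m X) * P)) ! j))
    \<le> (\<Sum>j<min m (n div 2). spr_plus X ! j) / 2"
proof -
  obtain Q x where Q: "unitary_mat n Q" and X_def: "X = diag_conj n Q (\<lambda>p. complex_of_real (x p))"
    and e: "mat_exp (\<i> \<cdot>\<^sub>m X) = diag_conj n Q (\<lambda>p. exp (\<i> * complex_of_real (x p)))"
    using hermitian_exp[OF X] .
  note u = unitary_matD[OF Q]
  define U where "U t = diag_conj n Q (\<lambda>p. exp (\<i> * complex_of_real (t * x p)))" for t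
  define B where "B t = (1\<^sub>m n - P) * (U t * P)" for t
  define s where "s t j = sing_vals (B t) ! j" for t j
  let ?c = "\<Sum>j<min m (n div 2). spr_plus X ! j"
  have B0: "B 0 = 0\<^sub>m n n"
    using P by (simp add: B_def U_def diag_conj_one[OF Q] mat_dist)
  have B1: "B 1 = (1\<^sub>m n - P) * (mat_exp (\<i> \<cdot>\<^sub>m X) * P)" by (simp add: B_def U_def e)
  have cP: "contraction P" "contraction (1\<^sub>m n - P)"
    using P by (auto intro!: contraction_projection simp: mat_dist)
  have s1: "0 \<le> s 1 j" "s 1 j \<le> 1" if "j < m" for j
  proof -
    have "unitary_mat n (U 1)" unfolding U_def by (rule unitary_diag_conj[OF Q]) simp
    then have B: "B 1 \<in> carrier_mat n n" "contraction (B 1)"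
      using P unitary_matD[of n "U 1"] cP unfolding B_def by (auto intro!: contraction_mult)
    show "s 1 j \<le> 1" unfolding s_def using that m by (intro sing_vals_contraction_le_one[OF B]) simp
    show "0 \<le> s 1 j" unfolding s_def
      using that m B length_sing_vals[of "B 1" n] decr_nonneg_sing_vals[of "B 1" n] by (simp add: decr_nonneg_def)
  qed
  have bound: "(\<Sum>j<m. arcsin (r * s 1 j)) \<le> ?c / 2" if r: "0 < r" "r < 1" for r
  proof -
    define K where "K = real m * (r / sqrt (1 - r\<^sup>2)) * (\<Sum>p<n. (x p)\<^sup>2)"
    have step: "(\<Sum>j<m. arcsin (r * s (t + h) j)) \<le> (\<Sum>j<m. arcsin (r * s t j)) + h / 2 * ?c + K * h\<^sup>2"
      if "0 \<le> h" for t h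
      using angle_sum_step[OF Q X_def P r m that U_def B_def] unfolding s_def K_def .
    have N: "(\<Sum>j<m. arcsin (r * s 1 j)) \<le> ?c / 2 + K / real (Suc N)" for N
    proof -
      define h where "h = 1 / real (Suc N)"
      have h: "0 \<le> h" "real (Suc N) * h = 1" by (simp_all add: h_def)
      have "(\<Sum>j<m. arcsin (r * s (real k * h) j)) \<le> real k * (h / 2 * ?c + K * h\<^sup>2)" for k
      proof (induction k)
        case 0
        have "s 0 j = 0" if "j < m" for j using that m by (simp add: s_def B0 sing_vals_zero)
        then show ?case by simp
      next
        case (Suc k)
        have "real (Suc k) * z = real k * z + z" for z by (simp add: algebra_simps)
        then show ?case using step[OF h(1), of "real k * h"] Suc by simp
      qed
      from this[of "Suc N"] have "(\<Sum>j<m. arcsin (r * s 1 j)) \<le> real (Suc N) * (h / 2 * ?c + K * h\<^sup>2)"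
        unfolding h(2) .
      also have "\<dots> = (real (Suc N) * h) * ?c / 2 + (real (Suc N) * h) * (K * h)"
        by (simp add: power2_eq_square algebra_simps)
      also have "\<dots> = ?c / 2 + K / real (Suc N)" unfolding h(2) by (simp add: h_def)
      finally show ?thesis .
    qed
    have "(\<lambda>N. ?c / 2 + K / real (Suc N)) \<longlonglongrightarrow> ?c / 2 + 0"
      by (intro tendsto_add tendsto_const LIMSEQ_Suc lim_const_over_n)
    then show ?thesis using N by (intro LIMSEQ_le_const[of _ "?c / 2"]) auto
  qed
  have rlim: "(\<lambda>N. 1 - 1 / real (Suc (Suc N))) \<longlonglongrightarrow> 1 - 0"
    by (intro tendsto_diff tendsto_const LIMSEQ_Suc lim_const_over_n)
  have "(\<lambda>N. \<Sum>j<m. arcsin ((1 - 1 / real (Suc (Suc N))) * s 1 j)) \<longlonglongrightarrow> (\<Sum>j<m. arcsin (s 1 j))"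
  proof (rule tendsto_sum)
    fix j assume "j \<in> {..<m}"
    then have j: "0 \<le> s 1 j" "s 1 j \<le> 1" using s1 by auto
    have "(\<lambda>N. (1 - 1 / real (Suc (Suc N))) * s 1 j) \<longlonglongrightarrow> s 1 j"
      using tendsto_mult_right[OF rlim, of "s 1 j"] by simp
    moreover have "(1 - 1 / real (Suc (Suc N))) * s 1 j \<in> {-1..1}" for N
    proof -
      have "0 \<le> (1 - 1 / real (Suc (Suc N))) * s 1 j" using j by (intro mult_nonneg_nonneg) auto
      moreover have "(1 - 1 / real (Suc (Suc N))) * s 1 j \<le> 1" using j by (intro mult_le_one) auto
      ultimately show ?thesis by simp
    qed
    ultimately show "(\<lambda>N. arcsin ((1 - 1 / real (Suc (Suc N))) * s 1 j)) \<longlonglongrightarrow> arcsin (s 1 j)"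
      using j by (intro continuous_on_tendsto_compose[OF continuous_on_arcsin']) auto
  qed
  then have "(\<Sum>j<m. arcsin (s 1 j)) \<le> ?c / 2"
  proof (rule LIMSEQ_le_const2)
    show "\<exists>N. \<forall>n\<ge>N. (\<Sum>j<m. arcsin ((1 - 1 / real (Suc (Suc n))) * s 1 j)) \<le> ?c / 2"
      by (intro exI allI impI bound) auto
  qed
  then show ?thesis by (simp add: s_def B1)
qed

section \<open>Principal angles\<close>

lemma isometry_le_dim:
  assumes "isometry_mat n k V" shows "k \<le> n"
proof -
  have V: "V \<in> carrier_mat n k" "V\<^sup>\<dagger> * V = 1\<^sub>m k" using assms by (auto simp: isometry_mat_def)
  have "complex_of_real (real k) = complex_of_real (\<Sum>p<n. \<Sum>j<k. (cmod (V $$ (p,j)))\<^sup>2)"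
    using trace_square[of V] V by simp
  then have "real k = (\<Sum>p<n. \<Sum>j<k. (cmod (V $$ (p,j)))\<^sup>2)" using of_real_eq_iff by blast
  also have "\<dots> \<le> (\<Sum>p<n. 1)"
    using contraction_row_norm[OF contraction_isometry[OF V(2)]] V(1) by (intro sum_mono) auto
  finally show ?thesis by simp
qed

lemma append_col_mult_vec:
  assumes "V \<in> carrier_mat n k" "v \<in> carrier_vec n" "c \<in> carrier_vec (Suc k)"
  shows "append_col V v *\<^sub>v c = V *\<^sub>v vec k (\<lambda>i. c $ i) + (c $ k) \<cdot>\<^sub>v v"
  using assms
  by (intro eq_vecI) (auto simp: index_mult_vec_sum append_col_def mult.commute simp del: index_mult_mat_vec)

text \<open>A largest orthonormal family in \<open>S\<close> spans \<open>S\<close>: otherwise the component of some vector of \<open>S\<close>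
  orthogonal to the family could be normalized and appended.\<close>

lemma subspace_isometry:
  assumes S: "VectorSpace.subspace class_ring S (module_vec TYPE(complex) n)"
  obtains k V where "isometry_mat n k V" "range_mat V = S"
proof -
  have sub: "submodule class_ring S (module_vec TYPE(complex) n)" using S by (simp add: subspace_def)
  have car: "S \<subseteq> carrier_vec n" and zero: "0\<^sub>v n \<in> S"
    using submodule.subset[OF sub] submodule.zero_closed[OF sub] by (simp_all add: module_vec_simps)
  have add: "v + w \<in> S" if "v \<in> S" "w \<in> S" for v w
    using submodule.m_closed[OF sub that] by (simp add: module_vec_simps)
  have smult: "c \<cdot>\<^sub>v v \<in> S" if "v \<in> S" for v c
    using submodule.smult_closed[OF sub _ that, of c] by (simp add: module_vec_simps class_ring_simps)
  let ?ok = "\<lambda>k. \<exists>V. isometry_mat n k V \<and> range_mat V \<subseteq> S"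
  have "?ok 0"
  proof (intro exI conjI)
    show "isometry_mat n 0 (0\<^sub>m n 0)" by (auto simp: isometry_mat_def)
    have "0\<^sub>m n 0 *\<^sub>v x = 0\<^sub>v n" if "x \<in> carrier_vec 0" for x :: "complex vec"
      using that by (intro eq_vecI) (auto simp: scalar_prod_def)
    then show "range_mat (0\<^sub>m n 0) \<subseteq> S" using zero by (auto simp: range_mat_def)
  qed
  moreover have "\<forall>k. ?ok k \<longrightarrow> k \<le> n" using isometry_le_dim by blast
  ultimately obtain k where k: "?ok k" "\<And>l. ?ok l \<Longrightarrow> l \<le> k"
    using Nat.ex_has_greatest_nat[of ?ok 0 n] by blast
  then obtain V where V: "isometry_mat n k V" and sub: "range_mat V \<subseteq> S" by blast
  have Vc: "V \<in> carrier_mat n k" "V\<^sup>\<dagger> * V = 1\<^sub>m k" using V by (auto simp: isometry_mat_def)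
  have inS: "V *\<^sub>v c \<in> S" if "c \<in> carrier_vec k" for c
    using sub that Vc by (auto simp: range_mat_def)
  have "S \<subseteq> range_mat V"
  proof (rule ccontr)
    assume "\<not> S \<subseteq> range_mat V"
    then obtain v where v: "v \<in> S" "v \<notin> range_mat V" by blast
    then have vc: "v \<in> carrier_vec n" using car by blast
    define w where "w = v + (- 1) \<cdot>\<^sub>v (V *\<^sub>v (V\<^sup>\<dagger> *\<^sub>v v))"
    have p: "V *\<^sub>v (V\<^sup>\<dagger> *\<^sub>v v) \<in> S" using Vc vc by (intro inS) auto
    then have pc: "V *\<^sub>v (V\<^sup>\<dagger> *\<^sub>v v) \<in> carrier_vec n" using car by blast
    have w: "w \<in> S" unfolding w_def using v(1) p by (intro add smult) auto
    then have wc: "w \<in> carrier_vec n" using car by blast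
    have Vw: "V\<^sup>\<dagger> *\<^sub>v w = 0\<^sub>v k"
    proof -
      have "V\<^sup>\<dagger> *\<^sub>v w = V\<^sup>\<dagger> *\<^sub>v v + (- 1) \<cdot>\<^sub>v (V\<^sup>\<dagger> *\<^sub>v (V *\<^sub>v (V\<^sup>\<dagger> *\<^sub>v v)))"
        unfolding w_def using Vc vc pc
        by (simp add: mult_add_distrib_mat_vec[of _ k n] mult_mat_vec[of _ k n])
      also have "V\<^sup>\<dagger> *\<^sub>v (V *\<^sub>v (V\<^sup>\<dagger> *\<^sub>v v)) = V\<^sup>\<dagger> *\<^sub>v v"
        using Vc vc by (simp add: Vc(2) flip: mult_vec_assoc_dim[of "V\<^sup>\<dagger>" V])
      finally show ?thesis using Vc by (intro eq_vecI) auto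
    qed
    have "w \<noteq> 0\<^sub>v n"
    proof
      assume w0: "w = 0\<^sub>v n"
      have "v = V *\<^sub>v (V\<^sup>\<dagger> *\<^sub>v v)"
      proof (rule eq_vecI)
        fix i assume "i < dim_vec (V *\<^sub>v (V\<^sup>\<dagger> *\<^sub>v v))"
        then have i: "i < n" using Vc by simp
        have "w $ i = 0" using w0 i by simp
        then show "v $ i = (V *\<^sub>v (V\<^sup>\<dagger> *\<^sub>v v)) $ i" unfolding w_def using i vc Vc(1) by (simp del: index_mult_mat_vec)
      qed (use vc Vc in auto)
      then have "v \<in> range_mat V" using Vc vc by (auto simp: range_mat_def intro!: image_eqI[of _ _ "V\<^sup>\<dagger> *\<^sub>v v"])
      with v(2) show False ..
    qed
    then obtain a where a: "sqnorm (a \<cdot>\<^sub>v w) = 1"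
      using exists_unit_multiple[OF wc] by blast
    have aw: "a \<cdot>\<^sub>v w \<in> S" "a \<cdot>\<^sub>v w \<in> carrier_vec n" using w wc smult by auto
    have "V\<^sup>\<dagger> *\<^sub>v (a \<cdot>\<^sub>v w) = 0\<^sub>v k"
      using mult_mat_vec[of "V\<^sup>\<dagger>" k n w a] Vc wc Vw by (simp, intro eq_vecI) auto
    then have "isometry_mat n (Suc k) (append_col V (a \<cdot>\<^sub>v w))"
      using isometry_append_col[OF Vc aw(2) a] Vc(1) by (auto simp: isometry_mat_def)
    moreover have "range_mat (append_col V (a \<cdot>\<^sub>v w)) \<subseteq> S"
    proof
      fix y assume "y \<in> range_mat (append_col V (a \<cdot>\<^sub>v w))"
      then obtain c where c: "c \<in> carrier_vec (Suc k)" "y = append_col V (a \<cdot>\<^sub>v w) *\<^sub>v c"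
        using Vc by (auto simp: range_mat_def)
      show "y \<in> S"
        unfolding c(2) append_col_mult_vec[OF Vc(1) aw(2) c(1)] by (intro add inS smult[OF aw(1)]) auto
    qed
    ultimately have "Suc k \<le> k" using k(2)[of "Suc k"] by blast
    then show False by simp
  qed
  with sub V show thesis using that by blast
qed

lemma mat_eq_by_mult_vec:
  assumes "A \<in> carrier_mat n k" "B \<in> carrier_mat n k" "\<And>c. c \<in> carrier_vec k \<Longrightarrow> A *\<^sub>v c = B *\<^sub>v (c :: complex vec)"
  shows "A = B"
proof (rule eq_matI)
  fix i j assume "i < dim_row B" "j < dim_col B"
  then have ij: "i < n" "j < k" using assms by auto
  have "M *\<^sub>v unit_vec k j = col M j" if "M \<in> carrier_mat n k" for M :: "complex mat"
    using mult_unit_vec[of j M] that ij by simp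
  then have "col A j = col B j" using assms by (metis unit_vec_carrier)
  then have "col A j $ i = col B j $ i" by simp
  then show "A $$ (i,j) = B $$ (i,j)" using ij assms by auto
qed (use assms in auto)

text \<open>\<open>V V\<^sup>*\<close> and \<open>W W\<^sup>*\<close> are the identity on the common range. Hence \<open>R = V\<^sup>* W\<close> is an isometry in
  both directions, and the traces of \<open>R\<^sup>* R\<close> and \<open>R R\<^sup>*\<close> give \<open>l = k\<close>.\<close>

lemma isometry_same_range:
  assumes V: "isometry_mat n k V" and W: "isometry_mat n l W" and eq: "range_mat V = range_mat W"
  obtains R where "l = k" "unitary_mat k R" "W = V * R"
proof -
  have Vc: "V \<in> carrier_mat n k" "V\<^sup>\<dagger> * V = 1\<^sub>m k" and Wc: "W \<in> carrier_mat n l" "W\<^sup>\<dagger> * W = 1\<^sub>m l"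
    using V W by (auto simp: isometry_mat_def)
  have proj: "A * (A\<^sup>\<dagger> * B) = B" if A: "A \<in> carrier_mat n a" "A\<^sup>\<dagger> * A = 1\<^sub>m a" and B: "B \<in> carrier_mat n b"
    and range: "range_mat B \<subseteq> range_mat A" for A B a b
  proof (rule mat_eq_by_mult_vec)
    fix c :: "complex vec" assume c: "c \<in> carrier_vec b"
    then have "B *\<^sub>v c \<in> range_mat A" using range B by (auto simp: range_mat_def)
    then obtain d where d: "d \<in> carrier_vec a" "B *\<^sub>v c = A *\<^sub>v d" using A by (auto simp: range_mat_def)
    have "A * (A\<^sup>\<dagger> * B) *\<^sub>v c = A *\<^sub>v (A\<^sup>\<dagger> *\<^sub>v (B *\<^sub>v c))" using A B c by (simp add: mult_vec_assoc_dim)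
    also have "\<dots> = A *\<^sub>v ((A\<^sup>\<dagger> * A) *\<^sub>v d)" unfolding d(2) using A(1) d by (simp add: mult_vec_assoc_dim)
    also have "\<dots> = B *\<^sub>v c" unfolding A(2) d(2) using d(1) by simp
    finally show "A * (A\<^sup>\<dagger> * B) *\<^sub>v c = B *\<^sub>v c" .
  qed (use A B in auto)
  define R where "R = V\<^sup>\<dagger> * W"
  have W_eq: "V * R = W" unfolding R_def using proj[OF Vc Wc(1)] eq by simp
  have V_eq: "W * (W\<^sup>\<dagger> * V) = V" using proj[OF Wc Vc(1)] eq by simp
  have R: "R \<in> carrier_mat k l" using Vc Wc by (auto simp: R_def)
  have RR: "R\<^sup>\<dagger> * R = 1\<^sub>m l"
  proof -
    have "R\<^sup>\<dagger> * R = W\<^sup>\<dagger> * (V * R)" using Vc Wc by (simp add: R_def adjoint_mult mult_assoc_dim)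
    then show ?thesis unfolding W_eq using Wc by simp
  qed
  have "R * R\<^sup>\<dagger> = V\<^sup>\<dagger> * (W * (W\<^sup>\<dagger> * V))" using Vc Wc by (simp add: R_def adjoint_mult mult_assoc_dim)
  also have "\<dots> = 1\<^sub>m k" unfolding V_eq using Vc by simp
  finally have "of_nat k = (of_nat l :: complex)"
    using RR R trace_comm[of R "R\<^sup>\<dagger>"] by simp
  then have "l = k" by simp
  with R RR W_eq show thesis using that[of R] by (simp add: isometry_mat_def)
qed

text \<open>A different choice of isometries multiplies \<open>V\<^sup>* W\<close> by unitary matrices on both sides,
  which preserves the singular values and therefore the angles.\<close>

lemma principal_angles_eq:
  assumes V: "isometry_mat n k V" "range_mat V = S" and W: "isometry_mat n k W" "range_mat W = T"
  shows "principal_angles n S T = map (\<lambda>j. arccos (sing_vals (V\<^sup>\<dagger> * W) ! (k - 1 - j))) [0..<k]"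
    and "\<And>j. j < k \<Longrightarrow> 0 \<le> sing_vals (V\<^sup>\<dagger> * W) ! j \<and> sing_vals (V\<^sup>\<dagger> * W) ! j \<le> 1"
proof -
  have Vc: "V \<in> carrier_mat n k" "V\<^sup>\<dagger> * V = 1\<^sub>m k" and Wc: "W \<in> carrier_mat n k" "W\<^sup>\<dagger> * W = 1\<^sub>m k"
    using V W by (auto simp: isometry_mat_def)
  let ?c = "\<lambda>j. sing_vals (V\<^sup>\<dagger> * W) ! j"
  have C: "V\<^sup>\<dagger> * W \<in> carrier_mat k k" "contraction (V\<^sup>\<dagger> * W)"
    using Vc Wc contraction_isometry[OF Vc(2)] contraction_isometry[OF Wc(2)]
    by (auto intro!: contraction_mult contraction_adjoint)
  show c: "0 \<le> ?c j \<and> ?c j \<le> 1" if "j < k" for j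
    using sing_vals_contraction_le_one[OF C that] Wc that length_sing_vals[of "V\<^sup>\<dagger> * W" k]
      decr_nonneg_sing_vals[of "V\<^sup>\<dagger> * W" k] by (simp add: decr_nonneg_def)
  show "principal_angles n S T = map (\<lambda>j. arccos (?c (k - 1 - j))) [0..<k]"
    unfolding principal_angles_def
  proof (rule the_equality)
    have "0 \<le> arccos (?c (k - 1 - j))" "arccos (?c (k - 1 - j)) \<le> pi / 2"
        "cos (arccos (?c (k - 1 - j))) = ?c (k - 1 - j)" if "j < k" for j
      using c[of "k - 1 - j"] that arccos_lbound[of "?c (k - 1 - j)"] arccos_le_pi2[of "?c (k - 1 - j)"] by auto
    then show "\<exists>k' P Q. isometry_mat n k' P \<and> range_mat P = S \<and> isometry_mat n k' Q \<and> range_mat Q = T \<and>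
       length (map (\<lambda>j. arccos (?c (k - 1 - j))) [0..<k]) = k' \<and>
       (\<forall>j<k'. 0 \<le> map (\<lambda>j. arccos (?c (k - 1 - j))) [0..<k] ! j \<and>
         map (\<lambda>j. arccos (?c (k - 1 - j))) [0..<k] ! j \<le> pi / 2 \<and>
         cos (map (\<lambda>j. arccos (?c (k - 1 - j))) [0..<k] ! j) = sing_vals (P\<^sup>\<dagger> * Q) ! (k' - 1 - j))"
      using V W by (intro exI[of _ k] exI[of _ V] exI[of _ W]) auto
  next
    fix \<theta> assume "\<exists>k' P Q. isometry_mat n k' P \<and> range_mat P = S \<and> isometry_mat n k' Q \<and> range_mat Q = T \<and>
       length \<theta> = k' \<and> (\<forall>j<k'. 0 \<le> \<theta> ! j \<and> \<theta> ! j \<le> pi / 2 \<and> cos (\<theta> ! j) = sing_vals (P\<^sup>\<dagger> * Q) ! (k' - 1 - j))"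
    then obtain k' P Q where P: "isometry_mat n k' P" "range_mat P = S" and Q: "isometry_mat n k' Q" "range_mat Q = T"
      and len: "length \<theta> = k'"
      and \<theta>: "\<And>j. j < k' \<Longrightarrow> 0 \<le> \<theta> ! j \<and> \<theta> ! j \<le> pi / 2 \<and> cos (\<theta> ! j) = sing_vals (P\<^sup>\<dagger> * Q) ! (k' - 1 - j)"
      by blast
    obtain R1 where R1: "k' = k" "unitary_mat k R1" "P = V * R1"
      using isometry_same_range[OF V(1) P(1)] V(2) P(2) by metis
    obtain R2 where R2: "unitary_mat k R2" "Q = W * R2"
      using isometry_same_range[OF W(1) Q(1)] W(2) Q(2) by metis
    note r1 = unitary_matD[OF R1(2)] and r2 = unitary_matD[OF R2(1)]
    have "P\<^sup>\<dagger> * Q = R1\<^sup>\<dagger> * ((V\<^sup>\<dagger> * W) * R2)"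
      unfolding R1(3) R2(2) using Vc Wc r1 r2 by (simp add: adjoint_mult mult_assoc_dim)
    then have "sing_vals (P\<^sup>\<dagger> * Q) = sing_vals (V\<^sup>\<dagger> * W)"
      using sing_vals_unitary_left[of "(V\<^sup>\<dagger> * W) * R2" "R1\<^sup>\<dagger>"] sing_vals_unitary_right[of "V\<^sup>\<dagger> * W" R2] r1 R2(1) Vc Wc
      by simp
    with \<theta> R1(1) have "\<theta> ! j = arccos (?c (k - 1 - j))" if "j < k" for j
      using that arccos_cos[of "\<theta> ! j"] by force
    then show "\<theta> = map (\<lambda>j. arccos (?c (k - 1 - j))) [0..<k]"
      using len R1(1) by (intro nth_equalityI) auto
  qed
qed

text \<open>With \<open>C = V\<^sup>* U V\<close>, the Gram matrix of \<open>(1 - P) U P\<close> is \<open>V (1 - C\<^sup>* C) V\<^sup>*\<close>. Its eigenvalues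
  are \<open>1 - c\<^sub>j\<^sup>2\<close>, and 0 on the complement of the range of \<open>V\<close>. Small \<open>c\<close> belong to large sines,
  which reverses the order.\<close>

lemma sing_vals_sines:
  assumes V: "isometry_mat n k V" and U: "unitary_mat n U"
  defines "P \<equiv> V * V\<^sup>\<dagger>" and "c \<equiv> \<lambda>j. sing_vals (V\<^sup>\<dagger> * (U * V)) ! j"
  assumes c: "\<And>j. j < k \<Longrightarrow> 0 \<le> c j \<and> c j \<le> 1"
  shows "sing_vals ((1\<^sub>m n - P) * (U * P)) = map (\<lambda>j. sqrt (1 - (c (k - 1 - j))\<^sup>2)) [0..<k] @ replicate (n - k) 0"
proof -
  have Vc: "V \<in> carrier_mat n k" "V\<^sup>\<dagger> * V = 1\<^sub>m k" using V by (auto simp: isometry_mat_def)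
  have k: "k \<le> n" using isometry_le_dim[OF V] .
  note u = unitary_matD[OF U]
  define C where "C = V\<^sup>\<dagger> * (U * V)"
  have C: "C \<in> carrier_mat k k" using Vc u by (auto simp: C_def)
  have cC: "c = (\<lambda>i. sing_vals C ! i)" by (simp add: c_def C_def)
  obtain G where G: "unitary_mat k G" "C\<^sup>\<dagger> * C = diag_conj k G (\<lambda>i. complex_of_real ((c i)\<^sup>2))"
    and len: "length (sing_vals C) = k" "decr_nonneg (sing_vals C)"
    using sing_vals_gram[OF carrier_matD(2)[OF C]] unfolding cC by blast
  note g = unitary_matD[OF G(1)]
  have VVM: "V\<^sup>\<dagger> * (V * M) = M" if "dim_row M = k" for M
    using Vc that by (simp flip: mult_assoc_dim)
  define H where "H = V * G"
  have H: "H \<in> carrier_mat n k" "H\<^sup>\<dagger> * H = 1\<^sub>m k"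
    using Vc g by (auto simp: H_def adjoint_mult mult_assoc_dim VVM)
  obtain R where R: "R \<in> carrier_mat n n" "R\<^sup>\<dagger> * R = 1\<^sub>m n" "take_cols k R = H"
    using isometry_extend[OF H k] .
  have uR: "unitary_mat n R" using R by (simp add: isometry_mat_def)
  define d where "d j = (if j < k then sqrt (1 - (c j)\<^sup>2) else 0)" for j
  have c2: "(c j)\<^sup>2 \<le> 1" if "j < k" for j using c[OF that] by (simp add: power_le_one)
  let ?B = "(1\<^sub>m n - P) * (U * P)"
  have Pc: "P \<in> carrier_mat n n" "P\<^sup>\<dagger> = P" using Vc by (auto simp: P_def adjoint_mult)
  have "?B\<^sup>\<dagger> * ?B = P * (U\<^sup>\<dagger> * ((1\<^sub>m n - P) * ((1\<^sub>m n - P) * (U * P))))"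
    using Pc u by (simp add: adjoint_mult adjoint_minus mult_assoc_dim)
  also have "(1\<^sub>m n - P) * ((1\<^sub>m n - P) * (U * P)) = (1\<^sub>m n - P) * (U * P)"
  proof -
    have "P * P = P" using Vc by (simp add: P_def mult_assoc_dim VVM)
    then have "(1\<^sub>m n - P) * (1\<^sub>m n - P) = 1\<^sub>m n - P"
      using Pc by (simp add: mat_dist) (intro eq_matI, auto)
    then show ?thesis using Pc u by (simp flip: mult_assoc_dim)
  qed
  also have "P * (U\<^sup>\<dagger> * ((1\<^sub>m n - P) * (U * P))) = V * (V\<^sup>\<dagger> - (C\<^sup>\<dagger> * C) * V\<^sup>\<dagger>)"
    using Vc u U by (simp add: P_def C_def mat_dist VVM)
  also have "(C\<^sup>\<dagger> * C) * V\<^sup>\<dagger> = G * (mat_diag k (\<lambda>i. complex_of_real ((c i)\<^sup>2)) * H\<^sup>\<dagger>)"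
    unfolding G(2) using Vc g by (simp add: diag_conj_def H_def adjoint_mult mult_assoc_dim)
  also have "V\<^sup>\<dagger> - \<dots> = G * (mat_diag k (\<lambda>_. 1) * H\<^sup>\<dagger>) - \<dots>"
    using Vc g G(1) by (simp add: H_def adjoint_mult)
  also have "V * \<dots> = diag_conj k H (\<lambda>_. 1) - diag_conj k H (\<lambda>i. complex_of_real ((c i)\<^sup>2))"
    using Vc g H by (simp add: diag_conj_def mat_dist H_def)
  also have "\<dots> = diag_conj k H (\<lambda>i. 1 - complex_of_real ((c i)\<^sup>2))" using H by (simp add: diag_conj_minus)
  also have "\<dots> = diag_conj n R (\<lambda>i. complex_of_real ((d i)\<^sup>2))"
  proof (rule eq_matI)
    fix i j assume "i < dim_row (diag_conj n R (\<lambda>i. complex_of_real ((d i)\<^sup>2)))"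
      "j < dim_col (diag_conj n R (\<lambda>i. complex_of_real ((d i)\<^sup>2)))"
    then have ij: "i < n" "j < n" using R by auto
    have "diag_conj n R (\<lambda>i. complex_of_real ((d i)\<^sup>2)) $$ (i,j)
        = (\<Sum>p<n. R $$ (i,p) * complex_of_real ((d p)\<^sup>2) * cnj (R $$ (j,p)))"
      using ij R by (subst diag_conj_index) auto
    also have "\<dots> = (\<Sum>p<k. H $$ (i,p) * (1 - complex_of_real ((c p)\<^sup>2)) * cnj (H $$ (j,p)))"
      unfolding R(3)[symmetric] using k R(1) ij c2
      by (intro sum.mono_neutral_cong_right) (auto simp: d_def)
    also have "\<dots> = diag_conj k H (\<lambda>i. 1 - complex_of_real ((c i)\<^sup>2)) $$ (i,j)"
      using ij H by (subst diag_conj_index) auto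
    finally show "diag_conj k H (\<lambda>i. 1 - complex_of_real ((c i)\<^sup>2)) $$ (i,j) = diag_conj n R (\<lambda>i. complex_of_real ((d i)\<^sup>2)) $$ (i,j)" ..
  qed (use H R in auto)
  finally have "sing_vals ?B = decreasing_sort (map d [0..<n])"
    using c2 by (intro sing_vals_eqI[OF uR]) (auto simp: d_def)
  also have "\<dots> = map (\<lambda>j. sqrt (1 - (c (k - 1 - j))\<^sup>2)) [0..<k] @ replicate (n - k) 0"
  proof (rule decreasing_sort_id)
    have c_decr: "c j \<le> c i" if "i \<le> j" "j < k" for i j
      using len that unfolding c_def C_def by (simp add: decr_nonneg_def)
    have "sqrt (1 - (c (k - 1 - j))\<^sup>2) \<le> sqrt (1 - (c (k - 1 - i))\<^sup>2)" if "i \<le> j" "j < k" for i j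
      using c_decr[of "k - 1 - j" "k - 1 - i"] c[of "k - 1 - i"] c[of "k - 1 - j"] that
      by (intro real_sqrt_le_mono diff_left_mono power_mono) auto
    moreover have "0 \<le> sqrt (1 - (c (k - 1 - j))\<^sup>2)" if "j < k" for j
      using c2[of "k - 1 - j"] that by simp
    ultimately show "decr_nonneg (map (\<lambda>j. sqrt (1 - (c (k - 1 - j))\<^sup>2)) [0..<k] @ replicate (n - k) 0)"
      by (auto simp: decr_nonneg_def nth_append)
    have "map (\<lambda>j. sqrt (1 - (c (k - 1 - j))\<^sup>2)) [0..<k] = rev (map d [0..<k])"
      by (intro nth_equalityI) (auto simp: rev_nth d_def)
    moreover have "map d [0..<n] = map d [0..<k] @ replicate (n - k) 0"
      using k by (intro nth_equalityI) (auto simp: nth_append d_def)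
    ultimately show "mset (map (\<lambda>j. sqrt (1 - (c (k - 1 - j))\<^sup>2)) [0..<k] @ replicate (n - k) 0) = mset (map d [0..<n])"
      by simp
  qed
  finally show ?thesis .
qed

text \<open>The sines of the angles are the leading singular values of \<open>(1 - P) e\<^sup>i\<^sup>X P\<close>, where \<open>P\<close>
  projects onto \<open>S\<close>.\<close>

lemma principal_angles_assertion_holds: "principal_angles_assertion"
  unfolding principal_angles_assertion_def
proof (intro allI impI)
  fix n :: nat and S T X
  assume S: "VectorSpace.subspace class_ring S (module_vec TYPE(complex) n)"
    and X: "hermitian_mat n X" and T: "(\<lambda>v. mat_exp (\<i> \<cdot>\<^sub>m X) *\<^sub>v v) ` S = T"
  define U where "U = mat_exp (\<i> \<cdot>\<^sub>m X)"
  obtain Q x where Q: "unitary_mat n Q" and Ud: "U = diag_conj n Q (\<lambda>p. exp (\<i> * complex_of_real (x p)))"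
    using hermitian_exp[OF X] unfolding U_def by metis
  have U: "unitary_mat n U" unfolding Ud by (rule unitary_diag_conj[OF Q]) simp
  note u = unitary_matD[OF U]
  obtain k V where V: "isometry_mat n k V" "range_mat V = S" using subspace_isometry[OF S] .
  have Vc: "V \<in> carrier_mat n k" "V\<^sup>\<dagger> * V = 1\<^sub>m k" using V by (auto simp: isometry_mat_def)
  have k: "k \<le> n" using isometry_le_dim[OF V(1)] .
  have W: "isometry_mat n k (U * V)"
    using Vc u U by (auto simp: isometry_mat_def adjoint_mult mult_assoc_dim)
  have "range_mat (U * V) = (\<lambda>v. U *\<^sub>v v) ` range_mat V"
    using Vc u by (auto simp: range_mat_def image_image mult_vec_assoc_dim)
  then have WT: "range_mat (U * V) = T" using T V(2) by (simp add: U_def)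
  define c where "c j = sing_vals (V\<^sup>\<dagger> * (U * V)) ! j" for j
  define \<theta> where "\<theta> j = arccos (c (k - 1 - j))" for j
  have angles: "principal_angles n S T = map \<theta> [0..<k]"
    unfolding \<theta>_def c_def using principal_angles_eq(1)[OF V W WT] .
  have c: "0 \<le> c j \<and> c j \<le> 1" if "j < k" for j
    unfolding c_def using principal_angles_eq(2)[OF V W WT that] .
  have c_decr: "c j \<le> c i" if "i \<le> j" "j < k" for i j
    using that Vc u length_sing_vals[of "V\<^sup>\<dagger> * (U * V)" k] decr_nonneg_sing_vals[of "V\<^sup>\<dagger> * (U * V)" k]
    by (auto simp: c_def decr_nonneg_def)
  have \<theta>: "0 \<le> \<theta> j" "\<theta> j \<le> pi / 2" if "j < k" for j
    unfolding \<theta>_def using c[of "k - 1 - j"] that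
      arccos_lbound[of "c (k - 1 - j)"] arccos_le_pi2[of "c (k - 1 - j)"] by auto
  have \<theta>_decr: "\<theta> j \<le> \<theta> i" if "i \<le> j" "j < k" for i j
    unfolding \<theta>_def using c_decr[of "k - 1 - j" "k - 1 - i"] c[of "k - 1 - j"] c[of "k - 1 - i"] that
    by (subst arccos_le_mono) auto
  define P where "P = V * V\<^sup>\<dagger>"
  have P: "P \<in> carrier_mat n n" "P\<^sup>\<dagger> = P" "P * P = P"
  proof -
    have "V\<^sup>\<dagger> * (V * V\<^sup>\<dagger>) = V\<^sup>\<dagger>" using Vc by (simp flip: mult_assoc_dim)
    then show "P * P = P" using Vc by (simp add: P_def mult_assoc_dim)
  qed (use Vc in \<open>auto simp: P_def adjoint_mult\<close>)
  have sv: "sing_vals ((1\<^sub>m n - P) * (U * P)) = map (\<lambda>j. sqrt (1 - (c (k - 1 - j))\<^sup>2)) [0..<k] @ replicate (n - k) 0"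
    unfolding P_def c_def by (rule sing_vals_sines[OF V(1) U]) (use c in \<open>simp add: c_def\<close>)
  have arc: "arcsin (sing_vals ((1\<^sub>m n - P) * (U * P)) ! j) = \<theta> j" if "j < k" for j
  proof -
    have "sing_vals ((1\<^sub>m n - P) * (U * P)) ! j = sin (\<theta> j)"
      unfolding sv \<theta>_def using that c[of "k - 1 - j"] by (simp add: nth_append sin_arccos)
    then show ?thesis using \<theta>[OF that] by (simp add: arcsin_sin)
  qed
  have bound: "(\<Sum>j<m. \<theta> j) \<le> (\<Sum>j<min m (n div 2). spr_plus X ! j) / 2" if "m \<le> k" for m
    using angle_sum_bound[OF X P, of m] arc that k by (simp add: U_def)
  note len = length_spr_plus[OF X] and dn = decr_nonneg_spr_plus[OF X]
  show "principal_angles n S T \<prec>\<^sub>w map ((*) (1/2)) (spr_plus X)"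
    unfolding angles
  proof (rule submajorizedI)
    show "decr_nonneg (map \<theta> [0..<k])" using \<theta> \<theta>_decr by (auto simp: decr_nonneg_def)
    show "decr_nonneg (map ((*) (1/2)) (spr_plus X))" using dn by (auto simp: decr_nonneg_def)
    fix j
    have "(\<Sum>i<min j k. \<theta> i) \<le> (\<Sum>i<min (min j k) (n div 2). spr_plus X ! i) / 2" by (rule bound) simp
    also have "(\<Sum>i<min (min j k) (n div 2). spr_plus X ! i) \<le> (\<Sum>i<min j (n div 2). spr_plus X ! i)"
      using dn len by (intro sum_mono2) (auto simp: decr_nonneg_def)
    finally show "(\<Sum>i<min j (length (map \<theta> [0..<k])). map \<theta> [0..<k] ! i)
        \<le> (\<Sum>i<min j (length (map ((*) (1/2)) (spr_plus X))). map ((*) (1/2)) (spr_plus X) ! i)"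
      by (simp add: len sum_divide_distrib)
  qed
qed

theorem theorem3p7:
  shows "(difference_assertion \<longleftrightarrow> off_diagonal_assertion) \<and>
         (off_diagonal_assertion \<longleftrightarrow> generalized_commutator_assertion) \<and>
         (generalized_commutator_assertion \<longleftrightarrow> unitary_conjugation_assertion) \<and>
         (unitary_conjugation_assertion \<longleftrightarrow> principal_angles_assertion)"
  using difference_assertion_holds off_diagonal_assertion_holds
    generalized_commutator_assertion_holds unitary_conjugation_assertion_holds
    principal_angles_assertion_holds
  by simp

end
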